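(* For $1\le p\le t-1$ and $R'=\tau_pR$, one has $\chi_{R'}(\tau_pw)=\tau_p(\chi_R(w))$ for all $w\in W(R)$.
   Context: $\sim_K$ is Knuth equivalence; $w|_B$ is the subword of $w$ of letters in $B$; tableaux are in English notation, column-strict meaning rows weakly increase and columns strictly increase; $\mathrm{word}(T)=\dotsb u^2u^1$ with $u^i$ the $i$-th row of $T$ read left to right; $P(w)$, $Q(w)$ are the Schensted row-insertion and recording tableaux. $R=(R_1,\dots,R_t)$ is a sequence of rectangular partitions, $R_i$ with $\eta_i$ rows and $\mu_i$ columns; $n=\sum\eta_i$; $A_i=\{\eta_1+\dots+\eta_{i-1}+1,\dots,\eta_1+\dots+\eta_i\}$; $Y_i$ is the column-strict tableau of shape $R_i$ whose $j$-th row consists of $\mu_i$ copies of $\eta_1+\dots+\eta_{i-1}+j$. $W(R)$ is the set of words $w$ in $[n]$ with $w|_{A_i}\sim_K\mathrm{word}(Y_i)$ for all $i$; $\mathrm{LRT}(\lambda;R)$ is the set of column-strict tableaux of shape $\lambda$ with word in $W(R)$. Rectangle switching: $\tau_pR=(R_1,\dots,R_{p-1},R_{p+1},R_p,R_{p+2},\dots,R_t)$. For $t=2$, $\tau_1:\mathrm{LRT}(\lambda;(R_1,R_2))\to\mathrm{LRT}(\lambda;(R_2,R_1))$ is the unique map (both sets are empty or singletons of equal size) and $\tau_1:W((R_1,R_2))\to W((R_2,R_1))$ is defined by $P(\tau_1w)=\tau_1P(w)$, $Q(\tau_1w)=Q(w)$. For general $t$, $\tau_pw$ is obtained from $w\in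 W(R)$ by replacing the subword $w|_{A_p\cup A_{p+1}}$ (same positions) by its image under the two-rectangle map for $(R_p,R_{p+1})$ (letters shifted down by $\eta_1+\dots+\eta_{p-1}$ and back up); $\tau_pw\in W(\tau_pR)$. Cyclage map: for $1\le r\le n-1$ and a word $u$, regard letters $r$ as right parentheses and $r+1$ as left parentheses, match them, leaving an unmatched subword $r^a(r+1)^b$; $s_ru$ replaces it by $r^b(r+1)^a$. These give an action of $S_n$ on words. $w_0^R$ is the longest element of the Young subgroup of $S_n$ stabilizing each $A_i$. For $w=ux$ with $x$ a letter, $\chi_R(w)=(w_0^Rx)(w_0^Ru)$; $\chi_R$ maps $W(R)$ to itself. *)

theory Defs
  imports Main
begin

(* Words are nat lists; letters live in {1..n}.  Tableaux are lists of rows (row 1 first). *)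

definition knuth_step :: "nat list \<Rightarrow> nat list \<Rightarrow> bool" where
  "knuth_step u v \<longleftrightarrow>
     (\<exists>a b x y z. u = a @ [x, z, y] @ b \<and> v = a @ [z, x, y] @ b \<and> x \<le> y \<and> y < z) \<or>
     (\<exists>a b x y z. u = a @ [y, x, z] @ b \<and> v = a @ [y, z, x] @ b \<and> x < y \<and> y \<le> z)"

definition knuth_equiv :: "nat list \<Rightarrow> nat list \<Rightarrow> bool" where
  "knuth_equiv = equivclp knuth_step"

definition shape :: "nat list list \<Rightarrow> nat list" where
  "shape T = map length T"

definition is_partition :: "nat list \<Rightarrow> bool" where
  "is_partition lam \<longleftrightarrow> (\<forall>i<length lam. lam ! i > 0) \<and> sorted_wrt (\<ge>) lam"

definition column_strict :: "nat list list \<Rightarrow> bool" where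
  "column_strict T \<longleftrightarrow> is_partition (shape T) \<and> (\<forall>r\<in>set T. sorted r) \<and>
     (\<forall>i j. Suc i < length T \<and> j < length (T ! Suc i) \<longrightarrow> T ! i ! j < T ! Suc i ! j)"

definition tword :: "nat list list \<Rightarrow> nat list" where
  "tword T = concat (rev T)"

fun row_ins :: "nat \<Rightarrow> nat list \<Rightarrow> nat list \<times> nat option" where
  "row_ins x [] = ([x], None)"
| "row_ins x (y # ys) = (if x < y then (x # ys, Some y)
     else (let (ys', b) = row_ins x ys in (y # ys', b)))"

fun tab_ins :: "nat \<Rightarrow> nat list list \<Rightarrow> nat list list" where
  "tab_ins x [] = [[x]]"
| "tab_ins x (r # rs) = (case row_ins x r of
      (r', None) \<Rightarrow> r' # rs
    | (r', Some y) \<Rightarrow> r' # tab_ins y rs)"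

definition new_box_row :: "nat list list \<Rightarrow> nat list list \<Rightarrow> nat" where
  "new_box_row T T' = (LEAST i. length T \<le> i \<or> length (T' ! i) \<noteq> length (T ! i))"

definition rsk_step :: "nat list list \<times> nat list list \<Rightarrow> nat \<times> nat \<Rightarrow> nat list list \<times> nat list list" where
  "rsk_step PQ kx = (let (P, Q) = PQ; (k, x) = kx; P' = tab_ins x P; i = new_box_row P P' in
      (P', if i < length Q then Q[i := Q ! i @ [k]] else Q @ [[k]]))"

definition rsk :: "nat list \<Rightarrow> nat list list \<times> nat list list" where
  "rsk w = foldl rsk_step ([], []) (zip [1..<Suc (length w)] w)"

definition Ptab :: "nat list \<Rightarrow> nat list list" where "Ptab w = fst (rsk w)"
definition Qtab :: "nat list \<Rightarrow> nat list list" where "Qtab w = snd (rsk w)"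

(* R is a list of rectangles (eta_i, mu_i) = (number of rows, number of columns);
   indices are 0-based in the list, i.e. R ! (i-1) is the paper's R_i. *)

definition offs :: "(nat \<times> nat) list \<Rightarrow> nat \<Rightarrow> nat" where
  "offs R i = sum_list (map fst (take i R))"

definition total :: "(nat \<times> nat) list \<Rightarrow> nat" where
  "total R = sum_list (map fst R)"

definition blk :: "(nat \<times> nat) list \<Rightarrow> nat \<Rightarrow> nat set" where
  "blk R i = {offs R i + 1 .. offs R i + fst (R ! i)}"

definition Ytab :: "(nat \<times> nat) list \<Rightarrow> nat \<Rightarrow> nat list list" where
  "Ytab R i = map (\<lambda>j. replicate (snd (R ! i)) (offs R i + j)) [1..<Suc (fst (R ! i))]"

definition Wset :: "(nat \<times> nat) list \<Rightarrow> nat list set" where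
  "Wset R = {w. set w \<subseteq> {1..total R} \<and>
     (\<forall>i<length R. knuth_equiv (filter (\<lambda>x. x \<in> blk R i) w) (tword (Ytab R i)))}"

definition LRT :: "nat list \<Rightarrow> (nat \<times> nat) list \<Rightarrow> nat list list set" where
  "LRT lam R = {T. column_strict T \<and> shape T = lam \<and> tword T \<in> Wset R}"

definition tau_tab2 :: "nat \<times> nat \<Rightarrow> nat \<times> nat \<Rightarrow> nat list list \<Rightarrow> nat list list" where
  "tau_tab2 R1 R2 T = (THE T'. T' \<in> LRT (shape T) [R2, R1])"

definition tau_word2 :: "nat \<times> nat \<Rightarrow> nat \<times> nat \<Rightarrow> nat list \<Rightarrow> nat list" where
  "tau_word2 R1 R2 w = (THE w'. Ptab w' = tau_tab2 R1 R2 (Ptab w) \<and> Qtab w' = Qtab w)"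

definition fill_pos :: "nat set \<Rightarrow> nat list \<Rightarrow> nat list \<Rightarrow> nat list" where
  "fill_pos S w vs = map (\<lambda>i. if i \<in> S then vs ! card {j\<in>S. j < i} else w ! i) [0..<length w]"

(* paper's tau_p R, p 1-based *)
definition tauR :: "nat \<Rightarrow> (nat \<times> nat) list \<Rightarrow> (nat \<times> nat) list" where
  "tauR p R = R[p - 1 := R ! p, p := R ! (p - 1)]"

(* paper's tau_p w for w in W(R), p 1-based *)
definition tauW :: "nat \<Rightarrow> (nat \<times> nat) list \<Rightarrow> nat list \<Rightarrow> nat list" where
  "tauW p R w = (let off = offs R (p - 1);
       B = blk R (p - 1) \<union> blk R p;
       v = map (\<lambda>x. x - off) (filter (\<lambda>x. x \<in> B) w);
       v' = tau_word2 (R ! (p - 1)) (R ! p) v;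
       S = {i. i < length w \<and> w ! i \<in> B}
     in fill_pos S w (map (\<lambda>x. x + off) v'))"

(* positions of matched letters: r = right parenthesis, r+1 = left parenthesis *)
fun matched_aux :: "nat \<Rightarrow> nat list \<Rightarrow> nat \<Rightarrow> nat list \<Rightarrow> nat set" where
  "matched_aux r st i [] = {}"
| "matched_aux r st i (x # xs) =
     (if x = Suc r then matched_aux r (i # st) (Suc i) xs
      else if x = r \<and> st \<noteq> [] then {i, hd st} \<union> matched_aux r (tl st) (Suc i) xs
      else matched_aux r st (Suc i) xs)"

definition s_op :: "nat \<Rightarrow> nat list \<Rightarrow> nat list" where
  "s_op r u = (let U = {i. i < length u \<and> (u ! i = r \<or> u ! i = Suc r)} - matched_aux r [] 0 u;
       a = card {i\<in>U. u ! i = r};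
       b = card {i\<in>U. u ! i = Suc r}
     in fill_pos U u (replicate b r @ replicate a (Suc r)))"

fun act_gens :: "nat list \<Rightarrow> nat list \<Rightarrow> nat list" where
  "act_gens [] u = u"
| "act_gens (r # rs) u = s_op r (act_gens rs u)"

definition transp_fun :: "nat \<Rightarrow> nat \<Rightarrow> nat" where
  "transp_fun r k = (if k = r then Suc r else if k = Suc r then r else k)"

fun gens_prod :: "nat list \<Rightarrow> nat \<Rightarrow> nat" where
  "gens_prod [] = id"
| "gens_prod (r # rs) = transp_fun r \<circ> gens_prod rs"

(* action of a permutation pi of {1..n} (identity outside) on words *)
definition act_perm :: "nat \<Rightarrow> (nat \<Rightarrow> nat) \<Rightarrow> nat list \<Rightarrow> nat list" where
  "act_perm n pi u = act_gens (SOME rs. set rs \<subseteq> {1..<n} \<and> gens_prod rs = pi) u"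

(* longest element w_0^R of the Young subgroup stabilizing each A_i *)
definition w0R :: "(nat \<times> nat) list \<Rightarrow> nat \<Rightarrow> nat" where
  "w0R R k = (if \<exists>i<length R. k \<in> blk R i
      then (let i = (THE i. i < length R \<and> k \<in> blk R i) in 2 * offs R i + fst (R ! i) + 1 - k)
      else k)"

definition chi :: "(nat \<times> nat) list \<Rightarrow> nat list \<Rightarrow> nat list" where
  "chi R w = (if w = [] then [] else
     act_perm (total R) (w0R R) [last w] @ act_perm (total R) (w0R R) (butlast w))"

end

theory Submission
  imports Defs
begin

text \<open>
  Identify a word with the pair of its insertion and recording tableaux. The crystal raising
  operators \<open>E r\<close> commute with Knuth equivalence and preserve the recording tableau, so the
  reflections \<open>s_op r\<close> do too; reducing the braid relation to tableaux on three letters shows that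
  they define an action of the symmetric group. On a block whose restricted word is Knuth equivalent
  to a rectangle, the cyclage of a last letter \<open>x\<close> of that block moves only this block, so everything
  reduces to two rectangles. There the Littlewood--Richardson tableaux are determined by their shape,
  and the two orders of the rectangles admit the same shapes, so it suffices to see that
  \<open>chi w\<close> and \<open>chi (tau w)\<close> have the same recording tableau. Writing \<open>w = u x\<close>, this recording
  tableau is determined by that of \<open>u\<close> and by the shape of \<open>chi w\<close>. At most two admissible shapes
  cover the shape of \<open>u\<close>; if there are two, bounds on the rows and columns where insertion can end
  force the cyclage to exchange them, for either order of the rectangles.
\<close>

section \<open>Knuth equivalence\<close>

text \<open>The action of a permutation is defined through some chosen word in the generators, so
  independence of that word must be proved; this needs the braid relation and the fact that the
  Coxeter relations present the symmetric group. Recording tableaux grow at the right end of a word,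
  whereas cyclage puts a letter at the left end. Highest weight words bridge this: their content is
  their shape, so the first letter of such a word with highest weight tail is the index of the row
  that receives the new box. Letters of the crystal start at \<open>0\<close> because rows are
  numbered from \<open>0\<close>; blocks of letters are translated where content and shape are
  compared. Two admissible shapes covering that of \<open>u\<close> add their boxes in rows
  \<open>c\<close> and \<open>m + e - 1 - c\<close>. If the last letter lies in the first block, the
  box removed is in the first \<open>mu\<close> columns and the box added in the first
  \<open>m\<close> rows; otherwise the box removed is in the first \<open>e\<close> rows and the box
  added in the first \<open>nu\<close> columns. Either pair of bounds rules out that the same box is
  removed and added when there is a choice.\<close>

lemma knuth_refl [simp, intro]: "knuth_equiv u u"
  by (simp add: knuth_equiv_def)

lemma knuth_sym: "knuth_equiv u v \<Longrightarrow> knuth_equiv v u"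
  unfolding knuth_equiv_def by (rule equivclp_sym)

lemma knuth_trans [trans]: "knuth_equiv u v \<Longrightarrow> knuth_equiv v w \<Longrightarrow> knuth_equiv u w"
  unfolding knuth_equiv_def by (rule equivclp_trans)

lemma knuth_stepI: "knuth_step u v \<Longrightarrow> knuth_equiv u v"
  unfolding knuth_equiv_def by (rule r_into_equivclp)

lemma knuth_induct [consumes 1, case_names refl step]:
  assumes "knuth_equiv u v" "P u"
    and "\<And>v w. knuth_equiv u v \<Longrightarrow> knuth_step v w \<or> knuth_step w v \<Longrightarrow> P v \<Longrightarrow> P w"
  shows "P v"
  using assms(1)[unfolded knuth_equiv_def]
  by (induction rule: equivclp_induct) (use assms(2,3) in \<open>auto simp: knuth_equiv_def\<close>)

lemma knuth_step_cases [consumes 1, case_names xzy yxz]: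
  assumes "knuth_step u v"
  obtains a b x y z where "u = a @ [x, z, y] @ b" "v = a @ [z, x, y] @ b" "x \<le> y" "y < z"
  | a b x y z where "u = a @ [y, x, z] @ b" "v = a @ [y, z, x] @ b" "x < y" "y \<le> z"
  using assms unfolding knuth_step_def by blast

lemma knuth_xzy: "x \<le> y \<Longrightarrow> y < z \<Longrightarrow> knuth_equiv (a @ x # z # y # b) (a @ z # x # y # b)"
  by (rule knuth_stepI) (auto simp: knuth_step_def)

lemma knuth_yxz: "x < y \<Longrightarrow> y \<le> z \<Longrightarrow> knuth_equiv (a @ y # x # z # b) (a @ y # z # x # b)"
  by (rule knuth_stepI) (simp add: knuth_step_def, blast)

lemma knuth_invariant:
  assumes "knuth_equiv u v" and "\<And>u v. knuth_step u v \<Longrightarrow> f u = f v"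
  shows "f u = f v"
  using assms(1) by (induction rule: knuth_induct) (use assms(2) in force)+

lemma knuth_lift:
  assumes "knuth_equiv u v" and "\<And>u v. knuth_step u v \<Longrightarrow> knuth_equiv (f u) (f v)"
  shows "knuth_equiv (f u) (f v)"
  using assms(1)
  by (induction rule: knuth_induct) (use assms(2) in \<open>blast intro: knuth_trans knuth_sym\<close>)+

lemma knuth_append_left: "knuth_equiv u v \<Longrightarrow> knuth_equiv (c @ u) (c @ v)"
proof (erule knuth_lift)
  fix u v assume "knuth_step u v"
  then show "knuth_equiv (c @ u) (c @ v)"
  proof (cases rule: knuth_step_cases)
    case (xzy a b x y z)
    then show ?thesis using knuth_xzy[of x y z "c @ a" b] by simp
  next
    case (yxz a b x y z)
    then show ?thesis using knuth_yxz[of x y z "c @ a" b] by simp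
  qed
qed

lemma knuth_append_right: "knuth_equiv u v \<Longrightarrow> knuth_equiv (u @ c) (v @ c)"
proof (erule knuth_lift)
  fix u v assume "knuth_step u v"
  then show "knuth_equiv (u @ c) (v @ c)"
  proof (cases rule: knuth_step_cases)
    case (xzy a b x y z)
    then show ?thesis using knuth_xzy[of x y z a "b @ c"] by simp
  next
    case (yxz a b x y z)
    then show ?thesis using knuth_yxz[of x y z a "b @ c"] by simp
  qed
qed

lemma knuth_count: "knuth_equiv u v \<Longrightarrow> count_list u k = count_list v k"
  by (erule knuth_invariant) (auto elim!: knuth_step_cases)

lemma knuth_set: "knuth_equiv u v \<Longrightarrow> set u = set v"
  by (erule knuth_invariant) (auto elim!: knuth_step_cases)

lemma knuth_map_add: "knuth_equiv u v \<Longrightarrow> knuth_equiv (map (\<lambda>x. x + k) u) (map (\<lambda>x. x + k) v)"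
proof (erule knuth_lift)
  fix u v assume "knuth_step u v"
  then show "knuth_equiv (map (\<lambda>x. x + k) u) (map (\<lambda>x. x + k) v)"
  proof (cases rule: knuth_step_cases)
    case (xzy a b x y z)
    then show ?thesis using knuth_xzy[of "x + k" "y + k" "z + k"] by simp
  next
    case (yxz a b x y z)
    then show ?thesis using knuth_yxz[of "x + k" "y + k" "z + k"] by simp
  qed
qed

section \<open>Parenthesis matching\<close>

text \<open>Reading left to right with \<open>k\<close> pending left parentheses \<open>Suc r\<close>, \<open>epsA r w k\<close> left
  parentheses remain unmatched; dually \<open>phiA r w k\<close> counts the unmatched right parentheses
  \<open>r\<close> when \<open>k\<close> of them follow \<open>w\<close>.\<close>

fun epsA :: "nat \<Rightarrow> nat list \<Rightarrow> nat \<Rightarrow> nat" where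
  "epsA r [] k = k"
| "epsA r (x # xs) k = epsA r xs (if x = Suc r then Suc k else if x = r then k - 1 else k)"

fun phiA :: "nat \<Rightarrow> nat list \<Rightarrow> nat \<Rightarrow> nat" where
  "phiA r [] k = k"
| "phiA r (x # xs) k = (if x = r then Suc (phiA r xs k) else if x = Suc r then phiA r xs k - 1
     else phiA r xs k)"

abbreviation "eps r w \<equiv> epsA r w 0"
abbreviation "phi r w \<equiv> phiA r w 0"

lemma epsA_append [simp]: "epsA r (u @ v) k = epsA r v (epsA r u k)"
  by (induction u arbitrary: k) auto

lemma phiA_append [simp]: "phiA r (u @ v) k = phiA r u (phiA r v k)"
  by (induction u arbitrary: k) auto

text \<open>Of \<open>k\<close> left parentheses pending at the start, \<open>phi r w\<close> can be
  absorbed by the right parentheses that \<open>w\<close> itself leaves unmatched; the rest stay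
  pending. All interaction between parts of a concatenation goes through these two numbers.\<close>

lemma epsA_eq: "epsA r w k = eps r w + (k - phi r w)"
proof (induction w arbitrary: k)
  case (Cons x w)
  have "epsA r w (Suc 0) = eps r w + (Suc 0 - phi r w)" by (rule Cons.IH)
  moreover have "epsA r w (Suc k) = eps r w + (Suc k - phi r w)" by (rule Cons.IH)
  moreover have "epsA r w (k - 1) = eps r w + (k - 1 - phi r w)" by (rule Cons.IH)
  moreover have "epsA r w k = eps r w + (k - phi r w)" by (rule Cons.IH)
  ultimately show ?case by auto
qed simp

lemma phiA_eq: "phiA r w k = phi r w + (k - eps r w)"
proof (induction w arbitrary: k)
  case (Cons x w)
  have "epsA r w (Suc 0) = eps r w + (Suc 0 - phi r w)" by (rule epsA_eq)
  with Cons[of k] show ?case by auto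
qed simp

text \<open>Matched letters come in pairs and cancel.\<close>

lemma eps_phi_count: "phi r w + count_list w (Suc r) = eps r w + count_list w r"
proof (induction w)
  case (Cons x w)
  have "epsA r w (Suc 0) = eps r w + (Suc 0 - phi r w)" by (rule epsA_eq)
  with Cons show ?case by auto
qed simp

lemma phi_prefix: "phi r (u @ v) = 0 \<Longrightarrow> phi r u = 0"
  using phiA_eq[of r u "phi r v"] by simp

lemma eps_suffix: "eps r (u @ v) = 0 \<Longrightarrow> eps r v = 0"
  using epsA_eq[of r v "eps r u"] by simp

lemma epsA_ge: "count_list w r = 0 \<Longrightarrow> epsA r w k \<ge> k"
proof (induction w arbitrary: k)
  case (Cons x w)
  show ?case using Cons.IH[of k] Cons.IH[of "Suc k"] Cons.prems by (auto split: if_splits)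
qed simp

lemma epsA_outside: "r \<notin> set w \<Longrightarrow> Suc r \<notin> set w \<Longrightarrow> epsA r w k = k"
  by (induction w arbitrary: k) auto

lemma epsA_replicate [simp]:
  "epsA r (replicate n x) k = (if x = Suc r then k + n else if x = r then k - n else k)"
  by (induction n arbitrary: k) auto

lemma phiA_replicate [simp]:
  "phiA r (replicate n x) k = (if x = r then k + n else if x = Suc r then k - n else k)"
  by (induction n arbitrary: k) auto

lemma epsA_filter: "r \<in> B \<Longrightarrow> Suc r \<in> B \<Longrightarrow> epsA r (filter (\<lambda>x. x \<in> B) w) k = epsA r w k"
  by (induction w arbitrary: k) auto

lemma phiA_filter: "r \<in> B \<Longrightarrow> Suc r \<in> B \<Longrightarrow> phiA r (filter (\<lambda>x. x \<in> B) w) k = phiA r w k"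
  by (induction w arbitrary: k) auto

lemma epsA_shift: "epsA (r + d) (map (\<lambda>x. x + d) w) k = epsA r w k"
  by (induction w arbitrary: k) auto

lemma phiA_shift: "phiA (r + d) (map (\<lambda>x. x + d) w) k = phiA r w k"
  by (induction w arbitrary: k) auto

lemma epsA_knuth: "knuth_equiv u v \<Longrightarrow> epsA r u k = epsA r v k"
  by (erule knuth_invariant) (auto elim!: knuth_step_cases)

lemma phiA_knuth: "knuth_equiv u v \<Longrightarrow> phiA r u k = phiA r v k"
  by (erule knuth_invariant) (auto elim!: knuth_step_cases)

section \<open>The raising relation\<close>

text \<open>\<open>E r w w'\<close>: the leftmost unmatched \<open>Suc r\<close> of \<open>w\<close> is turned into \<open>r\<close>, which is
  then the rightmost unmatched \<open>r\<close> of \<open>w'\<close>.\<close>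

definition E :: "nat \<Rightarrow> nat list \<Rightarrow> nat list \<Rightarrow> bool" where
  "E r w w' \<longleftrightarrow> (\<exists>a b. w = a @ Suc r # b \<and> w' = a @ r # b \<and> eps r a = 0 \<and> phi r b = 0)"

lemma EI: "eps r a = 0 \<Longrightarrow> phi r b = 0 \<Longrightarrow> E r (a @ Suc r # b) (a @ r # b)"
  unfolding E_def by blast

lemma EE:
  assumes "E r w w'"
  obtains a b where "w = a @ Suc r # b" "w' = a @ r # b" "eps r a = 0" "phi r b = 0"
  using assms unfolding E_def by blast

lemma E_count:
  assumes "E r w w'"
  shows "count_list w' r = Suc (count_list w r)" "count_list w (Suc r) = Suc (count_list w' (Suc r))"
    "k \<noteq> r \<Longrightarrow> k \<noteq> Suc r \<Longrightarrow> count_list w' k = count_list w k"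
    "sum_list w = Suc (sum_list w')" "length w' = length w"
  using assms by (auto elim!: EE)

lemma E_eps_phi:
  assumes "E r w w'"
  shows "eps r w = Suc (eps r w')" "phi r w' = Suc (phi r w)"
proof -
  obtain a b where w: "w = a @ Suc r # b" "w' = a @ r # b" "eps r a = 0" "phi r b = 0"
    using assms by (rule EE)
  show "eps r w = Suc (eps r w')" using w epsA_eq[of r b "Suc 0"] by simp
  show "phi r w' = Suc (phi r w)" using w phiA_eq[of r a "Suc 0"] by simp
qed

lemma append_Cons_cases:
  assumes "a @ x # b = a' @ y # b'"
  shows "(a = a' \<and> x = y \<and> b = b') \<or> (\<exists>c. a' = a @ x # c \<and> b = c @ y # b') \<or>
    (\<exists>c. a = a' @ y # c \<and> b' = c @ x # b)"
  using assms by (auto simp: append_eq_append_conv2 Cons_eq_append_conv append_eq_Cons_conv)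

lemma E_unique:
  assumes "E r w u" "E r w v" shows "u = v"
proof -
  \<comment> \<open>Two admissible positions would enclose such a \<open>c\<close>: the first
    \<open>Suc r\<close> must be matched inside \<open>c\<close>, but \<open>c\<close> has no free
    \<open>r\<close>.\<close>
  have *: False if "eps r (a @ Suc r # c) = 0" "phi r (c @ Suc r # b) = 0" for a b c
  proof -
    have "eps r (Suc r # c) = 0" using eps_suffix that(1) by blast
    then have "eps r c + (Suc 0 - phi r c) = 0" using epsA_eq[of r c "Suc 0"] by simp
    moreover have "phi r c = 0" using phi_prefix that(2) by blast
    ultimately show False by simp
  qed
  obtain a b where w: "w = a @ Suc r # b" "u = a @ r # b" "eps r a = 0" "phi r b = 0"
    using assms(1) by (rule EE)
  obtain a' b' where w': "w = a' @ Suc r # b'" "v = a' @ r # b'" "eps r a' = 0" "phi r b' = 0"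
    using assms(2) by (rule EE)
  from append_Cons_cases[of a "Suc r" b a' "Suc r" b'] w w' * show ?thesis by (metis (no_types))
qed

lemma E_inj:
  assumes "E r u w" "E r v w" shows "u = v"
proof -
  have *: False if "eps r (a @ r # c) = 0" "phi r (c @ r # b) = 0" for a b c
  proof -
    have "phi r (c @ [r]) = 0" using phi_prefix[of r "c @ [r]" b] that(2) by simp
    then have "phi r c + (Suc 0 - eps r c) = 0" using phiA_eq[of r c "Suc 0"] by simp
    moreover have "eps r c = 0" using eps_suffix[of r "a @ [r]" c] that(1) by simp
    ultimately show False by simp
  qed
  obtain a b where w: "u = a @ Suc r # b" "w = a @ r # b" "eps r a = 0" "phi r b = 0"
    using assms(1) by (rule EE)
  obtain a' b' where w': "v = a' @ Suc r # b'" "w = a' @ r # b'" "eps r a' = 0" "phi r b' = 0"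
    using assms(2) by (rule EE)
  from append_Cons_cases[of a r b a' r b'] w w' * show ?thesis by (metis (no_types))
qed

text \<open>The condition on \<open>b\<close> says that \<open>b\<close> leaves no \<open>r\<close>
  unmatched even if followed by one further \<open>r\<close> for each later unmatched
  \<open>Suc r\<close>; in this form it survives appending an \<open>r\<close> in the induction.
  \<open>E_exists\<close> takes \<open>j = 0\<close>.\<close>

lemma unmatched_left:
  "j < eps r w \<Longrightarrow> \<exists>a b. w = a @ Suc r # b \<and> eps r a = j \<and> phiA r b (eps r w - 1 - j) = 0"
proof (induction w rule: rev_induct)
  case (snoc x w)
  consider "x = Suc r" "j < eps r w" | "x = Suc r" "j = eps r w" | "x = r" | "x \<noteq> r" "x \<noteq> Suc r"
    using snoc.prems by fastforce
  then show ?case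
  proof cases
    case 1
    then obtain a b where "w = a @ Suc r # b" "eps r a = j" "phiA r b (eps r w - 1 - j) = 0"
      using snoc.IH by blast
    then show ?thesis using 1 by (intro exI[of _ a] exI[of _ "b @ [x]"]) (simp add: diff_right_commute)
  next
    case 2
    then show ?thesis by (intro exI[of _ w] exI[of _ "[]"]) simp
  next
    case 3
    then have "j < eps r w" "Suc (eps r w - Suc (Suc j)) = eps r w - Suc j" using snoc.prems by auto
    then obtain a b where "w = a @ Suc r # b" "eps r a = j" "phiA r b (eps r w - 1 - j) = 0"
      using snoc.IH by blast
    then show ?thesis using 3 \<open>Suc (eps r w - Suc (Suc j)) = eps r w - Suc j\<close>
      by (intro exI[of _ a] exI[of _ "b @ [x]"]) (simp add: diff_right_commute)
  next
    case 4
    then obtain a b where "w = a @ Suc r # b" "eps r a = j" "phiA r b (eps r w - 1 - j) = 0"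
      using snoc by auto
    then show ?thesis using 4 by (intro exI[of _ a] exI[of _ "b @ [x]"]) simp
  qed
qed simp

lemma unmatched_right:
  "j < phi r w \<Longrightarrow> \<exists>a b. w = a @ r # b \<and> phi r b = j \<and> epsA r a (phi r w - 1 - j) = 0"
proof (induction w)
  case (Cons x w)
  consider "x = r" "j < phi r w" | "x = r" "j = phi r w" | "x = Suc r" | "x \<noteq> r" "x \<noteq> Suc r"
    using Cons.prems by (fastforce split: if_splits)
  then show ?case
  proof cases
    case 1
    then obtain a b where "w = a @ r # b" "phi r b = j" "epsA r a (phi r w - 1 - j) = 0"
      using Cons.IH by blast
    then show ?thesis using 1 by (intro exI[of _ "x # a"] exI[of _ b]) (simp add: diff_right_commute)
  next
    case 2
    then show ?thesis by (intro exI[of _ "[]"] exI[of _ w]) simp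
  next
    case 3
    then have "j < phi r w" "Suc (phi r w - Suc (Suc j)) = phi r w - Suc j" using Cons.prems by auto
    then obtain a b where "w = a @ r # b" "phi r b = j" "epsA r a (phi r w - 1 - j) = 0"
      using Cons.IH by blast
    then show ?thesis using 3 \<open>Suc (phi r w - Suc (Suc j)) = phi r w - Suc j\<close>
      by (intro exI[of _ "x # a"] exI[of _ b]) (simp add: diff_right_commute)
  next
    case 4
    then obtain a b where "w = a @ r # b" "phi r b = j" "epsA r a (phi r w - 1 - j) = 0"
      using Cons by auto
    then show ?thesis using 4 by (intro exI[of _ "x # a"] exI[of _ b]) simp
  qed
qed simp

lemma E_exists: "0 < eps r w \<Longrightarrow> \<exists>w'. E r w w'"
proof -
  assume "0 < eps r w"
  then obtain a b where "w = a @ Suc r # b" "eps r a = 0" "phiA r b (eps r w - 1 - 0) = 0"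
    using unmatched_left by blast
  then show ?thesis using phiA_eq[of r b "eps r w - 1"] EI[of r a b] by auto
qed

lemma E_exists_inv: "0 < phi r w \<Longrightarrow> \<exists>w'. E r w' w"
proof -
  assume "0 < phi r w"
  then obtain a b where "w = a @ r # b" "phi r b = 0" "epsA r a (phi r w - 1 - 0) = 0"
    using unmatched_right by blast
  then show ?thesis using epsA_eq[of r a "phi r w - 1"] EI[of r a b] by auto
qed

text \<open>A Knuth move replaces a factor \<open>s\<close> by \<open>t\<close>. Both act alike on
  pending parentheses, so a letter raised outside the factor is raised at the same place after the
  move; only a letter inside the factor needs an argument.\<close>

lemma E_knuth_context:
  assumes E: "E r (a @ s @ b) u'"
    and kn: "\<And>a b. knuth_equiv (a @ s @ b) (a @ t @ b)"
    and inner: "\<And>p q. s = p @ Suc r # q \<Longrightarrow> eps r (a @ p) = 0 \<Longrightarrow> phi r (q @ b) = 0 \<Longrightarrow>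
      \<exists>p' q'. t = p' @ Suc r # q' \<and> eps r (a @ p') = 0 \<and> phi r (q' @ b) = 0 \<and>
        knuth_equiv (a @ (p @ r # q) @ b) (a @ (p' @ r # q') @ b)"
  shows "\<exists>v'. E r (a @ t @ b) v' \<and> knuth_equiv u' v'"
proof -
  have st: "epsA r s k = epsA r t k" "phiA r s k = phiA r t k" for k
    using epsA_knuth[OF kn[of "[]" "[]"]] phiA_knuth[OF kn[of "[]" "[]"]] by auto
  obtain c d where u: "a @ s @ b = c @ Suc r # d" "u' = c @ r # d" "eps r c = 0" "phi r d = 0"
    using E by (rule EE)
  consider (A) a2 where "a = c @ Suc r # a2" "d = a2 @ s @ b"
    | (S) p q where "s = p @ Suc r # q" "c = a @ p" "d = q @ b"
    | (B) b1 where "b = b1 @ Suc r # d" "c = a @ s @ b1"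
    using u(1) by (auto simp: append_eq_append_conv2 append_eq_Cons_conv Cons_eq_append_conv)
  then show ?thesis
  proof cases
    case A
    then have "E r (a @ t @ b) ((c @ r # a2) @ t @ b)"
      using EI[of r c "a2 @ t @ b"] u st by simp
    moreover have "knuth_equiv u' ((c @ r # a2) @ t @ b)"
      using kn[of "c @ r # a2" b] u A by simp
    ultimately show ?thesis by blast
  next
    case S
    then obtain p' q' where "t = p' @ Suc r # q'" "eps r (a @ p') = 0" "phi r (q' @ b) = 0"
      "knuth_equiv (a @ (p @ r # q) @ b) (a @ (p' @ r # q') @ b)"
      using inner[of p q] u by auto
    then show ?thesis using EI[of r "a @ p'" "q' @ b"] u S
      by (intro exI[of _ "a @ (p' @ r # q') @ b"]) simp
  next
    case B
    then have "E r (a @ t @ b) (a @ t @ b1 @ r # d)"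
      using EI[of r "a @ t @ b1" d] u st by simp
    moreover have "knuth_equiv u' (a @ t @ b1 @ r # d)"
      using kn[of a "b1 @ r # d"] u B by simp
    ultimately show ?thesis by blast
  qed
qed

lemma E_knuth_triple:
  assumes E: "E r (a @ [s1, s2, s3] @ b) u'"
    and kn: "\<And>a b. knuth_equiv (a @ [s1, s2, s3] @ b) (a @ t @ b)"
    and 1: "s1 = Suc r \<Longrightarrow> eps r a = 0 \<Longrightarrow> phi r (s2 # s3 # b) = 0 \<Longrightarrow>
      \<exists>p q. t = p @ Suc r # q \<and> eps r (a @ p) = 0 \<and> phi r (q @ b) = 0 \<and>
        knuth_equiv (a @ r # s2 # s3 # b) (a @ p @ r # q @ b)"
    and 2: "s2 = Suc r \<Longrightarrow> eps r (a @ [s1]) = 0 \<Longrightarrow> phi r (s3 # b) = 0 \<Longrightarrow>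
      \<exists>p q. t = p @ Suc r # q \<and> eps r (a @ p) = 0 \<and> phi r (q @ b) = 0 \<and>
        knuth_equiv (a @ s1 # r # s3 # b) (a @ p @ r # q @ b)"
    and 3: "s3 = Suc r \<Longrightarrow> eps r (a @ [s1, s2]) = 0 \<Longrightarrow> phi r b = 0 \<Longrightarrow>
      \<exists>p q. t = p @ Suc r # q \<and> eps r (a @ p) = 0 \<and> phi r (q @ b) = 0 \<and>
        knuth_equiv (a @ s1 # s2 # r # b) (a @ p @ r # q @ b)"
  shows "\<exists>v'. E r (a @ t @ b) v' \<and> knuth_equiv u' v'"
proof (rule E_knuth_context[OF E kn])
  fix p q
  assume pq: "[s1, s2, s3] = p @ Suc r # q" "eps r (a @ p) = 0" "phi r (q @ b) = 0"
  then consider "p = []" "s1 = Suc r" "q = [s2, s3]" | "p = [s1]" "s2 = Suc r" "q = [s3]"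
    | "p = [s1, s2]" "s3 = Suc r" "q = []"
    by (auto simp: Cons_eq_append_conv)
  then show "\<exists>p' q'. t = p' @ Suc r # q' \<and> eps r (a @ p') = 0 \<and> phi r (q' @ b) = 0 \<and>
      knuth_equiv (a @ (p @ r # q) @ b) (a @ (p' @ r # q') @ b)"
    by cases (use 1 2 3 pq in auto)
qed

lemma E_knuth_step:
  assumes "knuth_step u v \<or> knuth_step v u" "E r u u'"
  shows "\<exists>v'. E r v v' \<and> knuth_equiv u' v'"
  using assms(1)
proof
  assume "knuth_step u v"
  then show ?thesis
  proof (cases rule: knuth_step_cases)
    case (xzy a b x y z)
    have "\<exists>v'. E r (a @ [z, x, y] @ b) v' \<and> knuth_equiv u' v'"
    proof (rule E_knuth_triple[of r a x z y], goal_cases)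
      case 1 then show ?case using assms(2) xzy by simp
    next
      case 2 then show ?case using knuth_xzy[OF xzy(3,4)] by simp
    next
      case 3 then show ?case using xzy(3,4) knuth_xzy[of r y z a b]
        by (intro exI[of _ "[z]"] exI[of _ "[y]"]) auto
    next
      case 4 then show ?case using xzy(3,4) knuth_xzy[of x y r a b]
        by (intro exI[of _ "[]"] exI[of _ "[x, y]"]) (auto split: if_splits)
    next
      case 5 then show ?case using xzy(3,4) knuth_xzy[of x r z a b]
        by (intro exI[of _ "[z, x]"] exI[of _ "[]"]) (auto split: if_splits simp: le_Suc_eq)
    qed
    then show ?thesis using xzy by simp
  next
    case (yxz a b x y z)
    have "\<exists>v'. E r (a @ [y, z, x] @ b) v' \<and> knuth_equiv u' v'"
    proof (rule E_knuth_triple[of r a y x z], goal_cases)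
      case 1 then show ?case using assms(2) yxz by simp
    next
      case 2 then show ?case using knuth_yxz[OF yxz(3,4)] by simp
    next
      case 3 then show ?case using yxz(3,4) knuth_yxz[of x r z a b]
        by (intro exI[of _ "[]"] exI[of _ "[z, x]"]) (auto split: if_splits)
    next
      case 4 then show ?case using yxz(3,4) knuth_yxz[of r y z a b]
        by (intro exI[of _ "[y, z]"] exI[of _ "[]"]) auto
    next
      case 5
      show ?case
      \<comment> \<open>For the letters \<open>r + 1\<close>, \<open>r\<close>, \<open>r + 1\<close>
        the \<open>r\<close> changes its partner: the unmatched letter is the last one before the
        move and the first one after it, and the raised words are related by the other Knuth
        relation.\<close>
      proof (cases "y = Suc r")
        case True
        with 5 yxz(3,4) have "x = r" "eps r a = 0" by (auto split: if_splits)
        then show ?thesis using 5 True knuth_sym[OF knuth_xzy[of r r "Suc r" a b]]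
          by (intro exI[of _ "[]"] exI[of _ "[Suc r, r]"]) auto
      next
        case False
        then show ?thesis using 5 yxz(3,4) knuth_yxz[of x y r a b]
          by (intro exI[of _ "[y]"] exI[of _ "[x]"]) auto
      qed
    qed
    then show ?thesis using yxz by simp
  qed
next
  assume "knuth_step v u"
  then show ?thesis
  proof (cases rule: knuth_step_cases)
    case (xzy a b x y z)
    have "\<exists>v'. E r (a @ [x, z, y] @ b) v' \<and> knuth_equiv u' v'"
    proof (rule E_knuth_triple[of r a z x y], goal_cases)
      case 1 then show ?case using assms(2) xzy by simp
    next
      case 2 then show ?case using knuth_sym[OF knuth_xzy[OF xzy(3,4)]] by simp
    next
      case 3 then show ?case using xzy(3,4) knuth_sym[OF knuth_xzy[of x y r a b]]
        by (intro exI[of _ "[x]"] exI[of _ "[y]"]) (auto split: if_splits)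
    next
      case 4 then show ?case using xzy(3,4) knuth_sym[OF knuth_xzy[of r y z a b]]
        by (intro exI[of _ "[]"] exI[of _ "[z, y]"]) auto
    next
      case 5 then show ?case using xzy(3,4) knuth_sym[OF knuth_xzy[of x r z a b]]
        by (intro exI[of _ "[x, z]"] exI[of _ "[]"]) (auto split: if_splits simp: le_Suc_eq)
    qed
    then show ?thesis using xzy by simp
  next
    case (yxz a b x y z)
    have "\<exists>v'. E r (a @ [y, x, z] @ b) v' \<and> knuth_equiv u' v'"
    proof (rule E_knuth_triple[of r a y z x], goal_cases)
      case 1 then show ?case using assms(2) yxz by simp
    next
      case 2 then show ?case using knuth_sym[OF knuth_yxz[OF yxz(3,4)]] by simp
    next
      case 3
      show ?case
      \<comment> \<open>The same change of partner, read backwards.\<close>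
      proof (cases "x = r")
        case True
        with 3 yxz(3,4) have "z = Suc r" "phi r b = 0" by (auto split: if_splits)
        then show ?thesis using 3 True knuth_xzy[of r r "Suc r" a b]
          by (intro exI[of _ "[Suc r, r]"] exI[of _ "[]"]) auto
      next
        case False
        then show ?thesis using 3 yxz(3,4) knuth_sym[OF knuth_yxz[of x r z a b]]
          by (intro exI[of _ "[]"] exI[of _ "[x, z]"]) auto
      qed
    next
      case 4 then show ?case using yxz(3,4) knuth_sym[OF knuth_yxz[of x y r a b]]
        by (intro exI[of _ "[y, x]"] exI[of _ "[]"]) (auto split: if_splits)
    next
      case 5 then show ?case using yxz(3,4) knuth_sym[OF knuth_yxz[of r y z a b]]
        by (intro exI[of _ "[y]"] exI[of _ "[z]"]) auto
    qed
    then show ?thesis using yxz by simp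
  qed
qed

lemma E_knuth:
  assumes "knuth_equiv u v" "E r u u'"
  shows "\<exists>v'. E r v v' \<and> knuth_equiv u' v'"
  using assms(1)
proof (induction rule: knuth_induct)
  case refl
  then show ?case using assms(2) by auto
next
  case (step v w)
  then show ?case using E_knuth_step knuth_trans by blast
qed

section \<open>Tableaux and row insertion\<close>

definition dominates :: "nat list \<Rightarrow> nat list \<Rightarrow> bool" where
  "dominates r s \<longleftrightarrow> length s \<le> length r \<and> (\<forall>j<length s. r ! j < s ! j)"

text \<open>Row lengths as a total function, zero below the tableau: adding a box and comparing
  shapes then need no case distinction on the number of rows.\<close>

definition rl :: "nat list list \<Rightarrow> nat \<Rightarrow> nat" where
  "rl T i = (if i < length T then length (T ! i) else 0)"

lemma column_strict_iff:
  "column_strict T \<longleftrightarrow> (\<forall>i<length T. T ! i \<noteq> [] \<and> sorted (T ! i)) \<and>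
     (\<forall>i. Suc i < length T \<longrightarrow> dominates (T ! i) (T ! Suc i))"
proof -
  have "sorted_wrt (\<ge>) (map length T) \<longleftrightarrow> (\<forall>i. Suc i < length T \<longrightarrow> length (T ! Suc i) \<le> length (T ! i))"
    by (subst sorted_wrt_iff_nth_Suc_transp) (auto intro!: transpI)
  then show ?thesis
    unfolding column_strict_def is_partition_def shape_def dominates_def
    by (auto simp: all_set_conv_all_nth)
qed

lemma column_strict_Nil [simp]: "column_strict []"
  by (simp add: column_strict_iff)

lemma column_strict_Cons:
  "column_strict (r # T) \<longleftrightarrow> r \<noteq> [] \<and> sorted r \<and> column_strict T \<and> (T \<noteq> [] \<longrightarrow> dominates r (hd T))"
proof -
  have "(\<forall>i. Suc i < length (r # T) \<longrightarrow> dominates ((r # T) ! i) ((r # T) ! Suc i)) \<longleftrightarrow>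
    (T \<noteq> [] \<longrightarrow> dominates r (hd T)) \<and> (\<forall>i. Suc i < length T \<longrightarrow> dominates (T ! i) (T ! Suc i))"
    (is "?L = ?R")
  proof
    assume ?L
    then have "Suc i < length (r # T) \<longrightarrow> dominates ((r # T) ! i) ((r # T) ! Suc i)" for i by blast
    from this[of 0] this[of "Suc i" for i] show ?R by (auto simp: hd_conv_nth)
  next
    assume ?R
    then show ?L by (auto simp: hd_conv_nth nth_Cons split: nat.splits)
  qed
  moreover have "(\<forall>i<length (r # T). (r # T) ! i \<noteq> [] \<and> sorted ((r # T) ! i)) \<longleftrightarrow>
    (r \<noteq> [] \<and> sorted r) \<and> (\<forall>i<length T. T ! i \<noteq> [] \<and> sorted (T ! i))"
    by (simp add: All_less_Suc2)
  ultimately show ?thesis unfolding column_strict_iff by argo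
qed

lemma column_strict_drop: "column_strict T \<Longrightarrow> column_strict (drop k T)"
  by (auto simp: column_strict_iff)

lemma rl_antimono:
  assumes "column_strict T" "i \<le> j" shows "rl T j \<le> rl T i"
proof (rule lift_Suc_antimono_le[of "rl T", OF _ assms(2)])
  show "rl T (Suc n) \<le> rl T n" for n using assms(1) by (auto simp: column_strict_iff dominates_def rl_def)
qed

lemma rl_pos_iff: "column_strict T \<Longrightarrow> 0 < rl T i \<longleftrightarrow> i < length T"
  by (auto simp: column_strict_iff rl_def)

lemma shape_eq_iff:
  assumes "column_strict T" "column_strict T'"
  shows "shape T = shape T' \<longleftrightarrow> (\<forall>i. rl T i = rl T' i)"
proof
  assume eq: "shape T = shape T'"
  then have "length T = length T'" unfolding shape_def by (metis length_map)
  moreover have "length (T ! i) = length (T' ! i)" if "i < length T" for i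
    using arg_cong[OF eq, of "\<lambda>s. s ! i"] that \<open>length T = length T'\<close> by (simp add: shape_def)
  ultimately show "\<forall>i. rl T i = rl T' i" by (simp add: rl_def)
next
  assume eq: "\<forall>i. rl T i = rl T' i"
  then have "i < length T \<longleftrightarrow> i < length T'" for i using rl_pos_iff assms by metis
  then have "length T = length T'" by (metis linorder_neqE_nat less_irrefl)
  moreover from this have "length (T ! i) = length (T' ! i)" if "i < length T" for i
    using eq[rule_format, of i] that by (simp add: rl_def)
  ultimately show "shape T = shape T'" unfolding shape_def by (intro nth_equalityI) auto
qed

lemma set_tword: "set (tword T) = (\<Union>r\<in>set T. set r)"
  by (simp add: tword_def)

lemma tableau_entry_ge:
  assumes "column_strict T" "\<And>x. x \<in> set (tword T) \<Longrightarrow> b \<le> x" "i < length T" "j < length (T ! i)"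
  shows "b + i \<le> T ! i ! j"
  using assms(3,4)
proof (induction i)
  case 0
  then have "T ! 0 ! j \<in> set (tword T)" unfolding set_tword by (meson UN_I nth_mem)
  then show ?case using assms(2) by simp
next
  case (Suc i)
  then have "dominates (T ! i) (T ! Suc i)" using assms(1) by (simp add: column_strict_iff)
  then have "T ! i ! j < T ! Suc i ! j" "j < length (T ! i)" using Suc.prems by (auto simp: dominates_def)
  with Suc show ?case by simp
qed

lemma tword_Nil [simp]: "tword [] = []"
  by (simp add: tword_def)

lemma tword_Cons [simp]: "tword (r # T) = tword T @ r"
  by (simp add: tword_def)

lemma tword_append [simp]: "tword (S @ T) = tword T @ tword S"
  by (simp add: tword_def)

lemma tword_split: "i < length T \<Longrightarrow> tword T = tword (drop (Suc i) T) @ T ! i @ tword (take i T)"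
  by (metis append.assoc id_take_nth_drop tword_Cons tword_append)

lemma row_ins_spec:
  "row_ins x r = (let q = length (takeWhile (\<lambda>z. z \<le> x) r) in
     if q < length r then (r[q := x], Some (r ! q)) else (r @ [x], None))"
  by (induction r) (auto simp: Let_def split: prod.splits)

lemma row_ins_None: "row_ins x r = (r', None) \<Longrightarrow> r' = r @ [x] \<and> (\<forall>z\<in>set r. z \<le> x)"
  by (induction r arbitrary: r') (auto split: if_splits prod.splits)

lemma row_ins_Some:
  "row_ins x r = (r', Some y) \<Longrightarrow> x < y \<and> length r' = length r \<and> y \<in> set r \<and> x \<in> set r' \<and>
     set r' \<subseteq> insert x (set r) \<and> hd r' \<le> x"
  by (induction r arbitrary: r') (auto split: if_splits prod.splits)

lemma row_ins_sorted:
  "sorted r \<Longrightarrow> row_ins x r = (r', b) \<Longrightarrow> sorted r'"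
proof (induction r arbitrary: r')
  case (Cons a r)
  show ?case
  proof (cases "x < a")
    case True
    then show ?thesis using Cons.prems by auto (meson less_imp_le less_le_trans)
  next
    case False
    then obtain r2 where r2: "row_ins x r = (r2, b)" "r' = a # r2" using Cons.prems by (auto split: prod.splits)
    then have "set r2 \<subseteq> insert x (set r)"
      by (cases b) (auto dest!: row_ins_None row_ins_Some)
    with r2 Cons False show ?thesis by auto
  qed
qed simp

lemma knuth_move_left: "sorted (a # r) \<Longrightarrow> x < a \<Longrightarrow> knuth_equiv (a # r @ [x]) (a # x # r)"
proof (induction r arbitrary: a)
  case (Cons b r)
  then have "knuth_equiv (b # r @ [x]) (b # x # r)" by auto
  then have "knuth_equiv (a # b # r @ [x]) (a # b # x # r)" using knuth_append_left[of _ _ "[a]"] by simp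
  also have "knuth_equiv \<dots> (a # x # b # r)"
    using knuth_sym[OF knuth_yxz[of x a b "[]" r]] Cons.prems by simp
  finally show ?case by simp
qed simp

lemma row_ins_knuth:
  "sorted r \<Longrightarrow> row_ins x r = (r', Some y) \<Longrightarrow> knuth_equiv (r @ [x]) (y # r')"
proof (induction r arbitrary: r')
  case (Cons a r)
  show ?case
  proof (cases "x < a")
    case True
    then show ?thesis using Cons.prems knuth_move_left by auto
  next
    case False
    then obtain r2 where r2: "row_ins x r = (r2, Some y)" "r' = a # r2" using Cons.prems by (auto split: prod.splits)
    then have "knuth_equiv (a # r @ [x]) (a # y # r2)"
      using Cons knuth_append_left[of "r @ [x]" "y # r2" "[a]"] by simp
    moreover obtain c r3 where r3: "r2 = c # r3" using row_ins_Some[OF r2(1)] by (cases r2) auto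
    moreover have "a \<le> c" "c < y" using row_ins_Some[OF r2(1)] r3 False Cons.prems by auto
    ultimately show ?thesis using knuth_xzy[of a c y "[]" r3] r2 by (auto intro: knuth_trans)
  qed
qed simp

text \<open>The bumped letter \<open>y\<close> cannot land further right in the next row than the
  column it left, because the entry of \<open>s\<close> there exceeds \<open>y\<close>. What then
  stands above \<open>y\<close> is \<open>x\<close> or an entry to the left of \<open>x\<close>,
  hence smaller than \<open>y\<close>.\<close>

lemma row_ins_dom:
  assumes "sorted r" "sorted s" "dominates r s" "row_ins x r = (r', Some y)"
  shows "dominates r' (fst (row_ins y s))"
proof -
  define q where "q = length (takeWhile (\<lambda>z. z \<le> x) r)"
  define p where "p = length (takeWhile (\<lambda>z. z \<le> y) s)"
  have q: "q < length r" "r' = r[q := x]" "y = r ! q"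
    using assms(4) unfolding row_ins_spec q_def by (auto simp: Let_def split: if_splits)
  have "x < y" using row_ins_Some[OF assms(4)] by simp
  have rq: "r ! i \<le> x" if "i < q" for i using that unfolding q_def by (metis nth_mem set_takeWhileD takeWhile_nth)
  have pl: "p \<le> length s" unfolding p_def by (rule length_takeWhile_le)
  have sp: "s ! i \<le> y" if "i < p" for i using that unfolding p_def by (metis nth_mem set_takeWhileD takeWhile_nth)
  have "p \<le> q"
  proof (rule ccontr)
    assume "\<not> p \<le> q"
    then have "q < p" by simp
    with sp pl have "s ! q \<le> y" "q < length s" by auto
    with assms(3) q show False by (auto simp: dominates_def)
  qed
  have x': "r' ! i \<le> r ! i" if "i < length r" for i
    using that q \<open>x < y\<close> by (cases "i = q") auto
  have r'p: "r' ! p < y"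
  proof (cases "p = q")
    case False
    then have "r ! p \<le> x" using rq \<open>p \<le> q\<close> by simp
    then show ?thesis using q \<open>x < y\<close> False by simp
  qed (use q \<open>x < y\<close> in simp)
  show ?thesis
  proof (cases "p < length s")
    case True
    then have "fst (row_ins y s) = s[p := y]" by (simp add: row_ins_spec p_def[symmetric] Let_def)
    moreover have "r' ! j < s[p := y] ! j" if "j < length s" for j
    proof (cases "j = p")
      case False
      then show ?thesis using x'[of j] assms(3) that by (auto simp: dominates_def intro: le_less_trans)
    qed (use r'p that in auto)
    ultimately show ?thesis using assms(3) q by (simp add: dominates_def)
  next
    case False
    then have "p = length s" using pl by simp
    then have "fst (row_ins y s) = s @ [y]" by (simp add: row_ins_spec p_def[symmetric] Let_def)
    moreover have "r' ! j < (s @ [y]) ! j" if "j < Suc (length s)" for j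
    proof (cases "j = p")
      case False
      then have "j < length s" using that \<open>p = length s\<close> by simp
      then show ?thesis using x'[of j] assms(3) by (auto simp: dominates_def nth_append intro: le_less_trans)
    qed (use r'p \<open>p = length s\<close> in auto)
    ultimately show ?thesis using q \<open>p \<le> q\<close> \<open>p = length s\<close> by (simp add: dominates_def)
  qed
qed

lemma tab_ins_column_strict:
  "column_strict T \<Longrightarrow> column_strict (tab_ins x T) \<and> tab_ins x T \<noteq> [] \<and>
     hd (tab_ins x T) = fst (row_ins x (if T = [] then [] else hd T))"
proof (induction T arbitrary: x)
  case Nil
  then show ?case by (simp add: column_strict_Cons)
next
  case (Cons r T)
  obtain r' b where rb: "row_ins x r = (r', b)" by force
  have r: "sorted r" "r \<noteq> []" "column_strict T" "T \<noteq> [] \<Longrightarrow> dominates r (hd T)"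
    using Cons.prems by (auto simp: column_strict_Cons)
  have "sorted r'" using row_ins_sorted[OF r(1) rb] .
  show ?case
  proof (cases b)
    case None
    with row_ins_None[of x r r'] rb have "r' = r @ [x]" by simp
    moreover have "dominates (r @ [x]) (hd T)" if "T \<noteq> []"
      using r(4)[OF that] by (auto simp: dominates_def nth_append)
    ultimately show ?thesis using rb None r \<open>sorted r'\<close> by (auto simp: column_strict_Cons)
  next
    case (Some y)
    have "dominates r (if T = [] then [] else hd T)" using r by (auto simp: dominates_def)
    moreover have "sorted (if T = [] then [] else hd T)"
      using r(3) by (cases T) (auto simp: column_strict_Cons)
    ultimately have "dominates r' (hd (tab_ins y T))"
      using row_ins_dom[OF r(1) _ _ rb[unfolded Some]] Cons.IH[OF r(3), of y] by metis
    moreover have "r' \<noteq> []" using row_ins_Some[OF rb[unfolded Some]] r(2) by auto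
    ultimately show ?thesis using rb Some Cons.IH[OF r(3), of y] \<open>sorted r'\<close>
      by (simp add: column_strict_Cons)
  qed
qed

lemma tab_ins_knuth: "column_strict T \<Longrightarrow> knuth_equiv (tword T @ [x]) (tword (tab_ins x T))"
proof (induction T arbitrary: x)
  case (Cons r T)
  obtain r' b where rb: "row_ins x r = (r', b)" by force
  have r: "sorted r" "column_strict T" using Cons.prems by (auto simp: column_strict_Cons)
  show ?case
  proof (cases b)
    case None
    with row_ins_None[of x r r'] rb show ?thesis by simp
  next
    case (Some y)
    have "knuth_equiv (tword T @ r @ [x]) (tword T @ y # r')"
      using knuth_append_left row_ins_knuth[OF r(1) rb[unfolded Some]] by blast
    also have "knuth_equiv \<dots> (tword (tab_ins y T) @ r')"
      using knuth_append_right[OF Cons.IH[OF r(2), of y], of r'] by simp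
    finally show ?thesis using rb Some by simp
  qed
qed simp

section \<open>Growth of the shape and reversal of insertion\<close>

definition inc :: "nat \<Rightarrow> nat list \<Rightarrow> nat list" where
  "inc k s = (if k < length s then s[k := Suc (s ! k)] else s @ [1])"

lemma tab_ins_shape: "\<exists>k\<le>length T. shape (tab_ins x T) = inc k (shape T)"
proof (induction T arbitrary: x)
  case (Cons r T)
  obtain r' b where rb: "row_ins x r = (r', b)" by force
  show ?case
  proof (cases b)
    case None
    with row_ins_None[of x r r'] rb show ?thesis
      by (intro exI[of _ 0]) (simp add: shape_def inc_def)
  next
    case (Some y)
    obtain k where "k \<le> length T" "shape (tab_ins y T) = inc k (shape T)" using Cons by blast
    then show ?thesis using rb Some row_ins_Some[OF rb[unfolded Some]]
      by (intro exI[of _ "Suc k"]) (auto simp: shape_def inc_def)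
  qed
qed (auto simp: shape_def inc_def)

lemma new_box_row:
  assumes "k \<le> length T" "shape T' = inc k (shape T)"
  shows "new_box_row T T' = k"
  unfolding new_box_row_def
proof (rule Least_equality)
  have T': "map length T' = inc k (map length T)" using assms(2) by (simp add: shape_def)
  have l: "length (T' ! i) = inc k (map length T) ! i" if "i < length T" for i
  proof -
    have "length T' = length (inc k (map length T))" using T' by (metis length_map)
    then have "i < length T'" using that by (auto simp: inc_def split: if_splits)
    then show ?thesis using T' by (metis nth_map)
  qed
  show "length T \<le> k \<or> length (T' ! k) \<noteq> length (T ! k)"
    using l[of k] by (auto simp: inc_def)
  show "k \<le> i" if "length T \<le> i \<or> length (T' ! i) \<noteq> length (T ! i)" for i
    using that l[of i] assms(1) by (cases "i < length T") (auto simp: inc_def nth_append nth_list_update split: if_splits)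
qed

lemma rl_inc:
  assumes "k \<le> length T" "shape T' = inc k (shape T)"
  shows "rl T' i = rl T i + (if i = k then 1 else 0)"
proof -
  have T': "map length T' = inc k (map length T)" using assms(2) by (simp add: shape_def)
  then have "length T' = length (inc k (map length T))" by (metis length_map)
  moreover have "length (T' ! i) = inc k (map length T) ! i" if "i < length T'"
    using T' that by (metis nth_map)
  ultimately show ?thesis using assms(1)
    by (auto simp: rl_def inc_def nth_append nth_list_update split: if_splits)
qed

lemma row_ins_inj:
  "sorted r \<Longrightarrow> sorted s \<Longrightarrow> row_ins x r = (q, Some y) \<Longrightarrow> row_ins x' s = (q, Some y) \<Longrightarrow> x = x' \<and> r = s"
proof (induction r arbitrary: s q)
  case (Cons a r)
  obtain b s' where s: "s = b # s'" using Cons.prems(4) by (cases s) auto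
  have *: False if "sorted (a # r)" "row_ins x s' = (r, Some a)" for a x r s'
    using row_ins_Some[OF that(2)] that(1) by auto
  show ?case
  proof (cases "x < a")
    case True
    then have q: "q = x # r" "y = a" using Cons.prems by auto
    have "x' < b"
    proof (rule ccontr)
      assume "\<not> x' < b"
      then have "row_ins x' s' = (r, Some a)" using Cons.prems s q by (auto split: prod.splits)
      then show False using * Cons.prems(1) by blast
    qed
    then show ?thesis using Cons.prems s q by auto
  next
    case False
    then obtain q2 where q2: "row_ins x r = (q2, Some y)" "q = a # q2"
      using Cons.prems by (auto split: prod.splits)
    have "\<not> x' < b"
    proof
      assume "x' < b"
      then have "q2 = s'" "y = b" using Cons.prems s q2 by auto
      then show False using * Cons.prems(2) s q2 by blast
    qed
    then have "row_ins x' s' = (q2, Some y)" "a = b" using Cons.prems s q2 by (auto split: prod.splits)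
    then show ?thesis using Cons.IH[of s' q2] Cons.prems s q2 by simp
  qed
qed simp

text \<open>Insertion is undone row by row. Whether a row was extended or bumped is read off from
  its lengths before and after, hence the assumption that the shapes before insertion agree.\<close>

lemma tab_ins_inj:
  assumes "shape T = shape T'" "\<forall>r\<in>set T. sorted r" "\<forall>r\<in>set T'. sorted r" "tab_ins x T = tab_ins x' T'"
  shows "x = x' \<and> T = T'"
  using assms
proof (induction T arbitrary: x x' T')
  case Nil
  then show ?case by (simp add: shape_def)
next
  case (Cons r T)
  then obtain s S where T': "T' = s # S" by (cases T') (auto simp: shape_def)
  have len: "length r = length s" "shape T = shape S" using Cons.prems(1) T' by (auto simp: shape_def)
  obtain r' b where rb: "row_ins x r = (r', b)" by force
  obtain s' c where sc: "row_ins x' s = (s', c)" by force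
  have rs: "r' = s'" using Cons.prems(4) rb sc T' by (auto split: option.splits)
  have lr: "length r' = length r + (if b = None then 1 else 0)"
    using rb by (cases b) (auto dest!: row_ins_Some row_ins_None)
  have ls: "length s' = length s + (if c = None then 1 else 0)"
    using sc by (cases c) (auto dest!: row_ins_Some row_ins_None)
  show ?case
  proof (cases b)
    case None
    then have "c = None" using lr ls rs len by (auto split: if_splits)
    then show ?thesis using None rb sc rs row_ins_None[of x r r'] row_ins_None[of x' s s'] Cons.prems(4) T'
      by auto
  next
    case (Some y)
    then obtain z where z: "c = Some z" using lr ls rs len by (cases c) auto
    have "y = z \<and> T = S" using Cons.IH[of S y z] Cons.prems len T' rb sc Some z by auto
    then show ?thesis using row_ins_inj[of r s x r' y x'] Cons.prems T' rb sc Some z rs by auto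
  qed
qed

section \<open>The Robinson--Schensted--Knuth correspondence\<close>

lemma rsk_snoc: "rsk (w @ [x]) = rsk_step (rsk w) (Suc (length w), x)"
proof -
  have eq: "[1..<Suc (length (w @ [x]))] = [1..<Suc (length w)] @ [Suc (length w)]" by simp
  then have "zip [1..<Suc (length (w @ [x]))] (w @ [x]) =
    zip [1..<Suc (length w)] w @ [(Suc (length w), x)]"
    unfolding eq by (simp del: upt_Suc)
  then show ?thesis unfolding rsk_def by (simp only: foldl_append foldl.simps)
qed

lemma Ptab_Nil [simp]: "Ptab [] = []"
  by (simp add: Ptab_def rsk_def)

lemma Ptab_snoc: "Ptab (w @ [x]) = tab_ins x (Ptab w)"
  by (simp add: Ptab_def rsk_snoc rsk_step_def Let_def split: prod.splits)

lemma Qtab_Nil [simp]: "Qtab [] = []"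
  by (simp add: Qtab_def rsk_def)

lemma Qtab_snoc:
  assumes "k \<le> length (Ptab w)" "shape (Ptab (w @ [x])) = inc k (shape (Ptab w))"
  shows "Qtab (w @ [x]) = (if k < length (Qtab w) then (Qtab w)[k := Qtab w ! k @ [Suc (length w)]]
     else Qtab w @ [[Suc (length w)]])"
proof -
  obtain P Q where "rsk w = (P, Q)" by force
  then show ?thesis using new_box_row[OF assms] Ptab_snoc[of w x]
    by (simp add: Ptab_def Qtab_def rsk_snoc rsk_step_def Let_def)
qed

lemma Ptab_snoc_shape:
  obtains k where "k \<le> length (Ptab w)" "shape (Ptab (w @ [x])) = inc k (shape (Ptab w))"
  using tab_ins_shape[of "Ptab w" x] Ptab_snoc by metis

lemma column_strict_Ptab [simp]: "column_strict (Ptab w)"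
  by (induction w rule: rev_induct) (auto simp: Ptab_snoc tab_ins_column_strict)

lemma knuth_Ptab: "knuth_equiv w (tword (Ptab w))"
proof (induction w rule: rev_induct)
  case (snoc x w)
  have "knuth_equiv (w @ [x]) (tword (Ptab w) @ [x])" using snoc by (rule knuth_append_right)
  also have "knuth_equiv \<dots> (tword (Ptab (w @ [x])))" by (simp add: Ptab_snoc tab_ins_knuth)
  finally show ?case .
qed simp

lemma Qtab_props:
  "shape (Qtab w) = shape (Ptab w) \<and> (\<forall>r\<in>set (Qtab w). r \<noteq> [] \<and> (\<forall>z\<in>set r. z \<le> length w)) \<and>
     sum_list (map length (Qtab w)) = length w"
proof (induction w rule: rev_induct)
  case (snoc x w)
  obtain k where k: "k \<le> length (Ptab w)" "shape (Ptab (w @ [x])) = inc k (shape (Ptab w))"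
    by (rule Ptab_snoc_shape)
  have len: "length (Qtab w) = length (Ptab w)" using snoc unfolding shape_def by (metis length_map)
  have *: "shape (Qtab w) = shape (Ptab w)" using snoc by blast
  show ?case
  proof (cases "k < length (Qtab w)")
    case True
    have "set (Qtab (w @ [x])) \<subseteq> insert (Qtab w ! k @ [Suc (length w)]) (set (Qtab w))"
      using True Qtab_snoc[OF k] set_update_subset_insert[of "Qtab w" k] by simp
    moreover have "Qtab w ! k \<in> set (Qtab w)" using True by simp
    ultimately have "\<forall>r\<in>set (Qtab (w @ [x])). r \<noteq> [] \<and> (\<forall>z\<in>set r. z \<le> Suc (length w))"
      using snoc by (auto simp: le_Suc_eq dest!: subsetD)
    moreover have "shape (Qtab (w @ [x])) = inc k (shape (Qtab w))"
      using True Qtab_snoc[OF k] by (simp add: shape_def inc_def map_update)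
    moreover have "sum_list (map length (Qtab (w @ [x]))) = Suc (sum_list (map length (Qtab w)))"
      using True Qtab_snoc[OF k] by (simp add: map_update sum_list_update)
    ultimately show ?thesis using k * snoc by simp
  next
    case False
    then have "Qtab (w @ [x]) = Qtab w @ [[Suc (length w)]]" using Qtab_snoc[OF k] by simp
    moreover have "shape (Ptab (w @ [x])) = shape (Qtab w) @ [1]"
      using k * len False by (simp add: shape_def inc_def)
    ultimately show ?thesis using snoc by (auto simp: shape_def le_Suc_eq)
  qed
qed (simp add: shape_def)

text \<open>Deleting the largest entry gives the recording tableau of the word without its last
  letter, so equality of recording tableaux passes to prefixes.\<close>

lemma Qtab_restrict:
  "filter (\<lambda>r. r \<noteq> []) (map (filter (\<lambda>z. z \<le> length w)) (Qtab (w @ [x]))) = Qtab w"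
proof -
  obtain k where k: "k \<le> length (Ptab w)" "shape (Ptab (w @ [x])) = inc k (shape (Ptab w))"
    by (rule Ptab_snoc_shape)
  have *: "map (filter (\<lambda>z. z \<le> length w)) (Qtab w) = Qtab w"
    using Qtab_props[of w] by (intro map_idI) (auto simp: filter_id_conv)
  have **: "filter (\<lambda>r. r \<noteq> []) (Qtab w) = Qtab w"
    using Qtab_props[of w] by (auto simp: filter_id_conv)
  show ?thesis
  proof (cases "k < length (Qtab w)")
    case True
    have "filter (\<lambda>z. z \<le> length w) (Qtab w ! k) = Qtab w ! k"
      using Qtab_props[of w] True by (auto simp: filter_id_conv)
    then show ?thesis using True Qtab_snoc[OF k] * ** by (simp add: map_update)
  next
    case False
    then show ?thesis using Qtab_snoc[OF k] * ** by simp
  qed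
qed

text \<open>A recording tableau is the chain of shapes of the prefixes of a word. Equality of
  recording tableaux is used in this form; \<open>Qtab_eq_iff\<close> makes the connection.\<close>

definition Qs :: "nat list \<Rightarrow> nat list \<Rightarrow> bool" where
  "Qs u v \<longleftrightarrow> length u = length v \<and> (\<forall>k. shape (Ptab (take k u)) = shape (Ptab (take k v)))"

lemma Qs_refl [simp, intro]: "Qs u u"
  by (simp add: Qs_def)

lemma Qs_sym: "Qs u v \<Longrightarrow> Qs v u"
  by (simp add: Qs_def)

lemma Qs_trans [trans]: "Qs u v \<Longrightarrow> Qs v w \<Longrightarrow> Qs u w"
  by (simp add: Qs_def)

lemma Qs_shape: "Qs u v \<Longrightarrow> shape (Ptab u) = shape (Ptab v)"
  unfolding Qs_def by (metis order.refl take_all)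

lemma Qs_snoc:
  "Qs (u @ [x]) (v @ [y]) \<longleftrightarrow> Qs u v \<and> shape (Ptab (u @ [x])) = shape (Ptab (v @ [y]))"
proof
  assume L: "Qs (u @ [x]) (v @ [y])"
  then have len: "length u = length v" by (simp add: Qs_def)
  have "shape (Ptab (take k u)) = shape (Ptab (take k v))" for k
  proof -
    have "shape (Ptab (take (min k (length u)) (u @ [x]))) = shape (Ptab (take (min k (length u)) (v @ [y])))"
      using L unfolding Qs_def by blast
    moreover have "take (min k (length u)) (u @ [x]) = take k u" by (simp add: min_def)
    moreover have "take (min k (length u)) (v @ [y]) = take k v" using len by (simp add: min_def)
    ultimately show ?thesis by simp
  qed
  with len Qs_shape[OF L] show "Qs u v \<and> shape (Ptab (u @ [x])) = shape (Ptab (v @ [y]))"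
    by (simp add: Qs_def)
next
  assume R: "Qs u v \<and> shape (Ptab (u @ [x])) = shape (Ptab (v @ [y]))"
  then have len: "length u = length v" by (simp add: Qs_def)
  have "shape (Ptab (take k (u @ [x]))) = shape (Ptab (take k (v @ [y])))" for k
    using R len by (cases "k \<le> length u") (auto simp: Qs_def)
  with len show "Qs (u @ [x]) (v @ [y])" by (simp add: Qs_def)
qed

lemma inc_inj:
  assumes "k \<le> length s" "l \<le> length s" "inc k s = inc l s" shows "k = l"
proof (cases "k < length s \<and> l < length s")
  case True
  then have "inc k s ! k = inc l s ! k" using assms(3) by simp
  then show ?thesis using True by (simp add: inc_def nth_list_update split: if_splits)
next
  case False
  have "length (inc k s) = length (inc l s)" using assms(3) by simp
  then show ?thesis using assms(1,2) False by (auto simp: inc_def split: if_splits)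
qed

lemma Qtab_eq_iff: "Qtab u = Qtab v \<longleftrightarrow> Qs u v"
proof
  assume "Qtab u = Qtab v"
  then show "Qs u v"
  proof (induction u arbitrary: v rule: rev_induct)
    case Nil
    then have "length v = 0" using Qtab_props[of "[]"] Qtab_props[of v] by simp
    then show ?case by simp
  next
    case (snoc x u)
    then have len: "length v = Suc (length u)"
      using Qtab_props[of "u @ [x]"] Qtab_props[of v] by simp
    then obtain v' y where v: "v = v' @ [y]" by (metis length_Suc_conv_rev)
    then have "Qtab u = Qtab v'"
      using Qtab_restrict[of u x] Qtab_restrict[of v' y] snoc.prems len by simp
    then have "Qs u v'" by (rule snoc.IH)
    moreover have "shape (Ptab (u @ [x])) = shape (Ptab v)"
      using snoc.prems Qtab_props[of "u @ [x]"] Qtab_props[of v] by metis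
    ultimately show ?case using v Qs_snoc by simp
  qed
next
  assume "Qs u v"
  then show "Qtab u = Qtab v"
  proof (induction u arbitrary: v rule: rev_induct)
    case Nil
    then show ?case by (simp add: Qs_def)
  next
    case (snoc x u)
    then have len: "length v = Suc (length u)" by (simp add: Qs_def)
    then obtain v' y where v: "v = v' @ [y]" by (metis length_Suc_conv_rev)
    have "Qs u v'" and sh: "shape (Ptab (u @ [x])) = shape (Ptab (v' @ [y]))"
      using snoc.prems Qs_snoc v by auto
    then have IH: "Qtab u = Qtab v'" using snoc.IH by simp
    obtain k where k: "k \<le> length (Ptab u)" "shape (Ptab (u @ [x])) = inc k (shape (Ptab u))"
      by (rule Ptab_snoc_shape)
    obtain l where l: "l \<le> length (Ptab v')" "shape (Ptab (v' @ [y])) = inc l (shape (Ptab v'))"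
      by (rule Ptab_snoc_shape)
    have "shape (Ptab u) = shape (Ptab v')" using \<open>Qs u v'\<close> Qs_shape by blast
    then have "k = l" using inc_inj[of k "shape (Ptab u)" l] k l sh
      by (metis length_map shape_def)
    then show ?case using Qtab_snoc[OF k] Qtab_snoc[OF l] IH v len by simp
  qed
qed

lemma rsk_inj: "Qs u v \<Longrightarrow> Ptab u = Ptab v \<Longrightarrow> u = v"
proof (induction u arbitrary: v rule: rev_induct)
  case Nil
  then show ?case by (simp add: Qs_def)
next
  case (snoc x u)
  then have len: "length v = Suc (length u)" by (simp add: Qs_def)
  then obtain v' y where v: "v = v' @ [y]" by (metis length_Suc_conv_rev)
  have "Qs u v'" using snoc.prems Qs_snoc v by auto
  then have "shape (Ptab u) = shape (Ptab v')" by (rule Qs_shape)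
  moreover have "\<forall>r\<in>set (Ptab w). sorted r" for w
    using column_strict_Ptab[of w] unfolding column_strict_def by blast
  ultimately have "x = y \<and> Ptab u = Ptab v'" using tab_ins_inj snoc.prems(2) v by (metis Ptab_snoc)
  then show ?case using snoc.IH \<open>Qs u v'\<close> v by simp
qed

section \<open>The raising relation on tableaux\<close>

abbreviation hwd :: "nat list \<Rightarrow> bool" where
  "hwd w \<equiv> \<forall>r. eps r w = 0"

abbreviation Es :: "nat list \<Rightarrow> nat list \<Rightarrow> bool" where
  "Es w w' \<equiv> \<exists>r. E r w w'"

text \<open>The last letter \<open>Suc r\<close> below \<open>c\<close> in row \<open>i\<close> is
  followed in the reading word only by letters of its row that are at least \<open>c\<close>, and by
  the higher rows. If \<open>r \<ge> b + i\<close>, these contain no \<open>r\<close>, by induction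
  on the row, and this \<open>Suc r\<close> stays unmatched. The bound \<open>c\<close> admits
  letters of another block.\<close>

lemma lattice_rows:
  assumes T: "column_strict T" and b: "\<And>x. x \<in> set (tword T) \<Longrightarrow> b \<le> x"
    and eps: "\<And>r. b \<le> r \<Longrightarrow> Suc r < c \<Longrightarrow> eps r (tword T) = 0"
    and i: "i < length T" "x \<in> set (T ! i)" "x < c"
  shows "x = b + i"
  using i
proof (induction i arbitrary: x rule: less_induct)
  case (less i)
  obtain ps y zs where row: "T ! i = ps @ y # zs" "y < c" "\<forall>z\<in>set zs. \<not> z < c"
    using split_list_last_prop[of "T ! i" "\<lambda>x. x < c"] less.prems by blast
  have "sorted (T ! i)" using T less.prems by (simp add: column_strict_iff)
  then have xy: "x \<le> y" using row less.prems by (auto simp: sorted_append)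
  obtain j where "j < length (T ! i)" "x = T ! i ! j" using less.prems by (metis in_set_conv_nth)
  then have bx: "b + i \<le> x" using tableau_entry_ge[OF T b] less.prems by simp
  show ?case
  proof (cases "y = b + i")
    case False
    with xy bx obtain r where r: "y = Suc r" "b + i \<le> r" by (cases y) auto
    have "r \<notin> set zs" using row(2,3) r by auto
    moreover have "r \<notin> set (tword (take i T))"
    proof
      assume "r \<in> set (tword (take i T))"
      then obtain s where "s \<in> set (take i T)" "r \<in> set s" unfolding set_tword by blast
      moreover from this obtain i' where "i' < length (take i T)" "s = take i T ! i'"
        by (metis in_set_conv_nth)
      ultimately have i': "i' < i" "i' < length T" "r \<in> set (T ! i')" by auto
      have "r = b + i'" using i' less.IH[of i' r] row(2) r by simp
      with r i' show False by simp
    qed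
    ultimately have "count_list (zs @ tword (take i T)) r = 0" by (simp add: count_list_0_iff)
    then have "Suc 0 \<le> epsA r (zs @ tword (take i T)) (Suc (eps r (tword (drop (Suc i) T) @ ps)))"
      using epsA_ge[of "zs @ tword (take i T)" r "Suc (eps r (tword (drop (Suc i) T) @ ps))"] by linarith
    then have "eps r (tword T) \<noteq> 0" using tword_split[of i T] row r less.prems by simp
    then show ?thesis using eps[of r] r row(2) by simp
  qed (use xy bx in simp)
qed

lemma hw_row:
  assumes "column_strict T" "hwd (tword T)" "i < length T"
  shows "T ! i = replicate (length (T ! i)) i"
proof (rule replicate_eqI)
  fix x assume "x \<in> set (T ! i)"
  then show "x = i" using lattice_rows[of T 0 "Suc x" i x] assms by simp
qed simp

lemma count_tword: "count_list (tword T) k = (\<Sum>i<length T. count_list (T ! i) k)"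
proof (induction T)
  case (Cons r T)
  then show ?case by (simp add: sum.lessThan_Suc_shift del: sum.lessThan_Suc)
qed simp

lemma count_replicate: "count_list (replicate n x) k = (if k = x then n else 0)"
  by (induction n) auto

lemma hw_count:
  assumes "column_strict T" "hwd (tword T)"
  shows "count_list (tword T) k = rl T k"
proof -
  have "count_list (T ! i) k = (if i = k then length (T ! i) else 0)" if "i < length T" for i
    using hw_row[OF assms that] by (metis count_replicate)
  then show ?thesis by (simp add: count_tword rl_def)
qed

lemma hw_tab_unique:
  assumes "column_strict T" "hwd (tword T)" "column_strict T'" "hwd (tword T')" "shape T = shape T'"
  shows "T = T'"
proof (rule nth_equalityI)
  show len: "length T = length T'" using assms(5) unfolding shape_def by (metis length_map)
  fix i assume i: "i < length T"
  have "length (T ! i) = length (T' ! i)"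
    using arg_cong[OF assms(5), of "\<lambda>s. s ! i"] i len by (simp add: shape_def)
  then show "T ! i = T' ! i" using hw_row[OF assms(1,2) i] hw_row[of T' i] assms len i by metis
qed

lemma tword_position:
  "tword T = a @ y # b \<Longrightarrow> \<exists>i<length T. \<exists>p s. T ! i = p @ y # s \<and>
     a = tword (drop (Suc i) T) @ p \<and> b = s @ tword (take i T)"
proof (induction T arbitrary: b)
  case (Cons r T)
  then have "tword T @ r = a @ y # b" by simp
  then consider c where "tword T = a @ y # c" "b = c @ r" | p where "r = p @ y # b" "a = tword T @ p"
    by (auto simp: append_eq_append_conv2 append_eq_Cons_conv Cons_eq_append_conv)
  then show ?case
  proof cases
    case 1
    then obtain i p s where "i < length T" "T ! i = p @ y # s" "a = tword (drop (Suc i) T) @ p"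
      "c = s @ tword (take i T)" using Cons.IH by blast
    then show ?thesis using 1 by (intro exI[of _ "Suc i"]) simp
  qed (auto intro!: exI[of _ 0])
qed simp

lemma phiA_ge_minus: "r \<notin> set s \<Longrightarrow> K - count_list s (Suc r) \<le> phiA r s K"
  by (induction s) auto

lemma phiA_sorted_ge: "sorted s \<Longrightarrow> count_list s r \<le> phiA r s K"
proof (induction s)
  case (Cons x s)
  show ?case
  proof (cases "x = Suc r")
    case True
    then have "r \<notin> set s" using Cons.prems by auto
    then show ?thesis using True by (simp add: count_list_0_iff)
  qed (use Cons in auto)
qed simp

lemma sorted_nth_min: "sorted s \<Longrightarrow> (\<And>x. x \<in> set s \<Longrightarrow> m \<le> x) \<Longrightarrow> t < count_list s m \<Longrightarrow> s ! t = m"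
proof (induction s arbitrary: t)
  case (Cons x s)
  show ?case
  proof (cases "x = m")
    case True
    then show ?thesis using Cons by (cases t) auto
  next
    case False
    then have "m < x" using Cons.prems(2)[of x] by simp
    then have "m \<notin> set s" using Cons.prems(1) by auto
    then show ?thesis using Cons.prems(3) False by (simp add: count_list_0_iff)
  qed
qed simp

lemma count_ge_block:
  assumes "\<And>t. t < c \<Longrightarrow> j + t < length s \<and> s ! (j + t) = r"
  shows "c \<le> count_list s r"
proof -
  have "take c (drop j s) = replicate c r"
  proof (cases c)
    case (Suc n)
    then have "j + n < length s" using assms[of n] by simp
    then have "min (length s - j) c = c" using Suc by simp
    with Suc show ?thesis using assms by (intro nth_equalityI) (auto simp del: replicate_Suc)
  qed simp
  moreover have "s = take j s @ take c (drop j s) @ drop c (drop j s)" by (metis append_take_drop_id)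
  ultimately have "count_list s r = count_list (take j s) r + c + count_list (drop c (drop j s)) r"
    by (metis count_list_append count_replicate add.assoc)
  then show ?thesis by simp
qed

text \<open>The raised letter is the first \<open>Suc r\<close> of its row, as an earlier one would
  be unmatched too; so the row stays sorted. The entry above it is smaller than \<open>r\<close>, so
  the columns stay strict.\<close>

lemma E_tword:
  assumes T: "column_strict T" and E: "E r (tword T) w'"
  shows "\<exists>T'. w' = tword T' \<and> column_strict T' \<and> shape T' = shape T"
proof -
  obtain a b where ab: "tword T = a @ Suc r # b" "w' = a @ r # b" "eps r a = 0" "phi r b = 0"
    using E by (rule EE)
  obtain i p s where i: "i < length T" and row: "T ! i = p @ Suc r # s"
    and a: "a = tword (drop (Suc i) T) @ p" and b: "b = s @ tword (take i T)"
    using tword_position[OF ab(1)] by blast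
  define T' where "T' = T[i := p @ r # s]"
  have rows: "sorted (T ! k)" if "k < length T" for k using T that by (simp add: column_strict_iff)
  have so: "sorted (p @ Suc r # s)" using rows[OF i] row by simp
  have "Suc r \<notin> set p"
  proof
    assume "Suc r \<in> set p"
    then obtain p1 p2 where p: "p = p1 @ Suc r # p2" by (meson split_list)
    have "\<forall>x\<in>set p2. Suc r \<le> x" using so unfolding p by (simp add: sorted_append)
    then have "r \<notin> set p2" using Suc_n_not_le_n by blast
    then have "Suc 0 \<le> epsA r p2 (Suc (eps r (tword (drop (Suc i) T) @ p1)))"
      using epsA_ge[of p2 r "Suc (eps r (tword (drop (Suc i) T) @ p1))"] by (simp add: count_list_0_iff)
    then show False using ab(3) a p by simp
  qed
  moreover have "\<forall>x\<in>set p. x \<le> Suc r" using so by (simp add: sorted_append)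
  ultimately have "\<forall>x\<in>set p. x \<le> r" using le_Suc_eq by blast
  moreover have "\<forall>x\<in>set s. r \<le> x" using so by (simp add: sorted_append Suc_le_eq less_imp_le)
  ultimately have so': "sorted (p @ r # s)" using so by (simp add: sorted_append)
  have low: "(p @ r # s) ! j \<le> T ! i ! j" for j
    unfolding row by (auto simp: nth_append nth_Cons split: nat.split)
  \<comment> \<open>If the entry above were \<open>r\<close>, then \<open>r\<close> would stand
    above this \<open>Suc r\<close> and above each of the \<open>?c\<close> letters
    \<open>Suc r\<close> after it in the row. These \<open>?c + 1\<close> letters \<open>r\<close>
    come later in the word, where only the \<open>?c\<close> letters \<open>Suc r\<close> of
    \<open>s\<close> could match them, against \<open>phi r b = 0\<close>.\<close>
  have above: "T ! k ! length p < r" if k: "Suc k = i" for k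
  proof (rule ccontr)
    assume "\<not> T ! k ! length p < r"
    let ?j = "length p" and ?c = "count_list s (Suc r)"
    have dom: "dominates (T ! k) (p @ Suc r # s)" using T k i row by (auto simp: column_strict_iff)
    have "take i T = take k T @ [T ! k]" using k i by (metis Suc_lessD take_Suc_conv_app_nth)
    then have "phiA r s (phiA r (T ! k) (phi r (tword (take k T)))) = 0" using ab(4) b by simp
    moreover have "r \<notin> set s" using so by (auto simp: sorted_append)
    ultimately have "phiA r (T ! k) (phi r (tword (take k T))) \<le> ?c"
      using phiA_ge_minus by (metis diff_is_0_eq le_zero_eq)
    then have c: "count_list (T ! k) r \<le> ?c"
      using phiA_sorted_ge[OF rows[of k]] k i by (meson Suc_lessD le_trans)
    have "?j + t < length (T ! k) \<and> T ! k ! (?j + t) = r" if "t < Suc ?c" for t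
    proof -
      have st: "s ! u = Suc r" if "u < ?c" for u
        using sorted_nth_min[of s "Suc r" u] so that by (auto simp: sorted_append)
      have "?c \<le> length s" by (rule count_le_length)
      then have lt: "?j + t < length (p @ Suc r # s)" using that by simp
      have eq: "(p @ Suc r # s) ! (?j + t) = Suc r"
        using that st by (cases t) (auto simp: nth_append)
      have 1: "?j + t < length (T ! k)" using dom lt by (simp add: dominates_def)
      have 2: "T ! k ! (?j + t) < Suc r" using dom lt eq unfolding dominates_def by metis
      have "T ! k ! ?j \<le> T ! k ! (?j + t)"
        using rows[of k] k i 1 by (intro sorted_nth_mono) auto
      with 1 2 show ?thesis using \<open>\<not> T ! k ! length p < r\<close> by linarith
    qed
    then have "Suc ?c \<le> count_list (T ! k) r" by (rule count_ge_block)
    with c show False by simp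
  qed
  have "column_strict T'"
    unfolding column_strict_iff
  proof (intro conjI allI impI)
    fix k assume "k < length T'"
    then show "T' ! k \<noteq> []" "sorted (T' ! k)"
      using T so' by (cases "k = i"; simp add: T'_def column_strict_iff)+
  next
    fix k assume "Suc k < length T'"
    then have k: "Suc k < length T" by (simp add: T'_def)
    then have d: "dominates (T ! k) (T ! Suc k)" using T by (simp add: column_strict_iff)
    consider "k = i" | "Suc k = i" | "k \<noteq> i" "Suc k \<noteq> i" by blast
    then show "dominates (T' ! k) (T' ! Suc k)"
    proof cases
      case 1
      then have "T' ! k = p @ r # s" "T' ! Suc k = T ! Suc k" using i by (auto simp: T'_def)
      then show ?thesis using d low 1 row unfolding dominates_def by (auto intro: le_less_trans)
    next
      case 2
      then have 3: "T' ! Suc k = p @ r # s" "T' ! k = T ! k" using i by (auto simp: T'_def)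
      have "T ! k ! j < (p @ r # s) ! j" if "j < length (p @ r # s)" for j
      proof (cases "j = length p")
        case False
        then have "(p @ r # s) ! j = (p @ Suc r # s) ! j"
          by (auto simp: nth_append nth_Cons split: nat.split)
        then show ?thesis using d 2 row that by (auto simp: dominates_def)
      qed (use above[OF 2] in simp)
      then show ?thesis using 2 3 d row by (simp add: dominates_def)
    qed (use d in \<open>simp add: T'_def\<close>)
  qed
  moreover have "shape T' = shape T"
    unfolding shape_def T'_def using i row by (simp add: map_update list_update_same_conv)
  moreover have "w' = tword T'"
    using tword_split[of i T'] i ab(2) a b by (simp add: T'_def)
  ultimately show ?thesis by blast
qed

lemma tword_shape_inj: "tword T = tword T' \<Longrightarrow> shape T = shape T' \<Longrightarrow> T = T'"
proof (induction T arbitrary: T')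
  case (Cons r T)
  then obtain s S where "T' = s # S" by (cases T') (auto simp: shape_def)
  with Cons show ?case by (auto simp: shape_def)
qed (simp add: shape_def)

section \<open>Uniqueness of the tableau in a Knuth class\<close>

text \<open>Both tableaux are raised in parallel, which lowers the sum of the entries. At highest
  weight the content, a Knuth invariant, gives the shape and the shape gives the tableau. Raising is
  injective and keeps shapes, so equality comes back down.\<close>

lemma tab_unique:
  "column_strict T \<Longrightarrow> column_strict T' \<Longrightarrow> knuth_equiv (tword T) (tword T') \<Longrightarrow> T = T'"
proof (induction "sum_list (tword T)" arbitrary: T T' rule: less_induct)
  case less
  show ?case
  proof (cases "hwd (tword T)")
    case True
    then have hw: "hwd (tword T')" using epsA_knuth less.prems(3) by metis
    have "rl T i = rl T' i" for i
      using hw_count[OF less.prems(1) True] hw_count[OF less.prems(2) hw] knuth_count less.prems(3) by metis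
    then have "shape T = shape T'" using shape_eq_iff less.prems by blast
    then show ?thesis using hw_tab_unique less.prems True hw by blast
  next
    case False
    then obtain r u where u: "E r (tword T) u" using E_exists by blast
    obtain v where v: "E r (tword T') v" "knuth_equiv u v" using E_knuth[OF less.prems(3) u] by blast
    obtain S where S: "u = tword S" "column_strict S" "shape S = shape T"
      using E_tword[OF less.prems(1) u] by blast
    obtain S' where S': "v = tword S'" "column_strict S'" "shape S' = shape T'"
      using E_tword[OF less.prems(2) v(1)] by blast
    have "sum_list (tword S) < sum_list (tword T)" using E_count(4)[OF u] S by simp
    then have "S = S'" using less.hyps S S' v by blast
    then show ?thesis using E_inj[of r "tword T" u "tword T'"] u v S S' tword_shape_inj by metis
  qed
qed

lemma Ptab_unique: "column_strict T \<Longrightarrow> knuth_equiv w (tword T) \<Longrightarrow> Ptab w = T"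
  by (rule tab_unique[OF column_strict_Ptab _ knuth_trans[OF knuth_sym[OF knuth_Ptab]]])

lemma Ptab_tword: "column_strict T \<Longrightarrow> Ptab (tword T) = T"
  by (simp add: Ptab_unique)

lemma Ptab_eq_iff: "Ptab u = Ptab v \<longleftrightarrow> knuth_equiv u v"
proof
  assume "Ptab u = Ptab v"
  then have "knuth_equiv u (tword (Ptab v))" using knuth_Ptab[of u] by simp
  then show "knuth_equiv u v" by (rule knuth_trans[OF _ knuth_sym[OF knuth_Ptab]])
next
  assume "knuth_equiv u v"
  then show "Ptab u = Ptab v" by (rule Ptab_unique[OF column_strict_Ptab knuth_trans[OF _ knuth_Ptab]])
qed

lemma eps_Ptab: "eps r (tword (Ptab w)) = eps r w"
  by (rule epsA_knuth[OF knuth_sym[OF knuth_Ptab]])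

lemma phi_Ptab: "phi r (tword (Ptab w)) = phi r w"
  by (rule phiA_knuth[OF knuth_sym[OF knuth_Ptab]])

lemma count_Ptab: "count_list (tword (Ptab w)) k = count_list w k"
  by (rule knuth_count[OF knuth_sym[OF knuth_Ptab]])

lemma set_Ptab: "set (tword (Ptab w)) = set w"
  by (rule knuth_set[OF knuth_sym[OF knuth_Ptab]])

lemma E_Ptab:
  assumes "E r w w'"
  shows "E r (tword (Ptab w)) (tword (Ptab w'))" "shape (Ptab w') = shape (Ptab w)"
proof -
  obtain v where v: "E r (tword (Ptab w)) v" "knuth_equiv w' v"
    using E_knuth[OF knuth_Ptab assms] by blast
  obtain T where T: "v = tword T" "column_strict T" "shape T = shape (Ptab w)"
    using E_tword[OF column_strict_Ptab v(1)] by blast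
  then have "Ptab w' = T" using Ptab_unique v by simp
  then show "E r (tword (Ptab w)) (tword (Ptab w'))" "shape (Ptab w') = shape (Ptab w)"
    using v T by auto
qed

text \<open>A prefix is either untouched or raised at the same letter, since a prefix of
  \<open>b\<close> has no unmatched \<open>r\<close> either; and raising keeps the shape.\<close>

lemma E_Qs:
  assumes "E r w w'" shows "Qs w w'"
proof -
  obtain a b where ab: "w = a @ Suc r # b" "w' = a @ r # b" "eps r a = 0" "phi r b = 0"
    using assms by (rule EE)
  have "shape (Ptab (take k w)) = shape (Ptab (take k w'))" for k
  proof (cases "k \<le> length a")
    case False
    then obtain n where n: "k = length a + Suc n" by (metis less_imp_Suc_add not_le add_Suc_right)
    have "phi r (take n b) = 0" using ab(4) phi_prefix[of r "take n b" "drop n b"] by simp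
    then have "E r (take k w) (take k w')" using EI[OF ab(3)] ab n by simp
    then show ?thesis using E_Ptab(2) by metis
  qed (simp add: ab)
  then show ?thesis by (simp add: Qs_def ab)
qed

lemma Es_Qs: "Es\<^sup>*\<^sup>* w w' \<Longrightarrow> Qs w w'"
proof (induction rule: rtranclp_induct)
  case (step v x)
  then show ?case using E_Qs Qs_trans by blast
qed simp

lemma ex_hw: "\<exists>h. Es\<^sup>*\<^sup>* w h \<and> hwd h"
proof (induction "sum_list w" arbitrary: w rule: less_induct)
  case less
  show ?case
  proof (cases "hwd w")
    case False
    then obtain r w' where E: "E r w w'" using E_exists by blast
    then obtain h where "Es\<^sup>*\<^sup>* w' h" "hwd h" using less[of w'] E_count(4) by auto
    then show ?thesis using E by (metis (mono_tags, lifting) converse_rtranclp_into_rtranclp)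
  qed blast
qed

lemma hw_Ptab_eq: "hwd u \<Longrightarrow> hwd v \<Longrightarrow> shape (Ptab u) = shape (Ptab v) \<Longrightarrow> Ptab u = Ptab v"
  by (simp add: hw_tab_unique eps_Ptab)

lemma rl_cong: "shape (Ptab u) = shape (Ptab v) \<Longrightarrow> rl (Ptab u) i = rl (Ptab v) i"
  by (simp add: shape_eq_iff)

lemma hw_unique: "hwd u \<Longrightarrow> hwd v \<Longrightarrow> Qs u v \<Longrightarrow> u = v"
  by (rule rsk_inj[OF _ hw_Ptab_eq[OF _ _ Qs_shape]])

lemma hw_rl: "hwd h \<Longrightarrow> rl (Ptab h) i = count_list h i"
  using hw_count[of "Ptab h"] by (simp add: eps_Ptab count_Ptab)

text \<open>The path from \<open>t\<close> to \<open>t'\<close> can be run backwards from any word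
  with the insertion tableau of \<open>t'\<close>: \<open>phi\<close> depends only on the Knuth
  class, so lowering remains possible, and it determines the insertion tableau.\<close>

lemma Es_lift:
  assumes "Es\<^sup>*\<^sup>* t t'" "Ptab v = Ptab t'"
  shows "\<exists>u. Ptab u = Ptab t \<and> Qs u v"
  using assms(1)
proof (induction rule: converse_rtranclp_induct)
  case base
  then show ?case using assms(2) by blast
next
  case (step t s)
  then obtain r v' where E: "E r t s" and v': "Ptab v' = Ptab s" "Qs v' v" by blast
  have "phi r v' = phi r s" using phi_Ptab v'(1) by metis
  then have "0 < phi r v'" using E_eps_phi(2)[OF E] by simp
  then obtain u where u: "E r u v'" using E_exists_inv by blast
  have "tword (Ptab u) = tword (Ptab t)"
    using E_inj E_Ptab(1)[OF u] E_Ptab(1)[OF E] v'(1) by metis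
  moreover have "shape (Ptab u) = shape (Ptab t)"
    using E_Ptab(2)[OF u] E_Ptab(2)[OF E] v'(1) by metis
  ultimately have "Ptab u = Ptab t" by (rule tword_shape_inj)
  then show ?case using E_Qs[OF u] v'(2) Qs_trans by blast
qed

text \<open>Walk from \<open>w\<close> up to highest weight, where the insertion tableau depends only on its shape, and from
  there down to \<open>T\<close>.\<close>

lemma ex_word:
  assumes "column_strict T" "shape T = shape (Ptab w)"
  shows "\<exists>w'. Ptab w' = T \<and> Qs w' w"
proof -
  obtain h where h: "Es\<^sup>*\<^sup>* w h" "hwd h" using ex_hw by blast
  obtain t where t: "Es\<^sup>*\<^sup>* (tword T) t" "hwd t" using ex_hw by blast
  have "shape (Ptab h) = shape (Ptab t)"
    using Qs_shape[OF Es_Qs[OF h(1)]] Qs_shape[OF Es_Qs[OF t(1)]] assms Ptab_tword by metis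
  then have "Ptab h = Ptab t" using hw_Ptab_eq h t by blast
  then obtain u where "Ptab u = Ptab (tword T)" "Qs u h" using Es_lift[OF t(1)] by blast
  then show ?thesis using Ptab_tword[OF assms(1)] Es_Qs[OF h(1)] Qs_sym Qs_trans by metis
qed

lemma sum_list_counts:
  fixes u v :: "nat list"
  assumes "\<And>k. count_list u k = count_list v k" shows "sum_list u = sum_list v"
proof -
  have "set u = set v" using assms by (metis count_list_0_iff subsetI subset_antisym)
  then show ?thesis using sum_list_map_eq_sum_count[of "\<lambda>x. x" u] sum_list_map_eq_sum_count[of "\<lambda>x. x" v] assms
    by simp
qed

text \<open>Raising keeps the shape and lowers the sum of the letters. A highest weight word above
  \<open>w\<close> has the shape as its content, which is already the content of \<open>w\<close>,
  so no step was taken. This makes highest weight provable by counting.\<close>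

lemma content_eq_shape_imp_hw:
  assumes "\<And>k. count_list w k = rl (Ptab w) k" shows "hwd w"
proof -
  obtain h where h: "Es\<^sup>*\<^sup>* w h" "hwd h" using ex_hw by blast
  have "rl (Ptab h) k = rl (Ptab w) k" for k
    by (rule rl_cong[OF Qs_shape[OF Qs_sym[OF Es_Qs[OF h(1)]]]])
  then have "sum_list h = sum_list w" using sum_list_counts[of h w] hw_rl[OF h(2)] assms by metis
  moreover have "w = h \<or> sum_list h < sum_list w"
    using h(1) by (induction rule: rtranclp_induct) (auto dest: E_count(4))
  ultimately show ?thesis using h(2) by auto
qed

lemma Ptab_shift: "Ptab (map (\<lambda>x. x + d) w) = map (map (\<lambda>x. x + d)) (Ptab w)"
proof (rule Ptab_unique)
  show "column_strict (map (map (\<lambda>x. x + d)) (Ptab w))"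
    using column_strict_Ptab[of w] unfolding column_strict_iff dominates_def
    by (auto simp: sorted_map sorted_wrt_iff_nth_less)
  have "tword (map (map (\<lambda>x. x + d)) T) = map (\<lambda>x. x + d) (tword T)" for T
    by (induction T) auto
  then show "knuth_equiv (map (\<lambda>x. x + d) w) (tword (map (map (\<lambda>x. x + d)) (Ptab w)))"
    using knuth_map_add[OF knuth_Ptab] by simp
qed

lemma rl_shift: "rl (Ptab (map (\<lambda>x. x + d) w)) i = rl (Ptab w) i"
  by (simp add: Ptab_shift rl_def)

section \<open>Prepending a letter\<close>

text \<open>If the prepended letter is itself the leftmost unmatched \<open>Suc r\<close>, it is
  raised first, and the raising of \<open>u\<close> follows as a second step.\<close>

lemma E_prepend:
  assumes "E r u u'" shows "\<exists>x'\<le>x. Es\<^sup>*\<^sup>* (x # u) (x' # u')"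
proof -
  obtain a b where u: "u = a @ Suc r # b" "u' = a @ r # b" "eps r a = 0" "phi r b = 0"
    using assms by (rule EE)
  have *: "E r (y # u) (y # u')" if "eps r (y # a) = 0" for y
    using EI[OF that u(4)] u by simp
  show ?thesis
  proof (cases "eps r (x # a) = 0")
    case False
    then have x: "x = Suc r" "phi r a = 0"
      using u(3) epsA_eq[of r a "Suc 0"] by (auto split: if_splits)
    then have "phi r u = 0" using u by simp
    then have "E r (x # u) (r # u)" using EI[of r "[]" u] x by simp
    moreover have "E r (r # u) (r # u')" using * u(3) by simp
    ultimately have "Es\<^sup>*\<^sup>* (x # u) (r # u')" by (metis (mono_tags, lifting) rtranclp.simps)
    then show ?thesis using x by (intro exI[of _ r]) auto
  qed (use * in blast)
qed

lemma Es_prepend: "Es\<^sup>*\<^sup>* u u' \<Longrightarrow> \<exists>x'\<le>x. Es\<^sup>*\<^sup>* (x # u) (x' # u')"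
proof (induction rule: rtranclp_induct)
  case (step v w)
  then obtain x' where x': "x' \<le> x" "Es\<^sup>*\<^sup>* (x # u) (x' # v)" by blast
  obtain x'' where "x'' \<le> x'" "Es\<^sup>*\<^sup>* (x' # v) (x'' # w)" using step E_prepend by blast
  then show ?case using x' by (metis (mono_tags, lifting) le_trans rtranclp_trans)
qed blast

text \<open>A first letter \<open>Suc r\<close> that \<open>h\<close> does not match can be raised
  to \<open>r\<close>; one that \<open>h\<close> matches leaves the word of highest weight. The
  descent stops at \<open>0\<close> at the latest.\<close>

lemma hw_prepend: "hwd h \<Longrightarrow> \<exists>x'\<le>x. Es\<^sup>*\<^sup>* (x # h) (x' # h) \<and> hwd (x' # h)"
proof (induction x)
  case 0
  then show ?case by (intro exI[of _ 0]) (auto simp: epsA_eq[of _ h "0 - 1"])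
next
  case (Suc r)
  show ?case
  proof (cases "phi r h = 0")
    case True
    then have "E r (Suc r # h) (r # h)" using EI[of r "[]" h] by simp
    moreover obtain x' where "x' \<le> r" "Es\<^sup>*\<^sup>* (r # h) (x' # h)" "hwd (x' # h)" using Suc by blast
    ultimately show ?thesis
      by (metis (mono_tags, lifting) converse_rtranclp_into_rtranclp le_SucI)
  next
    case False
    then have "hwd (Suc r # h)" using Suc.prems by (auto simp: epsA_eq[of r h "Suc 0"])
    then show ?thesis by blast
  qed
qed

text \<open>Raise \<open>u\<close> to a highest weight word \<open>h\<close>, then lower the first letter as far as possible, to \<open>x'\<close>;
  shape and content of \<open>x' # h\<close> and of \<open>h\<close> agree.\<close>

lemma prepend:
  obtains x' h where "x' \<le> x" "hwd h" "Qs u h" "hwd (x' # h)" "Qs (x # u) (x' # h)"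
    "\<And>i. rl (Ptab (x # u)) i = rl (Ptab u) i + (if i = x' then 1 else 0)"
proof -
  obtain h where h: "Es\<^sup>*\<^sup>* u h" "hwd h" using ex_hw by blast
  obtain y where y: "y \<le> x" "Es\<^sup>*\<^sup>* (x # u) (y # h)" using Es_prepend[OF h(1)] by blast
  obtain x' where x': "x' \<le> y" "Es\<^sup>*\<^sup>* (y # h) (x' # h)" "hwd (x' # h)" using hw_prepend[OF h(2)] by blast
  have 1: "Qs u h" using Es_Qs h(1) by blast
  have 2: "Qs (x # u) (x' # h)" using Es_Qs y(2) x'(2) Qs_trans by blast
  have "rl (Ptab (x # u)) i = rl (Ptab u) i + (if i = x' then 1 else 0)" for i
  proof -
    have "rl (Ptab (x # u)) i = count_list (x' # h) i"
      using rl_cong[OF Qs_shape[OF 2]] hw_rl[OF x'(3)] by simp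
    moreover have "rl (Ptab u) i = count_list h i"
      using rl_cong[OF Qs_shape[OF 1]] hw_rl[OF h(2)] by simp
    ultimately show ?thesis by simp
  qed
  then show thesis using that[of x' h] x' y h 1 2 le_trans by blast
qed

text \<open>The counterpart of \<open>Qs_snoc\<close> at the left end. Both words rise to highest
  weight words with the same tail, fixed by the recording tableau of \<open>u\<close>; the first
  letter is then the row of the added box, fixed by the shapes.\<close>

lemma Qs_Cons:
  assumes "Qs u v" "shape (Ptab (x # u)) = shape (Ptab (y # v))"
  shows "Qs (x # u) (y # v)"
proof -
  obtain x' h where x: "hwd h" "Qs u h" "Qs (x # u) (x' # h)"
    "\<And>i. rl (Ptab (x # u)) i = rl (Ptab u) i + (if i = x' then 1 else 0)"
    using prepend[of x u] by metis
  obtain y' k where y: "hwd k" "Qs v k" "Qs (y # v) (y' # k)"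
    "\<And>i. rl (Ptab (y # v)) i = rl (Ptab v) i + (if i = y' then 1 else 0)"
    using prepend[of y v] by metis
  have hk: "h = k"
    by (rule hw_unique[OF x(1) y(1) Qs_trans[OF Qs_sym[OF x(2)] Qs_trans[OF assms(1) y(2)]]])
  have "rl (Ptab (x # u)) x' = rl (Ptab (y # v)) x'" "rl (Ptab u) x' = rl (Ptab v) x'"
    by (rule rl_cong[OF assms(2)], rule rl_cong[OF Qs_shape[OF assms(1)]])
  then have "x' = y'" using x(4)[of x'] y(4)[of x'] by presburger
  with hk have "Qs (x' # h) (y # v)" using Qs_sym[OF y(3)] by simp
  with x(3) show ?thesis by (rule Qs_trans)
qed

section \<open>Strings and reflections\<close>

lemma rtranclp_linear:
  assumes "\<And>x y z. R x y \<Longrightarrow> R x z \<Longrightarrow> y = z" "R\<^sup>*\<^sup>* x y" "R\<^sup>*\<^sup>* x z"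
  shows "R\<^sup>*\<^sup>* y z \<or> R\<^sup>*\<^sup>* z y"
  using assms(2)
proof (induction rule: rtranclp_induct)
  case base
  then show ?case using assms(3) by blast
next
  case (step y y')
  show ?case
    using step.IH
  proof
    assume "R\<^sup>*\<^sup>* y z"
    then show ?thesis using step.hyps(2) assms(1) by (metis converse_rtranclpE rtranclp.simps)
  qed (use step.hyps(2) in \<open>auto intro: rtranclp.rtrancl_into_rtrancl\<close>)
qed

definition Str :: "nat \<Rightarrow> nat list \<Rightarrow> nat list \<Rightarrow> bool" where
  "Str r u v \<longleftrightarrow> (E r)\<^sup>*\<^sup>* u v \<or> (E r)\<^sup>*\<^sup>* v u"

lemma Str_sym: "Str r u v \<Longrightarrow> Str r v u"
  by (auto simp: Str_def)

lemma E_chain_count: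
  "(E r)\<^sup>*\<^sup>* u v \<Longrightarrow> u = v \<or> count_list u r < count_list v r"
  by (induction rule: rtranclp_induct) (auto dest: E_count(1))

lemma E_common_source: "(E r)\<^sup>*\<^sup>* u v \<Longrightarrow> (E r)\<^sup>*\<^sup>* u v' \<Longrightarrow> Str r v v'"
  using rtranclp_linear[of "E r" u v v'] E_unique by (auto simp: Str_def)

lemma E_common_target: "(E r)\<^sup>*\<^sup>* v u \<Longrightarrow> (E r)\<^sup>*\<^sup>* v' u \<Longrightarrow> Str r v v'"
  using rtranclp_linear[of "(E r)\<inverse>\<inverse>" u v v'] E_inj
  by (auto simp: Str_def rtranclp_conversep)

text \<open>Strings are linear because raising is functional and injective, and every step adds one
  \<open>r\<close>; so the number of letters \<open>r\<close> is a coordinate on the string.\<close>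

lemma Str_unique:
  assumes "Str r u v" "Str r u v'" "count_list v r = count_list v' r"
  shows "v = v'"
proof -
  have "Str r v v'"
    using assms(1,2) E_common_source[of r u v v'] E_common_target[of r v u v']
      rtranclp_trans[of "E r" v u v'] rtranclp_trans[of "E r" v' u v]
    unfolding Str_def by blast
  then show ?thesis using E_chain_count assms(3) unfolding Str_def by (metis less_irrefl)
qed

lemma E_chain_count_sum:
  "(E r)\<^sup>*\<^sup>* u v \<Longrightarrow> count_list u r + count_list u (Suc r) = count_list v r + count_list v (Suc r)"
proof (induction rule: rtranclp_induct)
  case (step v w)
  then show ?case using E_count(1,2)[of r v w] by simp
qed simp

lemma Str_count_sum:
  "Str r u v \<Longrightarrow> count_list u r + count_list u (Suc r) = count_list v r + count_list v (Suc r)"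
  unfolding Str_def using E_chain_count_sum by metis

lemma E_chain_Qs: "(E r)\<^sup>*\<^sup>* u v \<Longrightarrow> Qs u v"
proof (induction rule: rtranclp_induct)
  case (step v w)
  then show ?case using E_Qs Qs_trans by blast
qed simp

lemma Str_Qs: "Str r u v \<Longrightarrow> Qs u v"
  unfolding Str_def using E_chain_Qs Qs_sym by blast

lemma Str_map:
  assumes "Str r u v" "\<And>u v. E r u v \<Longrightarrow> E r' (f u) (f v)" shows "Str r' (f u) (f v)"
proof -
  have "(E r')\<^sup>*\<^sup>* (f x) (f y)" if "(E r)\<^sup>*\<^sup>* x y" for x y
    using that by (induction rule: rtranclp_induct) (auto intro: rtranclp.rtrancl_into_rtrancl assms(2))
  then show ?thesis using assms(1) by (auto simp: Str_def)
qed

text \<open>\<open>phi\<close> is a Knuth invariant, so \<open>v\<close> can be lowered as well;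
  injectivity of raising on tableau words identifies the two results up to Knuth
  equivalence.\<close>

lemma E_knuth_inv:
  assumes "E r u' u" "knuth_equiv u v" shows "\<exists>v'. E r v' v \<and> knuth_equiv u' v'"
proof -
  have P: "Ptab u = Ptab v" using Ptab_eq_iff assms(2) by simp
  have "0 < phi r v" using E_eps_phi(2)[OF assms(1)] phiA_knuth[OF assms(2)] by simp
  then obtain v' where v': "E r v' v" using E_exists_inv by blast
  have "tword (Ptab u') = tword (Ptab v')"
    using E_inj[OF E_Ptab(1)[OF assms(1)]] E_Ptab(1)[OF v'] P by simp
  moreover have "shape (Ptab u') = shape (Ptab v')"
    using E_Ptab(2)[OF assms(1)] E_Ptab(2)[OF v'] P by simp
  ultimately have "Ptab u' = Ptab v'" by (rule tword_shape_inj)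
  then show ?thesis using v' Ptab_eq_iff by blast
qed

lemma Str_knuth:
  assumes "Str r u u'" "knuth_equiv u v" shows "\<exists>v'. Str r v v' \<and> knuth_equiv u' v'"
proof -
  have 1: "\<exists>v'. (E r)\<^sup>*\<^sup>* v v' \<and> knuth_equiv u' v'" if "(E r)\<^sup>*\<^sup>* u u'"
    using that
  proof (induction rule: rtranclp_induct)
    case base
    then show ?case using assms(2) by blast
  next
    case (step x y)
    then obtain x' where x': "(E r)\<^sup>*\<^sup>* v x'" "knuth_equiv x x'" by blast
    obtain y' where "E r x' y'" "knuth_equiv y y'" using E_knuth[OF x'(2) step.hyps(2)] by blast
    then show ?case using x'(1) by (meson rtranclp.rtrancl_into_rtrancl)
  qed
  have 2: "\<exists>v'. (E r)\<^sup>*\<^sup>* v' v \<and> knuth_equiv u' v'" if "(E r)\<^sup>*\<^sup>* u' u"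
    using that
  proof (induction rule: converse_rtranclp_induct)
    case base
    then show ?case using assms(2) by blast
  next
    case (step y x)
    then obtain x' where x': "(E r)\<^sup>*\<^sup>* x' v" "knuth_equiv x x'" by blast
    obtain y' where "E r y' x'" "knuth_equiv y y'" using E_knuth_inv[OF step.hyps(1) x'(2)] by blast
    then show ?case using x'(1) by (meson converse_rtranclp_into_rtranclp)
  qed
  show ?thesis using assms(1) 1 2 unfolding Str_def by blast
qed

section \<open>Computing a reflection from the unmatched letters\<close>

lemma fill_pos_Nil [simp]: "fill_pos S [] vs = []"
  by (simp add: fill_pos_def)

lemma fill_pos_Cons:
  "fill_pos S (x # w) vs = (if 0 \<in> S then vs ! 0 # fill_pos {i. Suc i \<in> S} w (drop 1 vs)
     else x # fill_pos {i. Suc i \<in> S} w vs)"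
  if "0 \<in> S \<longrightarrow> vs \<noteq> []"
proof -
  have card: "card {j \<in> S. j < Suc i} = (if 0 \<in> S then 1 else 0) + card {j. Suc j \<in> S \<and> j < i}" for i
  proof -
    have "{j \<in> S. j < Suc i} = (if 0 \<in> S then {0} else {}) \<union> Suc ` {j. Suc j \<in> S \<and> j < i}"
      by (auto simp: image_iff) (metis not0_implies_Suc Suc_less_eq)+
    then show ?thesis by (simp add: card_Un_disjoint card_image image_iff)
  qed
  have "[0..<length (x # w)] = 0 # map Suc [0..<length w]" by (simp add: map_Suc_upt upt_conv_Cons del: upt_Suc)
  then show ?thesis using that unfolding fill_pos_def
    by (auto simp: card comp_def nth_Cons' neq_Nil_conv)
qed

lemma fill_pos_skip:
  "(\<forall>i<length D. i \<notin> S) \<Longrightarrow> fill_pos S (D @ w) vs = D @ fill_pos {i. i + length D \<in> S} w vs"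
proof (induction D arbitrary: S)
  case (Cons x D)
  have "0 \<notin> S" using Cons.prems by auto
  moreover have "\<forall>i<length D. i \<notin> {i. Suc i \<in> S}" using Cons.prems by auto
  ultimately show ?case using Cons.IH[of "{i. Suc i \<in> S}"] by (simp add: fill_pos_Cons)
qed simp

text \<open>A word cut at its unmatched letters: the pieces in between are balanced.\<close>

definition asm :: "(nat list \<times> nat) list \<Rightarrow> nat list \<Rightarrow> nat list" where
  "asm ps D = concat (map (\<lambda>(C, c). C @ [c]) ps) @ D"

fun pos :: "nat \<Rightarrow> (nat list \<times> nat) list \<Rightarrow> nat list" where
  "pos n [] = []"
| "pos n ((C, c) # ps) = (n + length C) # pos (Suc (n + length C)) ps"

lemma asm_simps [simp]: "asm [] D = D" "asm ((C, c) # ps) D = C @ c # asm ps D"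
  by (auto simp: asm_def)

lemma length_pos [simp]: "length (pos n ps) = length ps"
  by (induction n ps rule: pos.induct) auto

lemma pos_append: "pos n (ps @ qs) = pos n ps @ pos (n + length (asm ps [])) qs"
  by (induction n ps rule: pos.induct) (auto simp: add_ac)

lemma pos_bounds: "i \<in> set (pos n ps) \<Longrightarrow> n \<le> i \<and> i < n + length (asm ps [])"
  by (induction n ps rule: pos.induct) auto

lemma distinct_pos: "distinct (pos n ps)"
  by (induction n ps rule: pos.induct) (auto dest: pos_bounds)

lemma pos_shift: "pos (n + k) ps = map (\<lambda>i. i + k) (pos n ps)"
proof (induction n ps rule: pos.induct)
  case (2 n C c ps)
  then show ?case by (simp add: add_ac)
qed simp

lemma nth_pos: "map (\<lambda>i. (w @ asm ps D) ! i) (pos (length w) ps) = map snd ps"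
proof (induction ps arbitrary: w)
  case (Cons p ps)
  obtain C c where p: "p = (C, c)" by force
  have "map (\<lambda>i. ((w @ C @ [c]) @ asm ps D) ! i) (pos (length (w @ C @ [c])) ps) = map snd ps"
    by (rule Cons.IH)
  then show ?case by (simp add: p nth_append)
qed simp

lemma fill_pos_asm:
  "length vs = length ps \<Longrightarrow> fill_pos (set (pos 0 ps)) (asm ps D) vs = asm (zip (map fst ps) vs) D"
proof (induction ps arbitrary: vs)
  case Nil
  then show ?case using fill_pos_skip[of D "{}" "[]"] by simp
next
  case (Cons p ps)
  obtain C c where p: "p = (C, c)" by force
  obtain v vs' where vs: "vs = v # vs'" using Cons.prems by (cases vs) auto
  have S: "set (pos 0 (p # ps)) = (\<lambda>i. i + length C) ` insert 0 (Suc ` set (pos 0 ps))"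
    using pos_shift[of 0 "Suc (length C)" ps] by (simp add: p image_image)
  have s: "{i. i + length C \<in> set (pos 0 (p # ps))} = insert 0 (Suc ` set (pos 0 ps))"
    unfolding S by (simp only: add_right_cancel image_iff bex_simps) blast
  have "\<forall>i<length C. i \<notin> set (pos 0 (p # ps))" unfolding S by auto
  then have "fill_pos (set (pos 0 (p # ps))) (asm (p # ps) D) vs =
    C @ fill_pos (insert 0 (Suc ` set (pos 0 ps))) (c # asm ps D) vs"
    using fill_pos_skip[of C "set (pos 0 (p # ps))" "c # asm ps D" vs] unfolding s by (simp add: p)
  also have "\<dots> = C @ v # fill_pos (set (pos 0 ps)) (asm ps D) vs'"
    by (simp add: fill_pos_Cons vs inj_image_mem_iff)
  also have "fill_pos (set (pos 0 ps)) (asm ps D) vs' = asm (zip (map fst ps) vs') D"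
    by (rule Cons.IH) (use Cons.prems vs in simp)
  finally show ?case by (simp add: vs p)
qed

text \<open>The stack of \<open>matched_aux\<close> after reading a word; carrying it along lets
  \<open>matched_aux\<close> split over concatenation.\<close>

fun mstk :: "nat \<Rightarrow> nat list \<Rightarrow> nat \<Rightarrow> nat list \<Rightarrow> nat list" where
  "mstk r st i [] = st"
| "mstk r st i (x # xs) =
     (if x = Suc r then mstk r (i # st) (Suc i) xs
      else if x = r \<and> st \<noteq> [] then mstk r (tl st) (Suc i) xs
      else mstk r st (Suc i) xs)"

lemma matched_aux_append:
  "matched_aux r st i (xs @ ys) = matched_aux r st i xs \<union> matched_aux r (mstk r st i xs) (i + length xs) ys"
  by (induction r st i xs rule: mstk.induct) auto

lemma matched_aux_lt: "\<forall>j\<in>set st. j < n \<Longrightarrow> i \<in> matched_aux r st n ys \<Longrightarrow> i < n + length ys"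
proof (induction ys arbitrary: st n)
  case (Cons x ys)
  consider "x = Suc r" | "x = r" "st \<noteq> []" | "x \<noteq> Suc r" "x = r \<longrightarrow> st = []" by blast
  then show ?case
  proof cases
    case 1
    then show ?thesis using Cons.IH[of "n # st" "Suc n"] Cons.prems by (simp add: less_SucI)
  next
    case 2
    then have "hd st < n" "\<forall>j\<in>set (tl st). j < Suc n"
      using Cons.prems(1) by (auto simp: list.set_sel less_SucI)
    then show ?thesis using Cons.IH[of "tl st" "Suc n"] Cons.prems(2) 2 by auto
  next
    case 3
    then have "i \<in> matched_aux r st (Suc n) ys" using Cons.prems(2) by auto
    then show ?thesis using Cons.IH[of st "Suc n"] Cons.prems(1) by (simp add: less_SucI)
  qed
qed simp

lemma mstk_append: "mstk r st i (xs @ ys) = mstk r (mstk r st i xs) (i + length xs) ys"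
  by (induction r st i xs rule: mstk.induct) auto

definition bal :: "nat \<Rightarrow> nat list \<Rightarrow> bool" where
  "bal r w \<longleftrightarrow> (\<forall>k. epsA r w k = k \<and> phiA r w k = k)"

text \<open>Induction on the last letter. A \<open>Suc r\<close> becomes a new unmatched letter. An
  \<open>r\<close> does so if no left parenthesis is pending; otherwise it closes the last one, and
  two balanced pieces merge around the matched pair. The stack lists the positions of the pending
  left parentheses, the last one on top.\<close>

lemma unmatched_asm:
  "\<exists>ps D a b. xs = asm ps D \<and> (\<forall>p\<in>set ps. bal r (fst p)) \<and> bal r D \<and>
     map snd ps = replicate a r @ replicate b (Suc r) \<and>
     mstk r [] 0 xs = rev (drop a (pos 0 ps)) \<and>
     {i. i < length xs \<and> (xs ! i = r \<or> xs ! i = Suc r)} - matched_aux r [] 0 xs = set (pos 0 ps)"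
proof (induction xs rule: rev_induct)
  case Nil
  show ?case by (rule exI[of _ "[]"], rule exI[of _ "[]"]) (auto simp: bal_def)
next
  case (snoc x xs)
  then obtain ps D a b where IH: "xs = asm ps D" "\<forall>p\<in>set ps. bal r (fst p)" "bal r D"
    "map snd ps = replicate a r @ replicate b (Suc r)" "mstk r [] 0 xs = rev (drop a (pos 0 ps))"
    "{i. i < length xs \<and> (xs ! i = r \<or> xs ! i = Suc r)} - matched_aux r [] 0 xs = set (pos 0 ps)"
    by blast
  let ?U = "\<lambda>xs. {i. i < length xs \<and> (xs ! i = r \<or> xs ! i = Suc r)} - matched_aux r [] 0 xs"
  have lt: "i < length xs" if "i \<in> matched_aux r [] 0 xs" for i
    using matched_aux_lt[OF _ that] by simp
  have lps: "length ps = a + b" using IH(4) by (metis length_append length_map length_replicate)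
  have p1: "pos 0 (ps @ [(D, y)]) = pos 0 ps @ [length xs]" for y by (simp add: pos_append IH(1) asm_def)
  have U: "?U (xs @ [x]) = (if x = r \<or> x = Suc r then {length xs} else {}) \<union>
      {i. i < length xs \<and> (xs ! i = r \<or> xs ! i = Suc r)} - matched_aux r [] 0 (xs @ [x])"
    by (auto simp: nth_append less_Suc_eq)
  have n: "length xs \<notin> matched_aux r [] 0 xs" using lt by blast
  have e1: "xs @ [x] = asm (ps @ [(D, x)]) []" by (simp add: IH(1) asm_def)
  consider (L) "x = Suc r" | (Z) "x = r" "b = 0" | (M) "x = r" "b > 0" | (O) "x \<noteq> r" "x \<noteq> Suc r"
    by blast
  then show ?case
  proof cases
    case L
    have "?U (xs @ [x]) = set (pos 0 (ps @ [(D, x)]))"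
      unfolding U using L IH(6) n by (auto simp: matched_aux_append p1)
    moreover have "mstk r [] 0 (xs @ [x]) = rev (drop a (pos 0 (ps @ [(D, x)])))"
      using L IH(5) lps by (simp add: mstk_append p1)
    moreover have "map snd (ps @ [(D, x)]) = replicate a r @ replicate (Suc b) (Suc r)"
      using L IH(4) by (simp add: replicate_append_same)
    ultimately show ?thesis using e1 IH(2,3)
      by (intro exI[of _ "ps @ [(D, x)]"] exI[of _ "[]"] exI[of _ a] exI[of _ "Suc b"]) (auto simp: bal_def)
  next
    case Z
    have st: "mstk r [] 0 xs = []" using IH(5) lps Z by simp
    have "?U (xs @ [x]) = set (pos 0 (ps @ [(D, x)]))"
      unfolding U using Z IH(6) n st by (auto simp: matched_aux_append p1)
    moreover have "mstk r [] 0 (xs @ [x]) = rev (drop (Suc a) (pos 0 (ps @ [(D, x)])))"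
      using Z st lps by (simp add: mstk_append p1)
    moreover have "map snd (ps @ [(D, x)]) = replicate (Suc a) r @ replicate 0 (Suc r)"
      using Z IH(4) by (simp add: replicate_append_same)
    ultimately show ?thesis using e1 IH(2,3)
      by (intro exI[of _ "ps @ [(D, x)]"] exI[of _ "[]"] exI[of _ "Suc a"] exI[of _ 0]) (auto simp: bal_def)
  next
    case M
    then obtain c where c: "b = Suc c" by (cases b) auto
    have "map snd ps = (replicate a r @ replicate c (Suc r)) @ [Suc r]"
      using IH(4) c by (simp add: replicate_append_same)
    moreover from this obtain ps' C y where "ps = ps' @ [(C, y)]" by (cases ps rule: rev_exhaust) auto
    ultimately have ps: "ps = ps' @ [(C, Suc r)]" "map snd ps' = replicate a r @ replicate c (Suc r)"
      by auto
    define q where "q = length (asm ps' C)"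
    have pq: "pos 0 ps = pos 0 ps' @ [q]" by (simp add: ps pos_append q_def asm_def)
    have lps': "length ps' = a + c" using lps ps c by simp
    have qn: "q < length xs" by (simp add: q_def IH(1) ps asm_def)
    have q': "q \<notin> set (pos 0 ps')" by (auto simp: q_def asm_def dest: pos_bounds)
    have st: "mstk r [] 0 xs = q # rev (drop a (pos 0 ps'))" using IH(5) pq lps' by simp
    have "?U (xs @ [x]) = ?U xs - {q}"
      unfolding U using M st by (auto simp: matched_aux_append)
    then have "?U (xs @ [x]) = set (pos 0 ps')" using IH(6) pq q' by auto
    moreover have "mstk r [] 0 (xs @ [x]) = rev (drop a (pos 0 ps'))"
      using M st by (simp add: mstk_append)
    moreover have "xs @ [x] = asm ps' (C @ Suc r # D @ [r])"
      using M by (simp add: IH(1) ps asm_def)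
    moreover have "bal r (C @ Suc r # D @ [r])"
      using IH(2,3) ps by (auto simp: bal_def)
    ultimately show ?thesis using IH(2) ps
      by (intro exI[of _ ps'] exI[of _ "C @ Suc r # D @ [r]"] exI[of _ a] exI[of _ c]) auto
  next
    case O
    have "?U (xs @ [x]) = set (pos 0 ps)"
      unfolding U using O IH(6) by (simp add: matched_aux_append)
    moreover have "mstk r [] 0 (xs @ [x]) = rev (drop a (pos 0 ps))"
      using O IH(5) by (simp add: mstk_append)
    moreover have "xs @ [x] = asm ps (D @ [x])" by (simp add: IH(1) asm_def)
    moreover have "bal r (D @ [x])" using IH(3) O by (auto simp: bal_def)
    ultimately show ?thesis using IH(2,4)
      by (intro exI[of _ ps] exI[of _ "D @ [x]"] exI[of _ a] exI[of _ b]) auto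
  qed
qed

lemma eps_asm:
  "\<forall>C\<in>set Cs. bal r C \<Longrightarrow> bal r D \<Longrightarrow> epsA r (asm (zip Cs (replicate (length Cs) r)) D) 0 = 0"
  by (induction Cs) (auto simp: bal_def)

lemma phi_asm:
  "\<forall>C\<in>set Cs. bal r C \<Longrightarrow> bal r D \<Longrightarrow> phi r (asm (zip Cs (replicate (length Cs) (Suc r))) D) = 0"
  by (induction Cs) (auto simp: bal_def)

lemma E_asm:
  assumes bal: "\<forall>C\<in>set (As @ C # Bs). bal r C" "bal r D"
  shows "E r (asm (zip (As @ C # Bs) (replicate (length As) r @ replicate (Suc (length Bs)) (Suc r))) D)
             (asm (zip (As @ C # Bs) (replicate (Suc (length As)) r @ replicate (length Bs) (Suc r))) D)"
proof -
  have r: "replicate (Suc (length As)) r = replicate (length As) r @ [r]" by (simp add: replicate_append_same)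
  have a: "asm (qs @ (C, y) # ps) D = asm qs C @ y # asm ps D" for qs ps y
    by (simp add: asm_def)
  have "eps r (asm (zip As (replicate (length As) r)) C) = 0"
    using eps_asm[of As r C] bal by simp
  moreover have "phi r (asm (zip Bs (replicate (length Bs) (Suc r))) D) = 0"
    using phi_asm[of Bs r D] bal by simp
  ultimately show ?thesis unfolding r by (simp add: a EI)
qed

lemma count_asm:
  "length cs = length Cs \<Longrightarrow> count_list (asm (zip Cs cs) D) x = count_list (concat Cs @ D) x + count_list cs x"
  by (induction cs Cs rule: list_induct2) auto

text \<open>With the balanced pieces kept fixed, the words \<open>g k\<close> with \<open>k\<close>
  letters \<open>r\<close> among the unmatched ones form a chain of raising steps. The word is
  \<open>g a\<close> and its image is \<open>g b\<close>, so both lie on one string. The two facts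
  shown characterise the reflection (\<open>s_op_eqI\<close>).\<close>

lemma s_op_spec: "Str r u (s_op r u) \<and> count_list (s_op r u) r = count_list u (Suc r)"
proof -
  obtain ps D a b where ps: "u = asm ps D" "\<forall>p\<in>set ps. bal r (fst p)" "bal r D"
    "map snd ps = replicate a r @ replicate b (Suc r)"
    "{i. i < length u \<and> (u ! i = r \<or> u ! i = Suc r)} - matched_aux r [] 0 u = set (pos 0 ps)"
    using unmatched_asm[of u r] by blast
  define Cs where "Cs = map fst ps"
  define g where "g k = asm (zip Cs (replicate k r @ replicate (length Cs - k) (Suc r))) D" for k
  have bal: "\<forall>C\<in>set Cs. bal r C" using ps(2) by (auto simp: Cs_def)
  have len: "length Cs = a + b" using arg_cong[OF ps(4), of length] by (simp add: Cs_def)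
  have card: "card {i \<in> set (pos 0 ps). u ! i = x} = count_list (map snd ps) x" for x
  proof -
    have "{i \<in> set (pos 0 ps). u ! i = x} = set (filter (\<lambda>i. u ! i = x) (pos 0 ps))" by auto
    then have "card {i \<in> set (pos 0 ps). u ! i = x} = length (filter (\<lambda>i. u ! i = x) (pos 0 ps))"
      by (metis distinct_card distinct_filter distinct_pos)
    also have "\<dots> = count_list (map (\<lambda>i. u ! i) (pos 0 ps)) x"
      by (simp add: count_list_eq_length_filter filter_map comp_def eq_commute)
    finally show ?thesis using nth_pos[of "[]" ps D] ps(1) by simp
  qed
  have ca: "card {i \<in> set (pos 0 ps). u ! i = r} = a" "card {i \<in> set (pos 0 ps). u ! i = Suc r} = b"
    unfolding card ps(4) by (auto simp: count_replicate)
  have "s_op r u = fill_pos (set (pos 0 ps)) u (replicate b r @ replicate a (Suc r))"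
    unfolding s_op_def Let_def ps(5) ca ..
  also have "\<dots> = asm (zip Cs (replicate b r @ replicate a (Suc r))) D"
    using fill_pos_asm[of "replicate b r @ replicate a (Suc r)" ps D] ps(1) len by (simp add: Cs_def)
  also have "\<dots> = g b" by (simp add: g_def len)
  finally have s: "s_op r u = g b" .
  have "ps = zip Cs (map snd ps)" unfolding Cs_def by (simp add: zip_map_fst_snd)
  then have u: "u = g a" using ps(1,4) len by (simp add: g_def)
  have chain: "(E r)\<^sup>*\<^sup>* (g i) (g j)" if "i \<le> j" "j \<le> length Cs" for i j
    using that
  proof (induction rule: dec_induct)
    case (step n)
    define As C Bs where "As = take n Cs" and "C = Cs ! n" and "Bs = drop (Suc n) Cs"
    have Cs: "Cs = As @ C # Bs" using step.prems step.hyps by (simp add: As_def C_def Bs_def id_take_nth_drop)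
    have n: "n = length As" "length Cs - n = Suc (length Bs)" "length Cs - Suc n = length Bs"
      using step.prems step.hyps by (auto simp: As_def Bs_def)
    have "E r (g n) (g (Suc n))"
      using E_asm[OF bal[unfolded Cs] ps(3)] unfolding g_def n(2,3) n(1)[symmetric] Cs[symmetric] .
    then show ?case using step by (auto intro: rtranclp.rtrancl_into_rtrancl)
  qed simp
  have "Str r u (s_op r u)"
    using chain[of a b] chain[of b a] len u s unfolding Str_def by (cases "a \<le> b") auto
  moreover have "count_list (concat Cs @ D) r = count_list (concat Cs @ D) (Suc r)"
  proof -
    have "bal r (concat Cs @ D)" using bal ps(3) by (induction Cs) (auto simp: bal_def)
    then show ?thesis using eps_phi_count[of r "concat Cs @ D"] by (simp only: bal_def)
  qed
  then have "count_list (s_op r u) r = count_list u (Suc r)"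
    using len unfolding s by (subst u) (simp add: g_def count_asm count_replicate)
  ultimately show ?thesis by blast
qed

lemma s_op_eqI: "Str r u v \<Longrightarrow> count_list v r = count_list u (Suc r) \<Longrightarrow> s_op r u = v"
  using s_op_spec[of r u] Str_unique[of r u "s_op r u" v] by simp

lemma s_op_Str: "Str r u (s_op r u)"
  using s_op_spec by blast

lemma s_op_count: "count_list (s_op r u) k = count_list u (transp_fun r k)"
proof -
  have 1: "count_list (s_op r u) r = count_list u (Suc r)" using s_op_spec by blast
  have 2: "count_list (s_op r u) (Suc r) = count_list u r" using Str_count_sum[OF s_op_Str[of r u]] 1 by simp
  have 3: "count_list x k = count_list y k" if "(E r)\<^sup>*\<^sup>* x y" "k \<noteq> r" "k \<noteq> Suc r" for x y
    using that by (induction rule: rtranclp_induct) (auto dest: E_count(3))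
  show ?thesis using 1 2 3 s_op_Str[of r u] unfolding Str_def transp_fun_def by metis
qed

lemma s_op_invol [simp]: "s_op r (s_op r u) = u"
  by (rule s_op_eqI[OF Str_sym[OF s_op_Str]]) (simp add: s_op_count transp_fun_def)

lemma s_op_Qs: "Qs u (s_op r u)"
  by (rule Str_Qs[OF s_op_Str])

lemma s_op_knuth:
  assumes "knuth_equiv u v" shows "knuth_equiv (s_op r u) (s_op r v)"
proof -
  obtain v' where v': "Str r v v'" "knuth_equiv (s_op r u) v'" using Str_knuth[OF s_op_Str assms] by blast
  have "count_list v' r = count_list v (Suc r)"
    using knuth_count[OF v'(2), of r] knuth_count[OF assms, of "Suc r"] by (simp add: s_op_count transp_fun_def)
  then show ?thesis using s_op_eqI[OF v'(1)] v'(2) by simp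
qed

lemma s_op_fix: "eps r u = 0 \<Longrightarrow> phi r u = 0 \<Longrightarrow> s_op r u = u"
  by (rule s_op_eqI) (use eps_phi_count[of r u] in \<open>auto simp: Str_def\<close>)

lemma s_op_shift: "s_op (r + d) (map (\<lambda>x. x + d) u) = map (\<lambda>x. x + d) (s_op r u)"
proof (rule s_op_eqI)
  have "E (r + d) (map (\<lambda>x. x + d) u) (map (\<lambda>x. x + d) v)" if "E r u v" for u v
    using that by (rule EE) (use EI[of "r + d" "map (\<lambda>x. x + d) _" "map (\<lambda>x. x + d) _"] in
      \<open>auto simp: epsA_shift phiA_shift\<close>)
  then show "Str (r + d) (map (\<lambda>x. x + d) u) (map (\<lambda>x. x + d) (s_op r u))"
    by (rule Str_map[OF s_op_Str])
  have "count_list (map (\<lambda>x. x + d) w) (k + d) = count_list w k" for w k by (induction w) auto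
  from this[of _ r] this[of _ "Suc r"]
  show "count_list (map (\<lambda>x. x + d) (s_op r u)) (r + d) = count_list (map (\<lambda>x. x + d) u) (Suc (r + d))"
    by (simp add: s_op_count transp_fun_def)
qed

lemma s_op_single: "s_op r [x] = [transp_fun r x]"
proof (rule s_op_eqI)
  have "E r [Suc r] [r]" using EI[of r "[]" "[]"] by simp
  then show "Str r [x] [transp_fun r x]" by (auto simp: Str_def transp_fun_def)
qed (auto simp: transp_fun_def)

section \<open>Reflections act locally and on subwords\<close>

definition pat :: "nat set \<Rightarrow> nat list \<Rightarrow> nat list \<Rightarrow> bool" where
  "pat B = list_all2 (\<lambda>x y. x = y \<or> x \<in> B \<and> y \<in> B)"

lemma pat_refl [simp]: "pat B u u"
  by (simp add: pat_def list_all2_refl)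

lemma pat_sym: "pat B u v \<Longrightarrow> pat B v u"
  unfolding pat_def by (auto simp: list_all2_conv_all_nth)

lemma pat_trans: "pat B u v \<Longrightarrow> pat B v w \<Longrightarrow> pat B u w"
  unfolding pat_def list_all2_conv_all_nth by metis

lemma pat_mono: "pat B u v \<Longrightarrow> B \<subseteq> C \<Longrightarrow> pat C u v"
  unfolding pat_def by (erule list_all2_mono) auto

text \<open>Reduces an identity between operators that change only letters of \<open>B\<close> to
  the subwords on \<open>B\<close>.\<close>

lemma pat_eq: "pat B u v \<Longrightarrow> filter (\<lambda>x. x \<in> B) u = filter (\<lambda>x. x \<in> B) v \<Longrightarrow> u = v"
  unfolding pat_def by (induction u v rule: list_all2_induct) (auto split: if_splits)

lemma pat_filter: "pat B u v \<Longrightarrow> B \<inter> C = {} \<Longrightarrow> filter (\<lambda>x. x \<in> C) u = filter (\<lambda>x. x \<in> C) v"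
  unfolding pat_def by (induction u v rule: list_all2_induct) auto

lemma E_pat: "E r u v \<Longrightarrow> pat {r, Suc r} u v"
  by (auto simp: pat_def elim!: EE intro!: list_all2_appendI list_all2_refl)

lemma Str_pat: "Str r u v \<Longrightarrow> pat {r, Suc r} u v"
proof -
  have "pat {r, Suc r} x y" if "(E r)\<^sup>*\<^sup>* x y" for x y
    using that
  proof (induction rule: rtranclp_induct)
    case (step y z)
    then show ?case using E_pat pat_trans by blast
  qed simp
  then show "Str r u v \<Longrightarrow> pat {r, Suc r} u v" unfolding Str_def using pat_sym by blast
qed

lemma s_op_pat: "pat {r, Suc r} u (s_op r u)"
  by (rule Str_pat[OF s_op_Str])

lemma s_op_filter:
  assumes "r \<in> B" "Suc r \<in> B"
  shows "filter (\<lambda>x. x \<in> B) (s_op r u) = s_op r (filter (\<lambda>x. x \<in> B) u)"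
proof (rule s_op_eqI[symmetric])
  have "E r (filter (\<lambda>x. x \<in> B) u) (filter (\<lambda>x. x \<in> B) v)" if "E r u v" for u v
    using that assms EI[of r "filter (\<lambda>x. x \<in> B) _" "filter (\<lambda>x. x \<in> B) _"]
    by (auto elim!: EE simp: epsA_filter phiA_filter)
  then show "Str r (filter (\<lambda>x. x \<in> B) u) (filter (\<lambda>x. x \<in> B) (s_op r u))"
    by (rule Str_map[OF s_op_Str])
  have "count_list (filter (\<lambda>x. x \<in> B) w) k = count_list w k" if "k \<in> B" for w k
    using that by (induction w) auto
  then show "count_list (filter (\<lambda>x. x \<in> B) (s_op r u)) r = count_list (filter (\<lambda>x. x \<in> B) u) (Suc r)"
    using assms by (simp add: s_op_count transp_fun_def)
qed

lemma s_op_filter_disjoint: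
  "r \<notin> C \<Longrightarrow> Suc r \<notin> C \<Longrightarrow> filter (\<lambda>x. x \<in> C) (s_op r u) = filter (\<lambda>x. x \<in> C) u"
  using pat_filter[OF s_op_pat, of r C u] by auto

text \<open>The two pairs of letters are disjoint, so each operator leaves the subword on the other
  pair alone; both sides agree on the two subwords and at all other positions.\<close>

lemma s_op_commute:
  assumes "Suc r < s" shows "s_op r (s_op s u) = s_op s (s_op r u)"
proof -
  let ?A = "{r, Suc r}" and ?C = "{s, Suc s}"
  let ?P = "list_all2 (\<lambda>x y. x = y \<or> x \<in> ?A \<and> y \<in> ?A \<or> x \<in> ?C \<and> y \<in> ?C)"
  have P: "pat ?A x y \<Longrightarrow> ?P x y" "pat ?C x y \<Longrightarrow> ?P x y" for x y
    unfolding pat_def by (erule list_all2_mono, blast)+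
  have tr: "?P x z" if "?P x y" "?P y z" for x y z
    by (rule list_all2_trans[OF _ that]) (use assms in auto)
  have eq: "x = y" if "?P x y" "filter (\<lambda>x. x \<in> ?A) x = filter (\<lambda>x. x \<in> ?A) y"
    "filter (\<lambda>x. x \<in> ?C) x = filter (\<lambda>x. x \<in> ?C) y" for x y
    using that by (induction x y rule: list_all2_induct) (use assms in \<open>auto split: if_splits\<close>)
  have A: "filter (\<lambda>x. x \<in> ?A) (s_op r x) = s_op r (filter (\<lambda>x. x \<in> ?A) x)"
    "filter (\<lambda>x. x \<in> ?A) (s_op s x) = filter (\<lambda>x. x \<in> ?A) x" for x
    by (rule s_op_filter s_op_filter_disjoint; use assms in simp)+
  have C: "filter (\<lambda>x. x \<in> ?C) (s_op s x) = s_op s (filter (\<lambda>x. x \<in> ?C) x)"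
    "filter (\<lambda>x. x \<in> ?C) (s_op r x) = filter (\<lambda>x. x \<in> ?C) x" for x
    by (rule s_op_filter s_op_filter_disjoint; use assms in simp)+
  show ?thesis
  proof (rule eq)
    show "?P (s_op r (s_op s u)) (s_op s (s_op r u))"
      by (rule tr[OF P(1)[OF pat_sym[OF s_op_pat]] tr[OF P(2)[OF pat_sym[OF s_op_pat]]
        tr[OF P(1)[OF s_op_pat] P(2)[OF s_op_pat]]]])
    show "filter (\<lambda>x. x \<in> ?A) (s_op r (s_op s u)) = filter (\<lambda>x. x \<in> ?A) (s_op s (s_op r u))"
      by (simp only: A)
    show "filter (\<lambda>x. x \<in> ?C) (s_op r (s_op s u)) = filter (\<lambda>x. x \<in> ?C) (s_op s (s_op r u))"
      by (simp only: C)
  qed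
qed

section \<open>The braid relation\<close>

text \<open>The reading word of a tableau on the three letters \<open>r\<close>, \<open>r + 1\<close>, \<open>r + 2\<close>.\<close>

definition Fw :: "nat \<Rightarrow> nat \<Rightarrow> nat \<Rightarrow> nat \<Rightarrow> nat \<Rightarrow> nat \<Rightarrow> nat \<Rightarrow> nat list" where
  "Fw r a b c d e f = replicate c (Suc (Suc r)) @ (replicate b (Suc r) @ replicate d (Suc (Suc r))) @
     (replicate a r @ replicate e (Suc r) @ replicate f (Suc (Suc r)))"

lemma sorted_three_letters:
  "sorted w \<Longrightarrow> set w \<subseteq> {r, Suc r, Suc (Suc r)} \<Longrightarrow>
     \<exists>a e f. w = replicate a r @ replicate e (Suc r) @ replicate f (Suc (Suc r))"
proof (induction w)
  case (Cons x w)
  then obtain a e f where w: "w = replicate a r @ replicate e (Suc r) @ replicate f (Suc (Suc r))" by auto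
  consider "x = r" | "x = Suc r" | "x = Suc (Suc r)" using Cons.prems by auto
  then show ?case
  proof cases
    case 1
    then show ?thesis using w by (intro exI[of _ "Suc a"] exI[of _ e] exI[of _ f]) auto
  next
    case 2
    then have "a = 0" using Cons.prems(1) w by (cases a) auto
    then show ?thesis using w 2 by (intro exI[of _ 0] exI[of _ "Suc e"] exI[of _ f]) auto
  next
    case 3
    then have "a = 0" "e = 0" using Cons.prems(1) w by (cases a; cases e; auto)+
    then show ?thesis using w 3 by (intro exI[of _ 0] exI[of _ 0] exI[of _ "Suc f"]) auto
  qed
qed (intro exI[of _ 0], simp)

text \<open>There are at most three rows, since the entries of row \<open>i\<close> are at least
  \<open>r + i\<close>. The inequalities come from column strictness; they decide which letters are
  matched and so make the raising steps explicit.\<close>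

lemma three_letter_tableau:
  assumes T: "column_strict T" "set (tword T) \<subseteq> {r, Suc r, Suc (Suc r)}"
  shows "\<exists>a b c d e f. tword T = Fw r a b c d e f \<and> b \<le> a \<and> c \<le> b \<and> b + d \<le> a + e"
proof -
  have ge: "r + i \<le> x" if i: "i < length T" and x: "x \<in> set (T ! i)" for i x
  proof -
    obtain j where "j < length (T ! i)" "x = T ! i ! j" using x by (metis in_set_conv_nth)
    moreover have "r \<le> y" if "y \<in> set (tword T)" for y using T(2) that by auto
    ultimately show ?thesis using tableau_entry_ge[of T r i j] T(1) i by simp
  qed
  have le: "set (T ! i) \<subseteq> {r, Suc r, Suc (Suc r)}" if "i < length T" for i
    using T(2) that unfolding set_tword by (meson UN_subset_iff nth_mem)
  have "length T \<le> 3"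
  proof (rule ccontr)
    assume "\<not> length T \<le> 3"
    then have 3: "3 < length T" by simp
    then have "T ! 3 \<noteq> []" using T by (simp add: column_strict_iff)
    then have "hd (T ! 3) \<in> set (T ! 3)" by simp
    then have "hd (T ! 3) \<in> {r, Suc r, Suc (Suc r)}" using le[OF 3] by blast
    then show False using ge[OF 3, of "hd (T ! 3)"] \<open>hd (T ! 3) \<in> set (T ! 3)\<close> by auto
  qed
  define R where "R i = (if i < length T then T ! i else [])" for i
  have word: "tword T = R (Suc (Suc 0)) @ R (Suc 0) @ R 0"
    using \<open>length T \<le> 3\<close> by (auto simp: R_def le_Suc_eq numeral_3_eq_3 numeral_2_eq_2 length_Suc_conv)
  have sor: "sorted (R i)" for i using T by (auto simp: R_def column_strict_iff)
  have dm: "dominates (R i) (R (Suc i))" for i using T by (auto simp: R_def column_strict_iff dominates_def)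
  have R: "set (R i) \<subseteq> {r, Suc r, Suc (Suc r)}" "x \<in> set (R i) \<Longrightarrow> r + i \<le> x" for i x
    using le ge by (auto simp: R_def)
  obtain a e f where R0: "R 0 = replicate a r @ replicate e (Suc r) @ replicate f (Suc (Suc r))"
    using sorted_three_letters[OF sor R(1)] by blast
  obtain a' b d where R1': "R (Suc 0) = replicate a' r @ replicate b (Suc r) @ replicate d (Suc (Suc r))"
    using sorted_three_letters[OF sor R(1)] by blast
  have "a' = 0" using R(2)[of r "Suc 0"] R1' by (cases a') auto
  with R1' have R1: "R (Suc 0) = replicate b (Suc r) @ replicate d (Suc (Suc r))" by simp
  obtain a'' b'' c where R2': "R (Suc (Suc 0)) = replicate a'' r @ replicate b'' (Suc r) @ replicate c (Suc (Suc r))"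
    using sorted_three_letters[OF sor R(1)] by blast
  have "a'' = 0" using R(2)[of r "Suc (Suc 0)"] R2' by (cases a'') auto
  moreover have "b'' = 0" using R(2)[of "Suc r" "Suc (Suc 0)"] R2' by (cases b'') auto
  ultimately have R2: "R (Suc (Suc 0)) = replicate c (Suc (Suc r))" using R2' by simp
  have d01: "length (R (Suc 0)) \<le> length (R 0)" "\<And>j. j < length (R (Suc 0)) \<Longrightarrow> R 0 ! j < R (Suc 0) ! j"
    using dm[of 0] by (auto simp: dominates_def)
  have d12: "length (R (Suc (Suc 0))) \<le> length (R (Suc 0))" "\<And>j. j < length (R (Suc (Suc 0))) \<Longrightarrow> R (Suc 0) ! j < R (Suc (Suc 0)) ! j"
    using dm[of "Suc 0"] by (auto simp: dominates_def numeral_2_eq_2)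
  have "b \<le> a"
  proof (rule ccontr)
    assume "\<not> b \<le> a"
    then show False using d01(2)[of a] d01(1) by (auto simp: R0 R1 nth_append split: if_splits)
  qed
  moreover have "c \<le> b"
  proof (rule ccontr)
    assume "\<not> c \<le> b"
    then show False using d12(2)[of b] d12(1) by (auto simp: R1 R2 nth_append split: if_splits)
  qed
  moreover have "b + d \<le> a + e"
  proof (rule ccontr)
    assume a: "\<not> b + d \<le> a + e"
    have "R 0 ! (a + e) = Suc (Suc r)" using a d01(1) by (auto simp: R0 R1 nth_append)
    moreover have "R (Suc 0) ! (a + e) \<in> set (R (Suc 0))" using a by (intro nth_mem) (auto simp: R1)
    then have "R (Suc 0) ! (a + e) \<le> Suc (Suc r)" using R(1)[of "Suc 0"] by auto
    ultimately show False using d01(2)[of "a + e"] a by (auto simp: R1)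
  qed
  ultimately show ?thesis using word R0 R1 R2 unfolding Fw_def by metis
qed

lemma count_Fw:
  "count_list (Fw r a b c d e f) r = a" "count_list (Fw r a b c d e f) (Suc r) = b + e"
  "count_list (Fw r a b c d e f) (Suc (Suc r)) = c + d + f"
  by (auto simp: Fw_def count_replicate)

lemma E_Fw_low: "b \<le> a \<Longrightarrow> E r (Fw r a b c d (Suc e) f) (Fw r (Suc a) b c d e f)"
  using EI[of r "replicate c (Suc (Suc r)) @ replicate b (Suc r) @ replicate d (Suc (Suc r)) @ replicate a r"
      "replicate e (Suc r) @ replicate f (Suc (Suc r))"]
  by (simp add: Fw_def replicate_app_Cons_same)

lemma E_Fw_mid: "c \<le> b \<Longrightarrow> e \<le> d \<Longrightarrow> E (Suc r) (Fw r a b c (Suc d) e f) (Fw r a (Suc b) c d e f)"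
  using EI[of "Suc r" "replicate c (Suc (Suc r)) @ replicate b (Suc r)"
      "replicate d (Suc (Suc r)) @ replicate a r @ replicate e (Suc r) @ replicate f (Suc (Suc r))"]
  by (simp add: Fw_def replicate_app_Cons_same)

lemma E_Fw_high: "c \<le> b \<Longrightarrow> d \<le> e \<Longrightarrow> E (Suc r) (Fw r a b c d e (Suc f)) (Fw r a b c d (Suc e) f)"
  using EI[of "Suc r" "replicate c (Suc (Suc r)) @ replicate b (Suc r) @ replicate d (Suc (Suc r)) @
      replicate a r @ replicate e (Suc r)" "replicate f (Suc (Suc r))"]
  by (simp add: Fw_def replicate_app_Cons_same)

lemma chain_Fw_low: "b \<le> a \<Longrightarrow> (E r)\<^sup>*\<^sup>* (Fw r a b c d (e + k) f) (Fw r (a + k) b c d e f)"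
proof (induction k arbitrary: a)
  case (Suc k)
  then have "E r (Fw r a b c d (Suc (e + k)) f) (Fw r (Suc a) b c d (e + k) f)" by (intro E_Fw_low)
  moreover have "(E r)\<^sup>*\<^sup>* (Fw r (Suc a) b c d (e + k) f) (Fw r (Suc a + k) b c d e f)"
    by (rule Suc.IH) (use Suc.prems in simp)
  ultimately show ?case by (simp add: converse_rtranclp_into_rtranclp)
qed simp

lemma chain_Fw_mid:
  "c \<le> b \<Longrightarrow> e \<le> d \<Longrightarrow> (E (Suc r))\<^sup>*\<^sup>* (Fw r a b c (d + k) e f) (Fw r a (b + k) c d e f)"
proof (induction k arbitrary: b)
  case (Suc k)
  then have "E (Suc r) (Fw r a b c (Suc (d + k)) e f) (Fw r a (Suc b) c (d + k) e f)"
    by (intro E_Fw_mid) auto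
  moreover have "(E (Suc r))\<^sup>*\<^sup>* (Fw r a (Suc b) c (d + k) e f) (Fw r a (Suc b + k) c d e f)"
    by (rule Suc.IH) (use Suc.prems in simp_all)
  ultimately show ?case by (simp add: converse_rtranclp_into_rtranclp)
qed simp

lemma chain_Fw_high:
  "c \<le> b \<Longrightarrow> d \<le> e \<Longrightarrow> (E (Suc r))\<^sup>*\<^sup>* (Fw r a b c d e (f + k)) (Fw r a b c d (e + k) f)"
proof (induction k arbitrary: e)
  case (Suc k)
  then have "E (Suc r) (Fw r a b c d e (Suc (f + k))) (Fw r a b c d (Suc e) (f + k))"
    by (intro E_Fw_high) auto
  moreover have "(E (Suc r))\<^sup>*\<^sup>* (Fw r a b c d (Suc e) (f + k)) (Fw r a b c d (Suc e + k) f)"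
    by (rule Suc.IH) (use Suc.prems in simp_all)
  ultimately show ?case by (simp add: converse_rtranclp_into_rtranclp)
qed simp

text \<open>The \<open>r + 2\<close> of the third row are matched by the second row, those of the
  second row by the \<open>r + 1\<close> of the first. The surplus of the second row is raised
  first, then the \<open>f\<close> letters \<open>r + 2\<close> of the first row.\<close>

lemma chain_Fw_top:
  assumes "c \<le> b"
  shows "(E (Suc r))\<^sup>*\<^sup>* (Fw r a b c d e f) (Fw r a (b + (d - min d e)) c (min d e) (e + f) 0)"
proof -
  have "(E (Suc r))\<^sup>*\<^sup>* (Fw r a b c d e f) (Fw r a (b + (d - min d e)) c (min d e) e f)"
    using chain_Fw_mid[of c b e "min d e" r a "d - min d e" f] assms
    by (cases "e \<le> d") auto
  moreover have "(E (Suc r))\<^sup>*\<^sup>* (Fw r a (b + (d - min d e)) c (min d e) e f)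
      (Fw r a (b + (d - min d e)) c (min d e) (e + f) 0)"
    using chain_Fw_high[of c "b + (d - min d e)" "min d e" e r a 0 f] assms by simp
  ultimately show ?thesis by (rule rtranclp_trans)
qed

lemma s_op_Fw_low:
  assumes "b \<le> a" shows "s_op r (Fw r a b c d e f) = Fw r (b + e) b c d (a - b) f"
proof (rule s_op_eqI)
  show "Str r (Fw r a b c d e f) (Fw r (b + e) b c d (a - b) f)"
  proof (cases "a - b \<le> e")
    case True
    then show ?thesis using chain_Fw_low[of b a r c d "a - b" "e - (a - b)" f] assms
      by (simp add: Str_def add.commute)
  next
    case False
    then show ?thesis using chain_Fw_low[of b "b + e" r c d e "a - b - e" f] assms
      by (simp add: Str_def)
  qed
qed (simp add: count_Fw)

text \<open>Both words rise to the same top of their string. Here \<open>y\<close> counts the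
  letters \<open>r + 1\<close> of the second row that the third row leaves unmatched, and
  \<open>u\<close> the matched pairs between the first and the second row.\<close>

lemma s_op_Fw_high:
  assumes u: "u = min d e" and z: "z = min f y"
  shows "s_op (Suc r) (Fw r a (c + y) c d e f) =
    Fw r a (c + (d - u) + z) c (y - z + u) (u + (f - z)) (e - u + z)"
proof (rule s_op_eqI)
  let ?v = "Fw r a (c + (d - u) + z) c (y - z + u) (u + (f - z)) (e - u + z)"
  have "min (y - z + u) (u + (f - z)) = u" using z by (cases "f \<le> y") auto
  moreover have "c + (d - u) + z + (y - z) = c + y + (d - u)" using z by simp
  moreover have "u + (f - z) + (e - u + z) = e + f" using u z by simp
  ultimately have "(E (Suc r))\<^sup>*\<^sup>* ?v (Fw r a (c + y + (d - u)) c u (e + f) 0)"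
    using chain_Fw_top[of c "c + (d - u) + z" r a "y - z + u" "u + (f - z)" "e - u + z"] by (simp add: ac_simps)
  moreover have "(E (Suc r))\<^sup>*\<^sup>* (Fw r a (c + y) c d e f) (Fw r a (c + y + (d - u)) c u (e + f) 0)"
    using chain_Fw_top[of c "c + y" r a d e f] u by simp
  ultimately show "Str (Suc r) (Fw r a (c + y) c d e f) ?v"
    using E_common_target by blast
  show "count_list ?v (Suc r) = count_list (Fw r a (c + y) c d e f) (Suc (Suc r))"
    using u z by (simp add: count_Fw)
qed

text \<open>Both sides are computed on the six multiplicities. With the inequalities absorbed in
  \<open>b = c + y\<close> and \<open>a = b + x\<close>, the claim becomes a list of identities
  between minima.\<close>

lemma braid_Fw:
  assumes "b \<le> a" "c \<le> b" "b + d \<le> a + e"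
  shows "s_op r (s_op (Suc r) (s_op r (Fw r a b c d e f))) =
    s_op (Suc r) (s_op r (s_op (Suc r) (Fw r a b c d e f)))"
proof -
  obtain y where y: "b = c + y" using assms(2) le_Suc_ex by blast
  obtain x where x: "a = c + y + x" using assms(1) y le_Suc_ex by blast
  have d: "d \<le> x + e" using assms(3) x y by simp
  define u v z where "u = min d x" and "v = min d e" and "z = min f y"
  have uvz: "u \<le> d" "u \<le> x" "v \<le> d" "v \<le> e" "z \<le> f" "z \<le> y" by (auto simp: u_def v_def z_def)
  have eq: "c + (d - u) + z + (u + (f - z)) = c + d + f" "c + (d - v) + z + (v + (f - z)) = c + d + f"
    using uvz by auto
  have "s_op r (Fw r a b c d e f) = Fw r (c + y + e) (c + y) c d x f"
    using s_op_Fw_low[of b a r c d e f] x y by simp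
  moreover have "s_op (Suc r) (Fw r (c + y + e) (c + y) c d x f) =
      Fw r (c + y + e) (c + (d - u) + z) c (y - z + u) (u + (f - z)) (x - u + z)"
    by (rule s_op_Fw_high[OF u_def z_def])
  moreover have "c + (d - u) + z \<le> c + y + e" using d uvz u_def by (auto simp: min_def split: if_splits)
  then have "s_op r (Fw r (c + y + e) (c + (d - u) + z) c (y - z + u) (u + (f - z)) (x - u + z)) =
      Fw r (c + d + f) (c + (d - u) + z) c (y - z + u) (c + y + e - (c + (d - u) + z)) (x - u + z)"
    using s_op_Fw_low[of "c + (d - u) + z" "c + y + e" r c "y - z + u" "u + (f - z)" "x - u + z"] eq
    by (simp only:)
  moreover have "s_op (Suc r) (Fw r a b c d e f) =
      Fw r a (c + (d - v) + z) c (y - z + v) (v + (f - z)) (e - v + z)"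
    unfolding y by (rule s_op_Fw_high[OF v_def z_def])
  moreover have "c + (d - v) + z \<le> a" using d uvz v_def x by (auto simp: min_def split: if_splits)
  then have "s_op r (Fw r a (c + (d - v) + z) c (y - z + v) (v + (f - z)) (e - v + z)) =
      Fw r (c + d + f) (c + ((d - v) + z)) c (y - z + v) (a - (c + (d - v) + z)) (e - v + z)"
    using s_op_Fw_low[of "c + (d - v) + z" a r c "y - z + v" "v + (f - z)" "e - v + z"] eq
    by (simp only: add.assoc)
  moreover define q where "q = min (y - z + v) (a - (c + (d - v) + z))"
  have "z = min (e - v + z) ((d - v) + z)" by (cases "d \<le> e") (auto simp: v_def)
  from s_op_Fw_high[OF q_def this]
  have "s_op (Suc r) (Fw r (c + d + f) (c + ((d - v) + z)) c (y - z + v) (a - (c + (d - v) + z)) (e - v + z)) =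
      Fw r (c + d + f) (c + (y - z + v - q) + z) c (d - v + z - z + q) (q + (e - v + z - z))
        (a - (c + (d - v) + z) - q + z)" .
  moreover have "y - z + v - q = d - u" "d - v + q = y - z + u"
      "q + (e - v) = c + y + e - (c + (d - u) + z)" "a - (c + (d - v) + z) - q + z = x - u + z"
    using d uvz unfolding q_def x u_def v_def z_def by (auto simp: min_def split: if_splits)
  ultimately show ?thesis by simp
qed

lemma s_op_braid:
  "s_op r (s_op (Suc r) (s_op r u)) = s_op (Suc r) (s_op r (s_op (Suc r) u))" (is "?L u = ?R u")
proof -
  let ?B = "{r, Suc r, Suc (Suc r)}"
  let ?f = "filter (\<lambda>x. x \<in> ?B)"
  have P: "pat ?B x (s_op r x)" "pat ?B x (s_op (Suc r) x)" for x
    by (rule pat_mono[OF s_op_pat], blast)+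
  have p: "pat ?B (?L u) (?R u)"
    by (rule pat_trans[OF pat_sym[OF pat_trans[OF pat_trans[OF P(1) P(2)] P(1)]]
      pat_trans[OF pat_trans[OF P(2) P(1)] P(2)]])
  have f: "?f (s_op r x) = s_op r (?f x)" "?f (s_op (Suc r) x) = s_op (Suc r) (?f x)" for x
    by (rule s_op_filter; simp)+
  let ?v = "?f u"
  have "set (tword (Ptab ?v)) \<subseteq> ?B" by (auto simp: set_Ptab)
  then obtain a b c d e f where "tword (Ptab ?v) = Fw r a b c d e f" "b \<le> a" "c \<le> b" "b + d \<le> a + e"
    using three_letter_tableau[OF column_strict_Ptab] by metis
  then have eq: "?L (tword (Ptab ?v)) = ?R (tword (Ptab ?v))" using braid_Fw by simp
  have "knuth_equiv (?L ?v) (?L (tword (Ptab ?v)))"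
    by (intro s_op_knuth knuth_Ptab)
  moreover have "knuth_equiv (?R ?v) (?R (tword (Ptab ?v)))"
    by (intro s_op_knuth knuth_Ptab)
  ultimately have k: "knuth_equiv (?L ?v) (?R ?v)" unfolding eq by (rule knuth_trans[OF _ knuth_sym])
  have "Qs ?v (?L ?v)" by (rule Qs_trans[OF Qs_trans[OF s_op_Qs s_op_Qs] s_op_Qs])
  moreover have "Qs ?v (?R ?v)" by (rule Qs_trans[OF Qs_trans[OF s_op_Qs s_op_Qs] s_op_Qs])
  ultimately have "Qs (?L ?v) (?R ?v)" by (rule Qs_trans[OF Qs_sym])
  moreover have "Ptab (?L ?v) = Ptab (?R ?v)" using k Ptab_eq_iff by simp
  ultimately have "?L ?v = ?R ?v" by (rule rsk_inj)
  then show ?thesis by (intro pat_eq[OF p]) (simp only: f)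
qed

section \<open>The action of the symmetric group\<close>

text \<open>The congruence generated by the Coxeter relations. Through it \<open>act_gens\<close> is
  shown to depend only on the permutation, as the choice in \<open>act_perm\<close>
  requires.\<close>

inductive cox :: "nat list \<Rightarrow> nat list \<Rightarrow> bool" where
  cox_refl: "cox u u"
| cox_sym: "cox u v \<Longrightarrow> cox v u"
| cox_trans [trans]: "cox u v \<Longrightarrow> cox v w \<Longrightarrow> cox u w"
| cox_invol: "cox (a @ r # r # b) (a @ b)"
| cox_commute: "Suc r < s \<Longrightarrow> cox (a @ r # s # b) (a @ s # r # b)"
| cox_braid: "cox (a @ r # Suc r # r # b) (a @ Suc r # r # Suc r # b)"

lemma cox_append: "cox u v \<Longrightarrow> cox (c @ u @ d) (c @ v @ d)"
proof (induction rule: cox.induct)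
  case (cox_invol a r b)
  then show ?case using cox.cox_invol[of "c @ a" r "b @ d"] by simp
next
  case (cox_commute r s a b)
  then show ?case using cox.cox_commute[OF cox_commute(1), of "c @ a" "b @ d"] by simp
next
  case (cox_braid a r b)
  then show ?case using cox.cox_braid[of "c @ a" r "b @ d"] by simp
qed (auto intro: cox_refl cox_sym cox_trans)

lemma cox_Cons: "cox u v \<Longrightarrow> cox (x # u) (x # v)"
  using cox_append[of u v "[x]" "[]"] by simp

lemma cox_append_right: "cox u v \<Longrightarrow> cox (u @ d) (v @ d)"
  using cox_append[of u v "[]" d] by simp

lemma cox_append_left: "cox u v \<Longrightarrow> cox (c @ u) (c @ v)"
  using cox_append[of u v c "[]"] by simp

lemma act_gens_append: "act_gens (a @ b) u = act_gens a (act_gens b u)"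
  by (induction a) auto

lemma gens_prod_append: "gens_prod (a @ b) = gens_prod a \<circ> gens_prod b"
  by (induction a) (auto simp: comp_assoc)

lemma cox_act: "cox a b \<Longrightarrow> act_gens a u = act_gens b u"
proof (induction arbitrary: u rule: cox.induct)
  case (cox_commute r s a b)
  then show ?case using s_op_commute[OF cox_commute] by (simp add: act_gens_append)
next
  case (cox_braid a r b)
  then show ?case using s_op_braid by (simp add: act_gens_append)
qed (auto simp: act_gens_append)

lemma transp_invol [simp]: "transp_fun r (transp_fun r k) = k"
  by (simp add: transp_fun_def)

lemma cox_gens_prod: "cox a b \<Longrightarrow> gens_prod a = gens_prod b"
proof (induction rule: cox.induct)
  case (cox_invol a r b)
  have "transp_fun r \<circ> (transp_fun r \<circ> g) = g" for g :: "nat \<Rightarrow> nat" by (auto simp: fun_eq_iff)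
  then show ?case by (simp add: gens_prod_append)
next
  case (cox_commute r s a b)
  have "transp_fun r \<circ> (transp_fun s \<circ> g) = transp_fun s \<circ> (transp_fun r \<circ> g)" for g :: "nat \<Rightarrow> nat"
    using cox_commute by (auto simp: fun_eq_iff transp_fun_def)
  then show ?case by (simp add: gens_prod_append)
next
  case (cox_braid a r b)
  have "transp_fun r \<circ> (transp_fun (Suc r) \<circ> (transp_fun r \<circ> g)) =
    transp_fun (Suc r) \<circ> (transp_fun r \<circ> (transp_fun (Suc r) \<circ> g))" for g :: "nat \<Rightarrow> nat"
    by (auto simp: fun_eq_iff transp_fun_def)
  then show ?case by (simp add: gens_prod_append)
qed auto

lemma cox_commute_block: "\<forall>s\<in>set w. Suc r < s \<Longrightarrow> cox (r # w) (w @ [r])"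
proof (induction w)
  case (Cons s w)
  have "cox (r # s # w) (s # r # w)" using cox_commute[of r s "[]" w] Cons.prems by simp
  also have "cox \<dots> (s # w @ [r])" using Cons by (intro cox_Cons) auto
  finally show ?case by simp
qed (auto intro: cox_refl)

lemma cox_commute_block': "\<forall>s\<in>set w. Suc s < r \<Longrightarrow> cox (r # w) (w @ [r])"
proof (induction w)
  case (Cons s w)
  have "cox (r # s # w) (s # r # w)"
    using cox_sym[OF cox_commute[of s r "[]" w]] Cons.prems by simp
  also have "cox \<dots> (s # w @ [r])" using Cons by (intro cox_Cons) auto
  finally show ?case by simp
qed (auto intro: cox_refl)

text \<open>Commutations bring \<open>r\<close> next to \<open>r - 1\<close> in the ascending run,
  one braid relation turns it into \<open>r - 1\<close>, and commutations carry that to the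
  end.\<close>

lemma cox_pass:
  assumes "k < r" "r \<le> m" shows "cox (r # [k..<Suc m]) ([k..<Suc m] @ [r - 1])"
proof -
  obtain q where q: "r = Suc q" "k \<le> q" using assms by (cases r) auto
  have "[k..<Suc m] = [k..<q] @ [q..<Suc m]" using q assms upt_add_eq_append[of k q "Suc m - q"] by simp
  also have "[q..<Suc m] = q # Suc q # [Suc (Suc q)..<Suc m]"
    using q assms by (simp add: upt_conv_Cons del: upt_Suc)
  finally have l: "[k..<Suc m] = [k..<q] @ q # Suc q # [Suc (Suc q)..<Suc m]" .
  have "cox (Suc q # [k..<q] @ q # Suc q # [Suc (Suc q)..<Suc m])
      ([k..<q] @ Suc q # q # Suc q # [Suc (Suc q)..<Suc m])"
    using cox_append_right[OF cox_commute_block'[of "[k..<q]" "Suc q"]] by simp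
  also have "cox \<dots> ([k..<q] @ q # Suc q # q # [Suc (Suc q)..<Suc m])"
    by (rule cox_sym[OF cox_braid])
  also have "cox \<dots> ([k..<q] @ q # Suc q # [Suc (Suc q)..<Suc m] @ [q])"
    by (intro cox_append_left cox_Cons cox_commute_block) auto
  finally show ?thesis using l q by simp
qed

text \<open>Coset representatives modulo the stabiliser of the largest letter: the run
  \<open>[k..<Suc m]\<close> sends \<open>Suc m\<close> to \<open>k\<close>, and the remaining word
  fixes \<open>Suc m\<close>.\<close>

lemma cox_normal_form:
  "set rs \<subseteq> {1..<Suc m} \<Longrightarrow> \<exists>k rs0. 1 \<le> k \<and> k \<le> Suc m \<and> set rs0 \<subseteq> {1..<m} \<and> cox rs ([k..<Suc m] @ rs0)"
proof (induction rs)
  case Nil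
  then show ?case by (intro exI[of _ "Suc m"] exI[of _ "[]"]) (auto intro: cox_refl)
next
  case (Cons r rs)
  then obtain k rs0 where k: "1 \<le> k" "k \<le> Suc m" "set rs0 \<subseteq> {1..<m}" "cox rs ([k..<Suc m] @ rs0)" by auto
  have r: "1 \<le> r" "r \<le> m" using Cons.prems by auto
  have 1: "cox (r # rs) (r # [k..<Suc m] @ rs0)" using cox_Cons[OF k(4)] by simp
  consider "Suc r < k" | "Suc r = k" | "r = k" | "k < r" by linarith
  then show ?case
  proof cases
    case 1
    have "cox (r # [k..<Suc m] @ rs0) ([k..<Suc m] @ r # rs0)"
      using cox_append_right[OF cox_commute_block[of "[k..<Suc m]" r], of rs0] 1 by (simp del: upt_Suc)
    then have "cox (r # rs) ([k..<Suc m] @ r # rs0)" using \<open>cox (r # rs) _\<close> cox_trans by blast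
    moreover have "r < m" using 1 k by simp
    ultimately show ?thesis using k r by (intro exI[of _ k] exI[of _ "r # rs0"]) simp
  next
    case 2
    then have "r # [k..<Suc m] = [r..<Suc m]" using r upt_conv_Cons[of r "Suc m"] by (simp del: upt_Suc)
    then have "cox (r # rs) ([r..<Suc m] @ rs0)" using \<open>cox (r # rs) _\<close> by (metis append_Cons)
    then show ?thesis using k r by (intro exI[of _ r] exI[of _ rs0]) simp
  next
    case 3
    then have "[k..<Suc m] = r # [Suc r..<Suc m]" using r by (simp add: upt_conv_Cons del: upt_Suc)
    then have "cox (r # [k..<Suc m] @ rs0) ([Suc r..<Suc m] @ rs0)"
      using cox_invol[of "[]" r "[Suc r..<Suc m] @ rs0"] 3 by (simp del: upt_Suc)
    then have "cox (r # rs) ([Suc r..<Suc m] @ rs0)" using \<open>cox (r # rs) _\<close> cox_trans by blast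
    then show ?thesis using k r by (intro exI[of _ "Suc r"] exI[of _ rs0]) simp
  next
    case 4
    have "cox (r # [k..<Suc m] @ rs0) ([k..<Suc m] @ (r - 1) # rs0)"
      using cox_append_right[OF cox_pass[OF 4 r(2)], of rs0] by (simp del: upt_Suc)
    then have "cox (r # rs) ([k..<Suc m] @ (r - 1) # rs0)" using \<open>cox (r # rs) _\<close> cox_trans by blast
    then show ?thesis using k r 4 by (intro exI[of _ k] exI[of _ "(r - 1) # rs0"]) auto
  qed
qed

lemma gens_prod_fix: "\<forall>r\<in>set rs. r \<noteq> k \<and> Suc r \<noteq> k \<Longrightarrow> gens_prod rs k = k"
  by (induction rs) (auto simp: transp_fun_def)

lemma gens_prod_cycle: "k \<le> m \<Longrightarrow> gens_prod [k..<m] m = k"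
proof (induction rule: inc_induct)
  case (step n)
  then have "[n..<m] = n # [Suc n..<m]" by (simp add: upt_conv_Cons)
  then show ?case using step by (simp add: transp_fun_def)
qed simp

text \<open>A product equal to the identity fixes the largest letter, so the run in its normal form
  is empty and induction applies to the rest.\<close>

lemma gens_prod_id_imp_cox: "set rs \<subseteq> {1..<n} \<Longrightarrow> gens_prod rs = id \<Longrightarrow> cox rs []"
proof (induction n arbitrary: rs)
  case 0
  then show ?case by (auto intro: cox_refl)
next
  case (Suc m)
  obtain k rs0 where k: "1 \<le> k" "k \<le> Suc m" "set rs0 \<subseteq> {1..<m}" "cox rs ([k..<Suc m] @ rs0)"
    using cox_normal_form[OF Suc.prems(1)] by blast
  have id: "gens_prod [k..<Suc m] \<circ> gens_prod rs0 = id"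
    using cox_gens_prod[OF k(4)] Suc.prems(2) by (simp only: gens_prod_append)
  have "gens_prod rs0 (Suc m) = Suc m" using k(3) by (intro gens_prod_fix) auto
  then have "k = Suc m" using fun_cong[OF id, of "Suc m"] gens_prod_cycle[OF k(2)] by simp
  then have "gens_prod rs0 = id" "cox rs rs0" using id k(4) by auto
  then show ?case using Suc.IH[OF k(3)] cox_trans by blast
qed

lemma gens_prod_rev: "gens_prod rs \<circ> gens_prod (rev rs) = id"
proof (induction rs)
  case (Cons r rs)
  have "gens_prod rs (gens_prod (rev rs) k) = k" for k using fun_cong[OF Cons.IH, of k] by simp
  then show ?case by (simp add: gens_prod_append fun_eq_iff)
qed simp

lemma act_gens_rev: "act_gens (rev rs) (act_gens rs u) = u"
  by (induction rs arbitrary: u) (auto simp: act_gens_append)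

lemma act_gens_cong:
  assumes "set rs \<subseteq> {1..<n}" "set rs' \<subseteq> {1..<n}" "gens_prod rs = gens_prod rs'"
  shows "act_gens rs u = act_gens rs' u"
proof -
  have "gens_prod (rs @ rev rs') = id" using assms(3) gens_prod_rev[of rs'] by (simp add: gens_prod_append)
  then have "cox (rs @ rev rs') []" using assms(1,2) by (intro gens_prod_id_imp_cox[of _ n]) auto
  then have "act_gens (rs @ rev rs') (act_gens rs' u) = act_gens rs' u" using cox_act by fastforce
  then show ?thesis by (simp add: act_gens_append act_gens_rev)
qed

lemma act_perm_eq:
  assumes "set rs \<subseteq> {1..<n}" "gens_prod rs = pi" shows "act_perm n pi u = act_gens rs u"
proof -
  have "set (SOME rs. set rs \<subseteq> {1..<n} \<and> gens_prod rs = pi) \<subseteq> {1..<n} \<and>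
    gens_prod (SOME rs. set rs \<subseteq> {1..<n} \<and> gens_prod rs = pi) = pi"
    by (rule someI[of _ rs]) (use assms in simp)
  then show ?thesis unfolding act_perm_def using act_gens_cong assms by blast
qed

lemma act_gens_single: "act_gens rs [x] = [gens_prod rs x]"
  by (induction rs) (auto simp: s_op_single)

lemma act_gens_Qs: "Qs u (act_gens rs u)"
proof (induction rs)
  case (Cons r rs)
  then show ?case using Qs_trans[OF Cons.IH s_op_Qs] by simp
qed simp

lemma act_gens_count: "count_list (act_gens rs u) (gens_prod rs k) = count_list u k"
  by (induction rs) (auto simp: s_op_count)

lemma act_gens_pat: "(\<And>r. r \<in> set rs \<Longrightarrow> r \<in> B \<and> Suc r \<in> B) \<Longrightarrow> pat B u (act_gens rs u)"
proof (induction rs)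
  case (Cons r rs)
  have "pat B (act_gens rs u) (s_op r (act_gens rs u))"
    using pat_mono[OF s_op_pat, of r B] Cons.prems[of r] by simp
  then show ?case using pat_trans[OF Cons.IH] Cons.prems by simp
qed simp

lemma act_gens_filter:
  "(\<And>r. r \<in> set rs \<Longrightarrow> r \<in> B \<and> Suc r \<in> B) \<Longrightarrow>
     filter (\<lambda>x. x \<in> B) (act_gens rs u) = act_gens rs (filter (\<lambda>x. x \<in> B) u)"
  by (induction rs) (auto simp: s_op_filter)

lemma act_gens_fix:
  "(\<And>r. r \<in> set rs \<Longrightarrow> eps r u = 0 \<and> phi r u = 0) \<Longrightarrow> act_gens rs u = u"
  by (induction rs) (auto simp: s_op_fix)

lemma act_gens_shift:
  "act_gens (map (\<lambda>r. r + d) rs) (map (\<lambda>x. x + d) u) = map (\<lambda>x. x + d) (act_gens rs u)"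
  by (induction rs) (auto simp: s_op_shift)

section \<open>Rectangular blocks\<close>

definition rect :: "nat \<Rightarrow> nat \<Rightarrow> nat \<Rightarrow> nat list list" where
  "rect off h mu = map (\<lambda>j. replicate mu (off + j)) [1..<Suc h]"

lemma length_rect [simp]: "length (rect off h mu) = h"
  by (simp add: rect_def)

lemma nth_rect: "i < h \<Longrightarrow> rect off h mu ! i = replicate mu (off + Suc i)"
  unfolding rect_def by (simp del: upt_Suc)

lemma column_strict_rect: "0 < mu \<Longrightarrow> column_strict (rect off h mu)"
  by (auto simp: column_strict_iff nth_rect dominates_def)

lemma count_rect:
  assumes "off < k" "k \<le> off + h" shows "count_list (tword (rect off h mu)) k = mu"
proof -
  define i where "i = k - Suc off"
  have k: "k = off + Suc i" "i < h" using assms by (auto simp: i_def)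
  have "count_list (tword (rect off h mu)) k = (\<Sum>j<h. if j = i then mu else 0)"
    unfolding count_tword length_rect by (rule sum.cong) (auto simp: nth_rect count_replicate k)
  then show ?thesis using k by simp
qed

lemma tword_map: "tword (map (map f) T) = map f (tword T)"
  by (induction T) auto

text \<open>After translation to letters from \<open>0\<close> the content is the shape, so the word
  is of highest weight.\<close>

lemma eps_rect:
  assumes mu: "0 < mu" and r: "off < r" "Suc r \<le> off + h"
  shows "eps r (tword (rect off h mu)) = 0"
proof -
  define Y where "Y = map (\<lambda>i. replicate mu i) [0..<h]"
  have Y: "column_strict Y" using mu by (auto simp: column_strict_iff Y_def dominates_def)
  have "count_list (tword Y) k = rl (Ptab (tword Y)) k" for k
    unfolding Ptab_tword[OF Y] count_tword by (auto simp: Y_def rl_def count_replicate)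
  then have "hwd (tword Y)" by (rule content_eq_shape_imp_hw)
  moreover have "rect off h mu = map (map (\<lambda>x. x + Suc off)) Y"
    by (rule nth_equalityI) (auto simp: nth_rect Y_def)
  then have "tword (rect off h mu) = map (\<lambda>x. x + Suc off) (tword Y)"
    by (simp only: tword_map)
  moreover have "r = (r - Suc off) + Suc off" using r by simp
  ultimately show ?thesis using epsA_shift[of "r - Suc off" "Suc off" "tword Y" 0] by metis
qed

text \<open>Turns the Knuth condition on a block into counting and matching conditions on the whole
  word. Conversely, the matching conditions make row \<open>i\<close> of the insertion tableau
  constant, and the counts make its length \<open>mu\<close>.\<close>

lemma block_iff:
  assumes mu: "0 < mu"
  shows "knuth_equiv (filter (\<lambda>x. x \<in> {off + 1..off + h}) w) (tword (rect off h mu)) \<longleftrightarrow>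
    (\<forall>k. off < k \<and> k \<le> off + h \<longrightarrow> count_list w k = mu) \<and>
    (\<forall>r. off < r \<and> Suc r \<le> off + h \<longrightarrow> eps r w = 0)" (is "knuth_equiv ?f _ \<longleftrightarrow> ?C \<and> ?E")
proof -
  have cf: "count_list ?f k = count_list w k" if "off < k" "k \<le> off + h" for k
    using that by (induction w) auto
  have ef: "eps r ?f = eps r w" if "off < r" "Suc r \<le> off + h" for r
    using that by (intro epsA_filter) auto
  show ?thesis
  proof
    assume k: "knuth_equiv ?f (tword (rect off h mu))"
    have ?C using cf count_rect knuth_count[OF k] by metis
    moreover have ?E using ef eps_rect[OF mu] epsA_knuth[OF k] by metis
    ultimately show "?C \<and> ?E" ..
  next
    assume CE: "?C \<and> ?E"
    let ?T = "Ptab ?f"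
    have set: "set (tword ?T) \<subseteq> {off + 1..off + h}" by (auto simp: set_Ptab)
    have row: "x = off + 1 + i" if "i < length ?T" "x \<in> set (?T ! i)" for i x
    proof (rule lattice_rows[OF column_strict_Ptab, of ?f "off + 1" "off + h + 1"])
      show "off + 1 \<le> y" if "y \<in> set (tword ?T)" for y using set that by auto
      show "eps r (tword ?T) = 0" if "off + 1 \<le> r" "Suc r < off + h + 1" for r
        unfolding eps_Ptab using ef CE that by simp
      show "x < off + h + 1" using set that unfolding set_tword by force
    qed (use that in auto)
    have ne: "?T ! i \<noteq> []" if "i < length ?T" for i
      using column_strict_Ptab[of ?f] that by (simp add: column_strict_iff)
    have rowc: "count_list (?T ! i) k = (if k = Suc (off + i) then length (?T ! i) else 0)" if "i < length ?T" for i k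
    proof -
      have "?T ! i = replicate (length (?T ! i)) (Suc (off + i))" by (rule replicate_eqI) (use row[OF that] in auto)
      then show ?thesis using count_replicate[of "length (?T ! i)" "Suc (off + i)" k] by metis
    qed
    have "length ?T \<le> h"
    proof (rule ccontr)
      assume "\<not> length ?T \<le> h"
      then have h: "h < length ?T" by simp
      then have "hd (?T ! h) = off + 1 + h" using row ne by simp
      moreover have "hd (?T ! h) \<in> set (tword ?T)" using h ne[OF h] unfolding set_tword by (meson UN_I hd_in_set nth_mem)
      ultimately show False using set by auto
    qed
    have total: "(\<Sum>j<length ?T. count_list (?T ! j) (Suc (off + i))) = mu" if "i < h" for i
      using CE that cf[of "Suc (off + i)"] unfolding count_tword[symmetric] count_Ptab by simp
    have sum: "(\<Sum>j<length ?T. count_list (?T ! j) (Suc (off + i))) = (if i < length ?T then length (?T ! i) else 0)" for i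
    proof -
      have "(\<Sum>j<length ?T. count_list (?T ! j) (Suc (off + i))) = (\<Sum>j<length ?T. if j = i then length (?T ! i) else 0)"
        by (rule sum.cong[OF refl]) (use rowc in auto)
      then show ?thesis by simp
    qed
    have len: "i < length ?T \<and> length (?T ! i) = mu" if "i < h" for i
      using total[OF that] sum[of i] mu by (simp split: if_splits)
    have "?T = rect off h mu"
    proof (rule nth_equalityI)
      show l: "length ?T = length (rect off h mu)"
        using \<open>length ?T \<le> h\<close> len[of "h - 1"] by (cases h) auto
      show "?T ! i = rect off h mu ! i" if "i < length ?T" for i
        using len[of i] row[OF that] that \<open>length ?T \<le> h\<close> by (auto simp: nth_rect intro!: replicate_eqI)
    qed
    then show "knuth_equiv ?f (tword (rect off h mu))" using knuth_Ptab[of ?f] by simp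
  qed
qed

section \<open>Lowest weight tableaux\<close>

definition cnt :: "nat \<Rightarrow> nat list \<Rightarrow> nat" where
  "cnt v s = length (filter (\<lambda>x. x \<le> v) s)"

lemma cnt_le: "cnt v s \<le> length s"
  by (simp add: cnt_def)

lemma cnt_all: "(\<And>x. x \<in> set s \<Longrightarrow> x \<le> v) \<Longrightarrow> cnt v s = length s"
  by (simp add: cnt_def)

lemma cnt_none: "(\<And>x. x \<in> set s \<Longrightarrow> v < x) \<Longrightarrow> cnt v s = 0"
  by (auto simp: cnt_def filter_empty_conv not_le)

lemma cnt_Suc: "cnt (Suc v) s = cnt v s + count_list s (Suc v)"
  by (induction s) (auto simp: cnt_def)

lemma sorted_cnt: "sorted s \<Longrightarrow> j < length s \<Longrightarrow> s ! j \<le> v \<longleftrightarrow> j < cnt v s"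
proof (induction s arbitrary: j)
  case (Cons x s)
  show ?case
  proof (cases "x \<le> v")
    case True
    then show ?thesis using Cons by (cases j) (auto simp: cnt_def)
  next
    case False
    then have "\<forall>y\<in>set (x # s). v < y" using Cons.prems(1) by auto
    then have "cnt v (x # s) = 0" "v < (x # s) ! j" using cnt_none Cons.prems(2) nth_mem by blast+
    then show ?thesis by simp
  qed
qed simp

lemma sorted_eq_cnt:
  assumes "sorted s" "sorted t" "length s = length t" "\<And>v. cnt v s = cnt v t"
  shows "s = t"
proof (rule nth_equalityI[OF assms(3)])
  fix j assume "j < length s"
  then have "s ! j \<le> v \<longleftrightarrow> t ! j \<le> v" for v using sorted_cnt assms by metis
  then show "s ! j = t ! j" by (meson le_antisym order_refl)
qed

lemma length_tableau_le:
  assumes "column_strict L" "\<And>x. x \<in> set (tword L) \<Longrightarrow> b < x \<and> x \<le> n"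
  shows "length L \<le> n - b"
proof (rule ccontr)
  assume "\<not> length L \<le> n - b"
  then have i: "n - b < length L" by simp
  then have ne: "L ! (n - b) \<noteq> []" using assms(1) by (simp add: column_strict_iff)
  then have "Suc b + (n - b) \<le> L ! (n - b) ! 0"
    using tableau_entry_ge[OF assms(1), of "Suc b" "n - b" 0] assms(2) i by (simp add: Suc_le_eq)
  moreover have "L ! (n - b) ! 0 \<in> set (tword L)"
    using i ne unfolding set_tword by (meson UN_I length_greater_0_conv nth_mem)
  ultimately show False using assms(2)[of "L ! (n - b) ! 0"] by linarith
qed

lemma sum_telescope:
  fixes f :: "nat \<Rightarrow> nat"
  assumes "\<And>i. f (Suc i) \<le> f i"
  shows "(\<Sum>k<N. f k - f (Suc k)) = f 0 - f N"
proof (induction N)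
  case (Suc N)
  have "f N \<le> f 0" using lift_Suc_antimono_le[of f] assms by blast
  then show ?case using Suc assms[of N] by simp
qed simp

text \<open>Row \<open>k\<close> contains \<open>rl L (n - v + k) - rl L (n - v + Suc k)\<close>
  letters \<open>v\<close>, and the sum over the rows telescopes. The content is thus the shape read
  backwards.\<close>

lemma lowest_weight_content:
  assumes L: "column_strict L" and set: "\<And>x. x \<in> set (tword L) \<Longrightarrow> b < x \<and> x \<le> n"
    and cnt: "\<And>v k. b \<le> v \<Longrightarrow> v \<le> n \<Longrightarrow> k < length L \<Longrightarrow> cnt v (L ! k) = rl L (n - v + k)"
    and v: "b < v" "v \<le> n"
  shows "count_list (tword L) v = rl L (n - v)"
proof -
  obtain u where u: "v = Suc u" using v by (cases v) auto
  have nu: "n - u = Suc (n - v)" using u v by simp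
  have "count_list (L ! k) v = rl L (n - v + k) - rl L (n - v + Suc k)" if "k < length L" for k
    using cnt[of v k] cnt[of u k] cnt_Suc[of u "L ! k"] u v that nu by simp
  then have "count_list (tword L) v = (\<Sum>k<length L. rl L (n - v + k) - rl L (n - v + Suc k))"
    by (simp add: count_tword)
  also have "\<dots> = rl L (n - v + 0) - rl L (n - v + length L)"
    by (rule sum_telescope) (use rl_antimono[OF L] in simp)
  also have "rl L (n - v + length L) = 0" by (simp add: rl_def)
  finally show ?thesis by simp
qed

text \<open>Shows that a lowest weight tableau is determined by its shape. Column strictness bounds
  the first row from below: a letter at most \<open>v + 1\<close> in the second row has a letter at
  most \<open>v\<close> above it. The conditions on \<open>phi\<close> bound it from above: each
  \<open>v\<close> of the first row must be matched by a \<open>v + 1\<close> that the rows below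
  leave unmatched.\<close>

lemma lowest_weight_rows:
  assumes "column_strict L" "\<And>x. x \<in> set (tword L) \<Longrightarrow> b < x \<and> x \<le> n"
    "\<And>r. b < r \<Longrightarrow> r < n \<Longrightarrow> phi r (tword L) = 0" "b \<le> v" "v \<le> n" "k < length L"
  shows "cnt v (L ! k) = rl L (n - v + k)"
  using assms
proof (induction L arbitrary: v k)
  case (Cons s L)
  have L: "column_strict L" "sorted s" "L \<noteq> [] \<Longrightarrow> dominates s (hd L)"
    using Cons.prems(1) by (auto simp: column_strict_Cons)
  have setL: "\<And>x. x \<in> set (tword L) \<Longrightarrow> b < x \<and> x \<le> n" and sets: "\<And>x. x \<in> set s \<Longrightarrow> b < x \<and> x \<le> n"
    using Cons.prems(2) by auto
  have phiL: "phi r (tword L) = 0" if "b < r" "r < n" for r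
    using Cons.prems(3)[OF that] phi_prefix[of r "tword L" s] by simp
  have IH: "cnt v (L ! k) = rl L (n - v + k)" if "b \<le> v" "v \<le> n" "k < length L" for v k
    by (rule Cons.IH[OF L(1) _ _ that]) (use setL phiL in blast)+
  have rlS: "rl (s # L) (Suc i) = rl L i" for i by (simp add: rl_def)
  note cont = lowest_weight_content[OF L(1) setL IH]
  show ?case
  proof (cases k)
    case (Suc k')
    then show ?thesis using IH[of v k'] Cons.prems rlS by simp
  next
    case 0
    have lower: "rl (s # L) (n - v) \<le> cnt v s" if v: "b \<le> v" "v \<le> n" for v
    proof (cases "v = n")
      case True
      then show ?thesis using cnt_all[of s v] sets by (simp add: rl_def)
    next
      case False
      then have nv: "n - v = Suc (n - Suc v)" using v by simp
      show ?thesis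
      proof (cases "L = []")
        case False
        have "cnt (Suc v) (hd L) = rl L (n - Suc v)"
          using IH[of "Suc v" 0] \<open>v \<noteq> n\<close> v False by (simp add: hd_conv_nth)
        moreover have "cnt (Suc v) (hd L) \<le> cnt v s"
        proof (rule ccontr)
          let ?j = "cnt v s"
          assume "\<not> cnt (Suc v) (hd L) \<le> cnt v s"
          then have j: "?j < cnt (Suc v) (hd L)" by simp
          then have "?j < length (hd L)" using cnt_le[of "Suc v" "hd L"] by simp
          moreover have "sorted (hd L)" using L(1) False by (cases L) (auto simp: column_strict_Cons)
          ultimately have "hd L ! ?j \<le> Suc v" "?j < length s" "s ! ?j < hd L ! ?j"
            using sorted_cnt j L(3)[OF False] by (auto simp: dominates_def)
          then show False using sorted_cnt[OF L(2), of ?j v] by simp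
        qed
        ultimately show ?thesis using nv rlS by simp
      qed (simp add: nv rl_def)
    qed
    have upper: "cnt v s \<le> rl (s # L) (n - v)" if "b \<le> v" "v \<le> n" for v
      using that
    proof (induction v rule: dec_induct)
      case base
      then show ?case using cnt_none[of s b] sets by simp
    next
      case (step u)
      have IHu: "cnt u s \<le> rl (s # L) (n - u)" using step by simp
      show ?case
      proof (cases "Suc u = n")
        case True
        then show ?thesis using cnt_le[of "Suc u" s] by (simp add: rl_def)
      next
        case False
        let ?v = "Suc u"
        have v: "b < ?v" "?v < n" using step False by auto
        have "phiA ?v (tword L) (phi ?v s) = 0" using Cons.prems(3)[OF v] by simp
        \<comment> \<open>The first row ends the reading word, so its letters \<open>?v\<close> can
          only be matched by what the lower rows leave open.\<close>
        then have "phi ?v s \<le> eps ?v (tword L)" using phiA_eq[of ?v "tword L" "phi ?v s"] by simp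
        moreover have "count_list s ?v \<le> phi ?v s" by (rule phiA_sorted_ge[OF L(2)])
        moreover have "eps ?v (tword L) + count_list (tword L) ?v = count_list (tword L) (Suc ?v)"
          using eps_phi_count[of ?v "tword L"] phiL[OF v] by simp
        moreover have "count_list (tword L) ?v = rl L (n - ?v)" using cont[of ?v] v by simp
        moreover have "count_list (tword L) (Suc ?v) = rl L (n - Suc ?v)" using cont[of "Suc ?v"] v by simp
        ultimately have "count_list s ?v + rl L (n - ?v) \<le> rl L (n - Suc ?v)" by linarith
        moreover have "rl L (n - ?v) = rl (s # L) (n - u)" "rl L (n - Suc ?v) = rl (s # L) (n - ?v)"
          using v rlS[of "n - ?v"] rlS[of "n - Suc ?v"] by (simp_all add: Suc_diff_Suc)
        ultimately show ?thesis using IHu cnt_Suc[of u s] by simp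
      qed
    qed
    show ?thesis using lower[of v] upper[of v] Cons.prems 0 by simp
  qed
qed simp

section \<open>Littlewood--Richardson tableaux for two rectangles\<close>

text \<open>Membership in \<open>Wset\<close> for two rectangles, with the Knuth conditions replaced
  by counting and matching; see \<open>W2_Wset\<close>.\<close>

definition W2 :: "nat \<Rightarrow> nat \<Rightarrow> nat \<Rightarrow> nat \<Rightarrow> nat list \<Rightarrow> bool" where
  "W2 m e mu nu w \<longleftrightarrow> set w \<subseteq> {1..m + e} \<and> (\<forall>k. 1 \<le> k \<and> k \<le> m \<longrightarrow> count_list w k = mu) \<and>
     (\<forall>k. m < k \<and> k \<le> m + e \<longrightarrow> count_list w k = nu) \<and>
     (\<forall>r. 1 \<le> r \<and> r < m + e \<and> r \<noteq> m \<longrightarrow> eps r w = 0)"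

text \<open>The shapes occurring in the product of two rectangular Schur functions (Okada).\<close>

definition LR_shape :: "nat \<Rightarrow> nat \<Rightarrow> nat \<Rightarrow> nat \<Rightarrow> (nat \<Rightarrow> nat) \<Rightarrow> bool" where
  "LR_shape m e mu nu l \<longleftrightarrow> (\<forall>i\<ge>m + e. l i = 0) \<and>
     (\<forall>i. i < m \<and> i < e \<longrightarrow> l i + l (m + e - 1 - i) = mu + nu \<and> mu \<le> l i \<and> nu \<le> l i) \<and>
     (\<forall>i. e \<le> i \<and> i < m \<longrightarrow> l i = mu) \<and> (\<forall>i. m \<le> i \<and> i < e \<longrightarrow> l i = nu)"

lemma LR_shape_commute: "LR_shape m e mu nu l \<longleftrightarrow> LR_shape e m nu mu l"
  unfolding LR_shape_def by (auto simp: add.commute)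

lemma column_increase:
  assumes "column_strict T" "k \<le> i" "i < length T" "j < length (T ! i)"
  shows "T ! k ! j + (i - k) \<le> T ! i ! j \<and> j < length (T ! k)"
  using assms(2-4)
proof (induction rule: dec_induct)
  case (step i)
  then have "dominates (T ! i) (T ! Suc i)" using assms(1) by (simp add: column_strict_iff)
  then have "T ! i ! j < T ! Suc i ! j" "j < length (T ! i)" using step.prems by (auto simp: dominates_def)
  with step show ?case by auto
qed simp

lemma sorted_split_replicate:
  "sorted r \<Longrightarrow> (\<And>x. x \<in> set r \<Longrightarrow> x \<le> m \<Longrightarrow> x = a) \<Longrightarrow> a \<le> m \<Longrightarrow>
     r = replicate (count_list r a) a @ filter (\<lambda>x. m < x) r"
proof (induction r)
  case (Cons x r)
  have IH: "r = replicate (count_list r a) a @ filter (\<lambda>x. m < x) r" using Cons by auto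
  show ?case
  proof (cases "x \<le> m")
    case True
    then have "x = a" using Cons.prems(2) by simp
    then show ?thesis using Cons.prems(3) by (simp add: IH[symmetric])
  next
    case False
    then have r: "\<forall>y\<in>set r. m < y" using Cons.prems(1) by auto
    then have "a \<notin> set r" using Cons.prems(3) not_le by blast
    moreover have "filter (\<lambda>x. m < x) r = r" using r by (simp add: filter_id_conv)
    moreover have "x \<noteq> a" using False Cons.prems(3) by auto
    ultimately show ?thesis using False by (simp add: count_list_0_iff)
  qed
qed simp

locale two_rect =
  fixes m e mu nu :: nat
  assumes pos: "0 < m" "0 < e" "0 < mu" "0 < nu"
begin

text \<open>The letters up to \<open>m\<close> fill the first \<open>mu\<close> columns of the first
  \<open>m\<close> rows. A larger letter in row \<open>i\<close> lies further right, in a column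
  whose entry in row \<open>0\<close> is at least \<open>m + 1\<close>; this gives the lower bound
  \<open>m + 1 + i\<close>. The upper bound comes from matching, as in
  \<open>lattice_rows\<close>.\<close>

lemma LR_rows:
  assumes T: "column_strict T" and W: "W2 m e mu nu (tword T)" and i: "i < m"
  shows "i < length T \<and> mu \<le> rl T i \<and>
    T ! i = replicate mu (Suc i) @ replicate (rl T i - mu) (m + 1 + i)"
proof -
  have set: "1 \<le> x \<and> x \<le> m + e" if "x \<in> set (tword T)" for x using W that by (auto simp: W2_def)
  have small: "x = Suc i" if "i < length T" "x \<in> set (T ! i)" "x \<le> m" for i x
    using lattice_rows[OF T, of 1 "m + 1" i x] set W that by (auto simp: W2_def)
  have split: "i < length T \<and> T ! i = replicate mu (Suc i) @ filter (\<lambda>x. m < x) (T ! i)" if i: "i < m" for i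
  proof -
    have z: "count_list (T ! j) (Suc i) = 0" if "j < length T" "j \<noteq> i" for j
      using small[of j "Suc i"] that i by (auto simp: count_list_0_iff)
    have "(\<Sum>j<length T. count_list (T ! j) (Suc i)) = mu"
      using W i unfolding count_tword[symmetric] W2_def by auto
    moreover have "(\<Sum>j<length T. count_list (T ! j) (Suc i)) =
        (\<Sum>j<length T. if j = i then count_list (T ! i) (Suc i) else 0)"
      by (intro sum.cong) (auto simp: z)
    ultimately have c: "i < length T \<and> count_list (T ! i) (Suc i) = mu"
      using pos by (simp split: if_splits)
    then have "sorted (T ! i)" using T by (simp add: column_strict_iff)
    then show ?thesis using sorted_split_replicate[of "T ! i" m "Suc i"] small c i by auto
  qed
  have low: "m + 1 + i \<le> x" if i: "i < m" and x: "x \<in> set (T ! i)" "m < x" for i x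
  proof -
    have s: "i < length T" "T ! i = replicate mu (Suc i) @ filter (\<lambda>x. m < x) (T ! i)" using split[OF i] by auto
    obtain j where j: "j < length (T ! i)" "x = T ! i ! j" using x by (metis in_set_conv_nth)
    have "mu \<le> j"
    proof (rule ccontr)
      assume "\<not> mu \<le> j"
      then have "T ! i ! j = Suc i" by (subst s(2)) (simp add: nth_append)
      then show False using j x i by simp
    qed
    have c: "T ! 0 ! j + (i - 0) \<le> T ! i ! j" "j < length (T ! 0)" using column_increase[OF T _ s(1) j(1), of 0] by auto
    have s0: "T ! 0 = replicate mu (Suc 0) @ filter (\<lambda>x. m < x) (T ! 0)" using split[of 0] pos by auto
    have "T ! 0 ! j = filter (\<lambda>x. m < x) (T ! 0) ! (j - mu)" using \<open>mu \<le> j\<close> by (subst s0) (simp add: nth_append)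
    moreover have "j - mu < length (filter (\<lambda>x. m < x) (T ! 0))"
      using c(2) \<open>mu \<le> j\<close> arg_cong[OF s0, of length] by simp
    then have "filter (\<lambda>x. m < x) (T ! 0) ! (j - mu) \<in> set (filter (\<lambda>x. m < x) (T ! 0))" by (rule nth_mem)
    ultimately have "m < T ! 0 ! j" by simp
    then show ?thesis using c j by simp
  qed
  have big: "x = m + 1 + i" if "i < m" "x \<in> set (T ! i)" "m < x" for i x
    using that
  proof (induction i arbitrary: x rule: less_induct)
    case (less i)
    have il: "i < length T" using split less.prems(1) by blast
    then have so: "sorted (T ! i)" using T by (simp add: column_strict_iff)
    obtain ps y where row: "T ! i = ps @ [y]" using less.prems(2) by (metis empty_iff empty_set rev_exhaust)
    have xy: "x \<le> y" using so less.prems(2) row by (auto simp: sorted_append)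
    have yset: "y \<in> set (T ! i)" using row by simp
    have ly: "m + 1 + i \<le> y" using low[OF less.prems(1) yset] xy less.prems(3) by simp
    show ?case
    proof (cases "y = m + 1 + i")
      case True
      then show ?thesis using xy low[OF less.prems] by simp
    next
      case False
      then obtain r where r: "y = Suc r" "m + 1 + i \<le> r" using ly by (cases y) auto
      have "r \<notin> set (tword (take i T))"
      proof
        assume "r \<in> set (tword (take i T))"
        then obtain s where s: "s \<in> set (take i T)" "r \<in> set s" unfolding set_tword by blast
        then obtain i' where "i' < length (take i T)" "s = take i T ! i'" by (metis in_set_conv_nth)
        then have i': "i' < i" "r \<in> set (T ! i')" using s by auto
        then have "r = m + 1 + i'" using less.IH[of i' r] less.prems(1) r by simp
        then show False using r i' by simp
      qed
      then have "Suc 0 \<le> epsA r (tword (take i T)) (Suc (eps r (tword (drop (Suc i) T) @ ps)))"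
        using epsA_ge[of "tword (take i T)" r "Suc (eps r (tword (drop (Suc i) T) @ ps))"]
        by (simp add: count_list_0_iff)
      then have "eps r (tword T) \<noteq> 0" using tword_split[OF il] row r by simp
      moreover have "y \<le> m + e" using set yset il unfolding set_tword by (meson UN_I nth_mem)
      ultimately show ?thesis using W r by (auto simp: W2_def)
    qed
  qed
  have s: "i < length T" "T ! i = replicate mu (Suc i) @ filter (\<lambda>x. m < x) (T ! i)" using split[OF i] by auto
  have len: "rl T i = mu + length (filter (\<lambda>x. m < x) (T ! i))"
    using arg_cong[OF s(2), of length] s(1) by (simp add: rl_def)
  have "filter (\<lambda>x. m < x) (T ! i) = replicate (length (filter (\<lambda>x. m < x) (T ! i))) (m + 1 + i)"
    by (rule replicate_eqI) (use big[OF i] in auto)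
  then show ?thesis using s len by simp
qed

lemma LR_top_count:
  assumes T: "column_strict T" and W: "W2 m e mu nu (tword T)"
  shows "count_list (tword (take m T)) (m + 1 + i) = (if i < m then rl T i - mu else 0)"
proof -
  have len: "m \<le> length T" using LR_rows[OF T W, of "m - 1"] pos by linarith
  have "count_list (tword (take m T)) (m + 1 + i) = (\<Sum>j<m. count_list (T ! j) (m + 1 + i))"
    using len by (simp add: count_tword min_absorb2)
  also have "\<dots> = (\<Sum>j<m. if j = i then rl T i - mu else 0)"
  proof (rule sum.cong[OF refl])
    fix j assume "j \<in> {..<m}"
    then have "T ! j = replicate mu (Suc j) @ replicate (rl T j - mu) (m + 1 + j)" "j < m"
      using LR_rows[OF T W] by auto
    then show "count_list (T ! j) (m + 1 + i) = (if j = i then rl T i - mu else 0)"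
      by (auto simp: count_replicate)
  qed
  finally show ?thesis by simp
qed

lemma LR_bottom:
  assumes T: "column_strict T" and W: "W2 m e mu nu (tword T)"
  defines "L \<equiv> drop m T"
  shows "column_strict L" "\<And>x. x \<in> set (tword L) \<Longrightarrow> m < x \<and> x \<le> m + e"
    "\<And>r. m < r \<Longrightarrow> r < m + e \<Longrightarrow> phi r (tword L) = 0"
    "\<And>v k. m \<le> v \<Longrightarrow> v \<le> m + e \<Longrightarrow> k < length L \<Longrightarrow> cnt v (L ! k) = rl T (m + (m + e - v + k))"
    "\<And>i. i < e \<Longrightarrow> rl T (m + e - 1 - i) + (if i < m then rl T i - mu else 0) = nu"
proof -
  have set: "1 \<le> x \<and> x \<le> m + e" if "x \<in> set (tword T)" for x using W that by (auto simp: W2_def)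
  show L: "column_strict L" unfolding L_def by (rule column_strict_drop[OF T])
  have word: "tword T = tword L @ tword (take m T)" unfolding L_def by (metis append_take_drop_id tword_append)
  show setL: "m < x \<and> x \<le> m + e" if x: "x \<in> set (tword L)" for x
  proof -
    obtain k j where "k < length L" "j < length (L ! k)" "x = L ! k ! j"
      using x unfolding set_tword by (metis UN_E in_set_conv_nth)
    then have "1 + (m + k) \<le> x" using tableau_entry_ge[OF T, of 1 "m + k" j] set by (simp add: L_def)
    moreover have "x \<in> set (tword T)" using x word by simp
    ultimately show ?thesis using set by auto
  qed
  show phiL: "phi r (tword L) = 0" if r: "m < r" "r < m + e" for r
  proof -
    let ?A = "tword L" and ?B = "tword (take m T)"
    have "eps r (?A @ ?B) = 0" using W r unfolding word[symmetric] W2_def by auto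
    then have 1: "eps r ?B = 0" "eps r ?A \<le> phi r ?B" using epsA_eq[of r ?B "eps r ?A"] by auto
    have "count_list (?A @ ?B) r = nu" "count_list (?A @ ?B) (Suc r) = nu"
      using W r unfolding word[symmetric] W2_def by auto
    \<comment> \<open>As \<open>r\<close> and \<open>Suc r\<close> occur equally often,
      \<open>phi\<close> of the bottom is \<open>eps\<close> of the bottom minus \<open>phi\<close>
      of the top; this is zero because the top closes all that the bottom leaves open.\<close>
    then show ?thesis using 1 eps_phi_count[of r ?A] eps_phi_count[of r ?B] by simp
  qed
  have rlL: "rl L k = rl T (m + k)" for k by (auto simp: L_def rl_def)
  have cnt: "cnt v (L ! k) = rl L (m + e - v + k)" if "m \<le> v" "v \<le> m + e" "k < length L" for v k
    by (rule lowest_weight_rows[OF L setL phiL that])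
  then show "cnt v (L ! k) = rl T (m + (m + e - v + k))" if "m \<le> v" "v \<le> m + e" "k < length L" for v k
    using cnt[OF that] rlL by simp
  \<comment> \<open>The letter \<open>m + 1 + i\<close> occurs \<open>nu\<close> times:
    \<open>rl T i - mu\<close> times in the top rows if \<open>i < m\<close>, and the rest below,
    where the content is the reversed shape.\<close>
  show "rl T (m + e - 1 - i) + (if i < m then rl T i - mu else 0) = nu" if i: "i < e" for i
  proof -
    have "count_list (tword L) (m + 1 + i) = rl L (m + e - (m + 1 + i))"
      by (rule lowest_weight_content[OF L setL cnt]) (use i in auto)
    moreover have "m + (m + e - (m + 1 + i)) = m + e - 1 - i" using i by simp
    moreover have "count_list (tword T) (m + 1 + i) = nu" using W i by (auto simp: W2_def)
    ultimately show ?thesis using rlL[of "m + e - (m + 1 + i)"] LR_top_count[OF T W, of i] word by simp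
  qed
qed

lemma LR_imp_shape:
  assumes T: "column_strict T" and W: "W2 m e mu nu (tword T)"
  shows "LR_shape m e mu nu (rl T)"
proof -
  note rows = LR_rows[OF T W] and bot = LR_bottom(5)[OF T W]
  have set: "0 < x \<and> x \<le> m + e" if "x \<in> set (tword T)" for x using W that by (auto simp: W2_def)
  have "length T \<le> m + e" using length_tableau_le[OF T, of 0 "m + e"] set by simp
  then have 1: "\<forall>i\<ge>m + e. rl T i = 0" by (simp add: rl_def)
  have 2: "rl T i = mu" if i: "e \<le> i" "i < m" for i
  proof (rule ccontr)
    assume "rl T i \<noteq> mu"
    then have "m + 1 + i \<in> set (T ! i)" using rows[OF i(2)] by (metis Un_iff diff_is_0_eq in_set_replicate le_antisym set_append)
    moreover have "i < length T" using rows i by blast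
    ultimately have "m + 1 + i \<in> set (tword T)" unfolding set_tword by (meson UN_I nth_mem)
    then show False using set i by fastforce
  qed
  have 3: "rl T j = nu" if j: "m \<le> j" "j < e" for j
  proof -
    have "m + e - 1 - (m + e - 1 - j) = j" "m + e - 1 - j < e" "\<not> m + e - 1 - j < m" using j by auto
    then show ?thesis using bot[of "m + e - 1 - j"] by presburger
  qed
  have 4: "nu \<le> rl T i" if i: "i < m" "i < e" for i
  proof (cases "m < e")
    case True
    then have "rl T m = nu" using 3 by simp
    then show ?thesis using rl_antimono[OF T, of i m] i by simp
  next
    case False
    \<comment> \<open>Otherwise column \<open>mu\<close> would have \<open>m + 1\<close> in row
      \<open>0\<close> and reach row \<open>m\<close> with a letter of at least
      \<open>2 * m + 1\<close>, which exceeds \<open>m + e\<close> in this case.\<close>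
    have "rl T m \<le> mu"
    proof (rule ccontr)
      assume a: "\<not> rl T m \<le> mu"
      then have m: "m < length T" "mu < length (T ! m)" by (auto simp: rl_def split: if_splits)
      have 0: "T ! 0 ! mu + m \<le> T ! m ! mu" "mu < length (T ! 0)" using column_increase[OF T _ m, of 0] by auto
      have r0: "0 < length T" "T ! 0 = replicate mu (Suc 0) @ replicate (rl T 0 - mu) (m + 1)" using rows[of 0] pos by auto
      have "mu < rl T 0" using 0(2) r0(1) by (simp add: rl_def)
      then have "T ! 0 ! mu = m + 1" by (subst r0(2)) (simp add: nth_append)
      moreover have "T ! m ! mu \<in> set (tword T)" unfolding set_tword using m by (meson UN_I nth_mem)
      ultimately show False using 0 set[of "T ! m ! mu"] False by linarith
    qed
    moreover have "rl T (m + e - 1 - i) \<le> rl T m" by (rule rl_antimono[OF T]) (use i in simp)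
    ultimately show ?thesis using bot[of i] rows[of i] i by simp
  qed
  have 5: "rl T i + rl T (m + e - 1 - i) = mu + nu" if i: "i < m" "i < e" for i
  proof -
    have "rl T (m + e - 1 - i) + (rl T i - mu) = nu" using bot[OF i(2)] i(1) by presburger
    moreover have "mu \<le> rl T i" using rows[OF i(1)] by blast
    ultimately show ?thesis by linarith
  qed
  show ?thesis unfolding LR_shape_def using 1 2 3 4 5 rows by blast
qed

lemma LR_unique:
  assumes T: "column_strict T" "W2 m e mu nu (tword T)" and T': "column_strict T'" "W2 m e mu nu (tword T')"
    and sh: "shape T = shape T'"
  shows "T = T'"
proof (rule nth_equalityI)
  show len: "length T = length T'" using sh unfolding shape_def by (metis length_map)
  have rl: "rl T i = rl T' i" for i using sh shape_eq_iff T(1) T'(1) by blast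
  fix i assume i: "i < length T"
  show "T ! i = T' ! i"
  proof (cases "i < m")
    case True
    then show ?thesis using LR_rows[OF T True] LR_rows[OF T' True] rl by simp
  next
    case False
    define k where "k = i - m"
    have k: "i = m + k" using False by (simp add: k_def)
    have so: "sorted (T ! i)" "sorted (T' ! i)" using T(1) T'(1) i len by (auto simp: column_strict_iff)
    have le: "length (T ! i) = length (T' ! i)" using rl[of i] i len by (simp add: rl_def)
    have "drop m T ! k \<in> set (drop m T)" by (rule nth_mem) (use i k in simp)
    then have mem: "x \<in> set (tword (drop m T))" if "x \<in> set (T ! i)" for x
      using that i k unfolding set_tword by auto
    have "drop m T' ! k \<in> set (drop m T')" by (rule nth_mem) (use i k len in simp)
    then have mem': "x \<in> set (tword (drop m T'))" if "x \<in> set (T' ! i)" for x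
      using that i k len unfolding set_tword by auto
    have "cnt v (T ! i) = cnt v (T' ! i)" for v
    proof -
      consider "v < m" | "m \<le> v" "v \<le> m + e" | "m + e < v" by linarith
      then show ?thesis
      proof cases
        case 1
        then have "cnt v (T ! i) = 0" "cnt v (T' ! i) = 0"
          using LR_bottom(2)[OF T mem] LR_bottom(2)[OF T' mem'] by (auto intro!: cnt_none dest: less_trans)
        then show ?thesis by simp
      next
        case 2
        then show ?thesis using LR_bottom(4)[OF T 2, of k] LR_bottom(4)[OF T' 2, of k] i k len rl by simp
      next
        case 3
        have "x \<le> v" if "x \<in> set (T ! i)" for x using LR_bottom(2)[OF T mem[OF that]] 3 by linarith
        moreover have "x \<le> v" if "x \<in> set (T' ! i)" for x using LR_bottom(2)[OF T' mem'[OF that]] 3 by linarith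
        ultimately have "cnt v (T ! i) = length (T ! i)" "cnt v (T' ! i) = length (T' ! i)"
          using cnt_all by blast+
        then show ?thesis using le by simp
      qed
    qed
    then show ?thesis by (rule sorted_eq_cnt[OF so le])
  qed
qed

text \<open>Among the tableaux of this shape and alphabet, one with the largest sum of entries
  serves: a possible lowering step would increase the sum.\<close>

lemma ex_lowest_weight:
  assumes U: "column_strict U" "\<And>x. x \<in> set (tword U) \<Longrightarrow> b < x \<and> x \<le> n"
  shows "\<exists>X. column_strict X \<and> shape X = shape U \<and> (\<forall>x\<in>set (tword X). b < x \<and> x \<le> n) \<and>
    (\<forall>r. b < r \<and> r < n \<longrightarrow> phi r (tword X) = 0)"
proof -
  let ?P = "\<lambda>X. column_strict X \<and> shape X = shape U \<and> (\<forall>x\<in>set (tword X). b < x \<and> x \<le> n)"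
  have len: "length (tword X) = sum_list (shape X)" for X by (induction X) (auto simp: shape_def)
  have bound: "sum_list w \<le> n * length w" if "\<forall>x\<in>set w. x \<le> n" for w using that by (induction w) auto
  have "sum_list (tword X) < Suc (n * sum_list (shape U))" if "?P X" for X
    using bound[of "tword X"] that len[of X] by auto
  then obtain X where X: "?P X" and max: "\<And>Y. ?P Y \<Longrightarrow> sum_list (tword Y) \<le> sum_list (tword X)"
    using ex_has_greatest_nat[of ?P U "\<lambda>X. sum_list (tword X)" "Suc (n * sum_list (shape U))"] U by blast
  have "phi r (tword X) = 0" if r: "b < r" "r < n" for r
  proof (rule ccontr)
    assume "phi r (tword X) \<noteq> 0"
    then obtain w where w: "E r w (tword X)" using E_exists_inv by blast
    have 1: "E r (tword (Ptab w)) (tword X)" using E_Ptab(1)[OF w] Ptab_tword X by simp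
    have "shape (Ptab w) = shape U" using E_Ptab(2)[OF w] Ptab_tword X by simp
    moreover have "b < x \<and> x \<le> n" if "x \<in> set (tword (Ptab w))" for x
      using 1 that X r by (auto elim!: EE)
    ultimately have "sum_list (tword (Ptab w)) \<le> sum_list (tword X)" using max[of "Ptab w"] by simp
    then show False using E_count(4)[OF 1] by simp
  qed
  with X show ?thesis by blast
qed

lemma epsA_no_left: "Suc r \<notin> set w \<Longrightarrow> epsA r w k = k - count_list w r"
  by (induction w arbitrary: k) auto

lemma epsA_le_count: "epsA r w k \<le> k + count_list w (Suc r)"
proof (induction w arbitrary: k)
  case (Cons x w)
  show ?case using Cons[of k] Cons[of "Suc k"] Cons[of "k - 1"] by auto
qed simp

text \<open>\<open>B\<close> opens nothing, and its letters \<open>r\<close> suffice to close every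
  \<open>Suc r\<close> of \<open>A\<close>.\<close>

lemma eps_zero_split:
  assumes "Suc r \<notin> set B" "count_list A (Suc r) \<le> count_list B r" shows "eps r (A @ B) = 0"
  using epsA_le_count[of r A 0] assms by (simp add: epsA_no_left)

text \<open>The first \<open>m\<close> rows are forced by \<open>LR_rows\<close>; below them goes a
  lowest weight tableau of the remaining shape, as \<open>LR_bottom\<close> demands.\<close>

lemma LR_exists:
  assumes T0: "column_strict T0" and ok: "LR_shape m e mu nu (rl T0)"
  shows "\<exists>T. column_strict T \<and> shape T = shape T0 \<and> W2 m e mu nu (tword T)"
proof -
  define l where "l = rl T0"
  have l0: "l i = 0" if "m + e \<le> i" for i using ok that by (auto simp: LR_shape_def l_def)
  have l1: "l i + l (m + e - 1 - i) = mu + nu" "nu \<le> l i" if "i < m" "i < e" for i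
    using ok that by (auto simp: LR_shape_def l_def)
  have l2: "l i = mu" if "e \<le> i" "i < m" for i using ok that by (auto simp: LR_shape_def l_def)
  have l3: "l i = nu" if "m \<le> i" "i < e" for i using ok that by (auto simp: LR_shape_def l_def)
  have lmu: "mu \<le> l i" if "i < m" for i using ok that by (cases "i < e") (auto simp: LR_shape_def l_def)
  have mono: "l j \<le> l i" if "i \<le> j" for i j unfolding l_def by (rule rl_antimono[OF T0 that])
  have lenT0: "i < length T0 \<longleftrightarrow> 0 < l i" for i unfolding l_def using rl_pos_iff[OF T0] by simp
  have "m - 1 < length T0" unfolding lenT0 using lmu[of "m - 1"] pos by simp
  then have mT0: "m \<le> length T0" using pos by simp
  have T0n: "length T0 \<le> m + e" using lenT0[of "m + e"] l0[of "m + e"] by simp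
  \<comment> \<open>Some filling of the remaining shape by the second block, from which a lowest
    weight filling is obtained.\<close>
  define U where "U = map (\<lambda>k. replicate (l (m + k)) (m + 1 + k)) [0..<length T0 - m]"
  have U: "column_strict U"
  proof -
    have u: "0 < l (m + k)" if "k < length T0 - m" for k
    proof -
      have "m + k < length T0" using that by simp
      then show ?thesis using lenT0 by blast
    qed
    have "dominates (replicate (l (m + k)) (m + 1 + k)) (replicate (l (m + Suc k)) (m + 1 + Suc k))" for k
      using mono[of "m + k" "m + Suc k"] by (auto simp: dominates_def)
    then show ?thesis unfolding column_strict_iff using u by (auto simp: U_def)
  qed
  have setU: "m < x \<and> x \<le> m + e" if "x \<in> set (tword U)" for x
    using that T0n mT0 by (auto simp: U_def set_tword split: if_splits)
  obtain X where X: "column_strict X" "shape X = shape U" "\<And>x. x \<in> set (tword X) \<Longrightarrow> m < x \<and> x \<le> m + e"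
    "\<And>r. m < r \<Longrightarrow> r < m + e \<Longrightarrow> phi r (tword X) = 0"
    using ex_lowest_weight[OF U setU] by blast
  have rlX: "rl X k = l (m + k)" for k
  proof -
    have "rl X k = rl U k" using X(1,2) U shape_eq_iff by blast
    also have "rl U k = l (m + k)" using lenT0[of "m + k"] by (auto simp: U_def rl_def)
    finally show ?thesis .
  qed
  have cntX: "cnt v (X ! k) = l (m + (m + e - v + k))" if "m \<le> v" "v \<le> m + e" "k < length X" for v k
  proof -
    have "cnt v (X ! k) = rl X (m + e - v + k)" using lowest_weight_rows[OF X(1,3,4) that] by simp
    then show ?thesis by (simp add: rlX)
  qed
  have contX: "count_list (tword X) (m + 1 + i) = l (m + e - 1 - i)" if "i < e" for i
  proof -
    have "cnt v (X ! k) = rl X (m + e - v + k)" if "m \<le> v" "v \<le> m + e" "k < length X" for v k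
      using lowest_weight_rows[OF X(1,3,4) that] by simp
    then have "count_list (tword X) (m + 1 + i) = rl X (m + e - (m + 1 + i))"
      using lowest_weight_content[OF X(1,3), of "m + 1 + i"] that by simp
    moreover have "m + (m + e - (m + 1 + i)) = m + e - 1 - i" using that by simp
    ultimately show ?thesis using rlX by simp
  qed
  define top where "top = map (\<lambda>i. replicate mu (Suc i) @ replicate (l i - mu) (m + 1 + i)) [0..<m]"
  define T where "T = top @ X"
  have ltop: "length top = m" by (simp add: top_def)
  have ntop: "top ! i = replicate mu (Suc i) @ replicate (l i - mu) (m + 1 + i)" if "i < m" for i
    using that by (simp add: top_def)
  have Ti: "T ! i = (if i < m then replicate mu (Suc i) @ replicate (l i - mu) (m + 1 + i) else X ! (i - m))" for i
    by (simp add: T_def nth_append ltop ntop)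
  have lenT: "length T = m + length X" by (simp add: T_def ltop)
  have rlT: "rl T i = l i" for i
    using rlX[of "i - m"] lmu[of i] by (auto simp: rl_def lenT Ti split: if_splits)
  have rowX: "m < X ! k ! j" if "k < length X" "j < length (X ! k)" for k j
    using X(3)[of "X ! k ! j"] that unfolding set_tword by (meson UN_I nth_mem)
  have cs: "column_strict T"
    unfolding column_strict_iff
  proof (intro conjI allI impI)
    fix i assume i: "i < length T"
    show "T ! i \<noteq> []" using X(1) i pos by (auto simp: Ti lenT column_strict_iff)
    show "sorted (T ! i)" using X(1) i by (auto simp: Ti lenT column_strict_iff sorted_append)
  next
    fix i assume i: "Suc i < length T"
    have le: "length (T ! Suc i) \<le> length (T ! i)"
      using rlT[of i] rlT[of "Suc i"] mono[of i "Suc i"] i by (simp add: rl_def)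
    consider "Suc i < m" | "Suc i = m" | "m \<le> i" by linarith
    then show "dominates (T ! i) (T ! Suc i)"
    proof cases
      case 1
      have "l (Suc i) \<le> l i" by (rule mono) simp
      then show ?thesis using le 1 by (auto simp: dominates_def Ti nth_append)
    next
      case 2
      have im: "i < m" and X0: "0 < length X" using i 2 lenT by auto
      have "T ! i ! j < X ! 0 ! j" if j: "j < length (X ! 0)" for j
      proof (cases "j < mu")
        case True
        then show ?thesis using rowX[OF X0 j] im by (simp add: Ti nth_append)
      next
        case False
        have jl: "j < l m" using rlX[of 0] X0 j by (simp add: rl_def)
        have em: "m \<le> e"
        proof (rule ccontr)
          assume "\<not> m \<le> e"
          then have "l i = mu" using l2[of i] im 2 by simp
          moreover have "l m \<le> l i" by (rule mono) (use im in simp)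
          ultimately show False using jl False by simp
        qed
        have "m + e - 1 - i = e" using 2 by simp
        then have "l e \<le> mu" using l1[of i] im em 2 by simp
        \<comment> \<open>The entry above, in row \<open>m - 1\<close> and beyond the first
          rectangle, is \<open>2 * m\<close>. Only the first \<open>l e\<close> entries of row
          \<open>m\<close> are at most \<open>2 * m\<close>, and
          \<open>l e \<le> mu\<close>.\<close>
        moreover have "cnt (2 * m) (X ! 0) = l e" using cntX[of "2 * m" 0] em X0 by simp
        ultimately have "\<not> X ! 0 ! j \<le> 2 * m"
          using sorted_cnt[of "X ! 0" j "2 * m"] X(1) X0 j False by (simp add: column_strict_iff)
        moreover have "T ! i ! j = m + 1 + i"
          using im False jl mono[of i m] by (simp add: Ti nth_append)
        ultimately show ?thesis using 2 by simp
      qed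
      then show ?thesis using le 2 by (simp add: dominates_def Ti)
    next
      case 3
      then show ?thesis using X(1) i by (simp add: Ti lenT column_strict_iff Suc_diff_le)
    qed
  qed
  have sh: "shape T = shape T0" using shape_eq_iff[OF cs T0] rlT by (simp add: l_def)
  have word: "tword T = tword X @ tword top" by (simp add: T_def)
  have ctop1: "count_list (tword top) (Suc k) = mu" if "k < m" for k
  proof -
    have "count_list (tword top) (Suc k) = (\<Sum>i<m. if i = k then mu else 0)"
      unfolding count_tword ltop using that by (intro sum.cong) (auto simp: ntop count_replicate)
    then show ?thesis using that by simp
  qed
  have ctop2: "count_list (tword top) (m + 1 + k) = (if k < m then l k - mu else 0)" for k
  proof -
    have "count_list (tword top) (m + 1 + k) = (\<Sum>i<m. if i = k then l k - mu else 0)"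
      unfolding count_tword ltop by (intro sum.cong) (auto simp: ntop count_replicate)
    then show ?thesis by simp
  qed
  have rtop: "x = Suc i \<or> x = m + 1 + i \<and> i < e" if "i < m" "x \<in> set (top ! i)" for i x
    using that l2[of i] by (cases "i < e") (auto simp: ntop split: if_splits)
  have take_top: "\<exists>i<p. i < m \<and> x \<in> set (top ! i)" if x: "x \<in> set (tword (take p top))" for x p
  proof -
    obtain s where s: "s \<in> set (take p top)" "x \<in> set s" using x unfolding set_tword by blast
    then obtain i where "i < length (take p top)" "s = take p top ! i" by (metis in_set_conv_nth)
    then show ?thesis using s(2) ltop by auto
  qed
  have drop_top: "\<exists>i\<ge>p. i < m \<and> x \<in> set (top ! i)" if x: "x \<in> set (tword (drop p top))" for x p
  proof -
    obtain s where s: "s \<in> set (drop p top)" "x \<in> set s" using x unfolding set_tword by blast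
    then obtain i where "i < length (drop p top)" "s = drop p top ! i" by (metis in_set_conv_nth)
    then show ?thesis using s(2) ltop by (intro exI[of _ "p + i"]) auto
  qed
  have ctotal: "count_list (tword T) (m + 1 + i) = nu" if "i < e" for i
    using contX[OF that] ctop2[of i] l1(1)[of i] lmu[of i] l3[of "m + e - 1 - i"] that word by auto
  have W: "W2 m e mu nu (tword T)"
    unfolding W2_def
  proof (intro conjI allI impI)
    show "set (tword T) \<subseteq> {1..m + e}"
    proof
      fix x assume "x \<in> set (tword T)"
      then consider "x \<in> set (tword X)" | "x \<in> set (tword (take m top))" by (auto simp: word ltop)
      then show "x \<in> {1..m + e}"
      proof cases
        case 1
        then show ?thesis using X(3)[of x] by auto
      next
        case 2
        then show ?thesis using take_top[OF 2] rtop by fastforce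
      qed
    qed
    show "count_list (tword T) k = mu" if "1 \<le> k \<and> k \<le> m" for k
    proof -
      have "k \<notin> set (tword X)" using X(3)[of k] that by auto
      moreover have "k - 1 < m" using that by linarith
      ultimately show ?thesis using ctop1[of "k - 1"] that by (simp add: word count_list_0_iff)
    qed
    show "count_list (tword T) k = nu" if "m < k \<and> k \<le> m + e" for k
    proof -
      have "k - m - 1 < e" "m + 1 + (k - m - 1) = k" using that by linarith+
      then show ?thesis using ctotal[of "k - m - 1"] by simp
    qed
    fix r assume r: "1 \<le> r \<and> r < m + e \<and> r \<noteq> m"
    show "eps r (tword T) = 0"
    proof (cases "r < m")
      case True
      have "epsA r (tword X) 0 = 0" using X(3)[of r] X(3)[of "Suc r"] True by (intro epsA_outside) auto
      moreover have "eps r (tword top) = 0"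
      proof -
        \<comment> \<open>Row \<open>r - 1\<close> holds the letters \<open>r\<close> and row
          \<open>r\<close> the letters \<open>Suc r\<close>, so the word is cut between these
          rows.\<close>
        have tp: "tword top = tword (drop r top) @ tword (take r top)"
          by (metis append_take_drop_id tword_append)
        have no: "Suc r \<notin> set (tword (take r top))" using take_top rtop True by fastforce
        have "r \<notin> set (tword (drop r top))"
        proof
          assume "r \<in> set (tword (drop r top))"
          then obtain i where "i < m" "r \<le> i" "r \<in> set (top ! i)" using drop_top by blast
          then show False using rtop[of i r] True by auto
        qed
        then have "count_list (tword (take r top)) r = mu"
          using ctop1[of "r - 1"] r True arg_cong[OF tp, of "\<lambda>w. count_list w r"]
          by (cases r) (auto simp: count_list_0_iff)
        moreover have "count_list (tword (drop r top)) (Suc r) \<le> mu"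
          using ctop1[of r] True arg_cong[OF tp, of "\<lambda>w. count_list w (Suc r)"] by simp
        ultimately show ?thesis using eps_zero_split[OF no] tp by simp
      qed
      ultimately show ?thesis by (simp add: word)
    next
      case False
      define i where "i = r - m - 1"
      have ri: "r = m + 1 + i" "Suc i < e" using False r by (auto simp: i_def)
      have "eps r (tword top) = 0"
      proof -
        have tp: "tword top = tword (drop (Suc i) top) @ tword (take (Suc i) top)"
          by (metis append_take_drop_id tword_append)
        have no: "Suc r \<notin> set (tword (take (Suc i) top))" using take_top rtop ri by fastforce
        have "r \<notin> set (tword (drop (Suc i) top))"
        proof
          assume "r \<in> set (tword (drop (Suc i) top))"
          then obtain k where "k < m" "Suc i \<le> k" "r \<in> set (top ! k)" using drop_top by blast
          then show False using rtop[of k r] ri by auto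
        qed
        then have "count_list (tword (take (Suc i) top)) r = (if i < m then l i - mu else 0)"
          using ctop2[of i] ri arg_cong[OF tp, of "\<lambda>w. count_list w r"] by (simp add: count_list_0_iff)
        moreover have "count_list (tword (drop (Suc i) top)) (Suc r) \<le> (if Suc i < m then l (Suc i) - mu else 0)"
          using ctop2[of "Suc i"] ri arg_cong[OF tp, of "\<lambda>w. count_list w (Suc r)"] by simp
        moreover have "l (Suc i) \<le> l i" by (rule mono) simp
        ultimately show ?thesis using eps_zero_split[OF no] tp by (simp split: if_splits)
      qed
      moreover have "count_list (tword X @ tword top) r = nu" "count_list (tword X @ tword top) (Suc r) = nu"
        using ctotal[of i] ctotal[of "Suc i"] ri word by auto
      moreover have "phi r (tword X) = 0" using X(4) ri by simp
      \<comment> \<open>The computation of \<open>LR_bottom\<close> in the opposite direction: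
        \<open>phi\<close> zero at the bottom gives that the top closes all that is open.\<close>
      ultimately show ?thesis
        using eps_phi_count[of r "tword X"] eps_phi_count[of r "tword top"]
          epsA_eq[of r "tword top" "eps r (tword X)"] by (simp add: word)
    qed
  qed
  show ?thesis using cs sh W by blast
qed

end

section \<open>Promotion of a block\<close>

text \<open>A word for the longest element on the letters from \<open>off + 1\<close> to
  \<open>off + h\<close>: each further run carries \<open>off + 1\<close> to the new largest
  letter.\<close>

fun rev_word :: "nat \<Rightarrow> nat \<Rightarrow> nat list" where
  "rev_word off 0 = []"
| "rev_word off (Suc h) = rev_word off h @ rev [Suc off..<Suc (off + h)]"

lemma set_rev_word: "r \<in> set (rev_word off h) \<Longrightarrow> off < r \<and> Suc r \<le> off + h"
  by (induction h) auto

lemma gens_prod_rev_upt: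
  "a \<le> b \<Longrightarrow> gens_prod (rev [a..<b]) k = (if k = a then b else if a < k \<and> k \<le> b then k - 1 else k)"
proof (induction b rule: dec_induct)
  case (step n)
  then show ?case by (auto simp: transp_fun_def)
qed simp

lemma gens_prod_rev_word:
  "gens_prod (rev_word off h) k = (if off < k \<and> k \<le> off + h then 2 * off + h + 1 - k else k)"
proof (induction h arbitrary: k)
  case (Suc h)
  have "gens_prod (rev_word off (Suc h)) k = gens_prod (rev_word off h) (gens_prod (rev [Suc off..<Suc (off + h)]) k)"
    by (simp add: gens_prod_append del: upt_Suc)
  also have "gens_prod (rev [Suc off..<Suc (off + h)]) k =
      (if k = Suc off then Suc (off + h) else if Suc off < k \<and> k \<le> Suc (off + h) then k - 1 else k)"
    by (rule gens_prod_rev_upt) simp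
  finally show ?case unfolding Suc.IH by (cases h) auto
qed simp

lemma rev_word_shift: "rev_word (off + d) h = map (\<lambda>r. r + d) (rev_word off h)"
proof (induction h)
  case (Suc h)
  have "[Suc (off + d)..<Suc (off + d + h)] = map (\<lambda>r. r + d) [Suc off..<Suc (off + h)]"
    by (rule nth_equalityI) (auto simp del: upt_Suc)
  then show ?case using Suc by (simp add: rev_map del: upt_Suc)
qed simp

definition Blk :: "nat \<Rightarrow> nat \<Rightarrow> nat \<Rightarrow> nat list \<Rightarrow> bool" where
  "Blk off h mu w \<longleftrightarrow> (\<forall>k. off < k \<and> k \<le> off + h \<longrightarrow> count_list w k = mu) \<and>
     (\<forall>r. off < r \<and> Suc r \<le> off + h \<longrightarrow> eps r w = 0)"

lemma count_filter: "k \<in> B \<Longrightarrow> count_list (filter (\<lambda>x. x \<in> B) w) k = count_list w k"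
  by (induction w) auto

lemma Blk_filter:
  assumes "filter (\<lambda>x. x \<in> {off + 1..off + h}) u = filter (\<lambda>x. x \<in> {off + 1..off + h}) v"
  shows "Blk off h mu u = Blk off h mu v"
proof -
  have "count_list u k = count_list v k" if "off < k" "k \<le> off + h" for k
    using count_filter[of k "{off + 1..off + h}" u] count_filter[of k "{off + 1..off + h}" v] assms that by simp
  moreover have "eps r u = eps r v" if "off < r" "Suc r \<le> off + h" for r
    using epsA_filter[of r "{off + 1..off + h}" u 0] epsA_filter[of r "{off + 1..off + h}" v 0] assms that by simp
  ultimately show ?thesis unfolding Blk_def by auto
qed

lemma Blk_phi: "Blk off h mu w \<Longrightarrow> off < r \<Longrightarrow> Suc r \<le> off + h \<Longrightarrow> phi r w = 0"
  using eps_phi_count[of r w] by (auto simp: Blk_def)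

text \<open>A rectangular block has no unmatched letters for its generators, so each of them fixes
  the word.\<close>

lemma Blk_act_fix: "Blk off h mu w \<Longrightarrow> act_gens (rev_word off h) w = w"
  by (rule act_gens_fix) (use Blk_phi set_rev_word in \<open>auto simp: Blk_def\<close>)

text \<open>Any larger letter of the block would be unmatched at the end of the word.\<close>

lemma Blk_last:
  assumes "Blk off h mu (u @ [x])" "off < x" "x \<le> off + h" shows "x = Suc off"
proof (rule ccontr)
  assume "x \<noteq> Suc off"
  then obtain r where r: "x = Suc r" "off < r" using assms(2) by (cases x) auto
  then have "eps r (u @ [x]) = 0" using assms by (auto simp: Blk_def)
  then show False using r by simp
qed

text \<open>Without \<open>x\<close> the block has the shape of the rectangle minus its corner and
  lacks one smallest letter. The longest element reverses the content, so that one largest letter is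
  missing; content and shape now agree and the block is of highest weight. The new first letter
  \<open>off + h\<close> is matched by the one free \<open>off + h - 1\<close>.\<close>

lemma Blk_promote:
  assumes mu: "0 < mu" and B: "Blk off h mu (u @ [x])" and x: "off < x" "x \<le> off + h"
  shows "Blk off h mu ((off + h) # act_gens (rev_word off h) u)"
proof -
  let ?B = "{off + 1..off + h}"
  let ?f = "filter (\<lambda>x. x \<in> ?B)"
  define u' where "u' = act_gens (rev_word off h) u"
  define v v' where "v = ?f u" and "v' = ?f u'"
  have x1: "x = Suc off" by (rule Blk_last[OF B x])
  have h: "0 < h" using x by linarith
  have cu: "count_list u k = (if k = Suc off then mu - 1 else mu)" if "off < k" "k \<le> off + h" for k
    using B that x1 by (auto simp: Blk_def split: if_splits)
  have cu': "count_list u' k = (if k = off + h then mu - 1 else mu)" if k: "off < k" "k \<le> off + h" for k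
  proof -
    define k' where "k' = 2 * off + h + 1 - k"
    have k': "off < k'" "k' \<le> off + h" "k' = Suc off \<longleftrightarrow> k = off + h" using k by (auto simp: k'_def)
    have "gens_prod (rev_word off h) k' = k" using k by (auto simp: gens_prod_rev_word k'_def)
    then have "count_list u' k = count_list u k'"
      using act_gens_count[of "rev_word off h" u k'] by (simp add: u'_def)
    then show ?thesis using cu[of k'] k' by simp
  qed
  have v': "v' = act_gens (rev_word off h) v"
    unfolding v'_def v_def u'_def by (rule act_gens_filter) (use set_rev_word in fastforce)
  have "?f (u @ [x]) = v @ [x]" using x by (simp add: v_def)
  moreover have "knuth_equiv (?f (u @ [x])) (tword (rect off h mu))"
    using block_iff[OF mu] B unfolding Blk_def by blast
  ultimately have P: "Ptab (v @ [x]) = rect off h mu"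
    using Ptab_unique[OF column_strict_rect[OF mu]] by metis
  obtain k where k: "k \<le> length (Ptab v)" "shape (Ptab (v @ [x])) = inc k (shape (Ptab v))"
    by (rule Ptab_snoc_shape)
  have rlr: "rl (Ptab (v @ [x])) i = (if i < h then mu else 0)" for i
    unfolding P by (simp add: rl_def nth_rect)
  have rli: "rl (Ptab (v @ [x])) i = rl (Ptab v) i + (if i = k then 1 else 0)" for i by (rule rl_inc[OF k])
  have "k = h - 1"
  proof (rule ccontr)
    assume ne: "k \<noteq> h - 1"
    have "k < h" using rlr[of k] rli[of k] by (simp split: if_splits)
    with ne h have "Suc k < h" by simp
    then have "rl (Ptab v) (Suc k) = mu" "rl (Ptab v) k = mu - 1"
      using rlr[of k] rli[of k] rlr[of "Suc k"] rli[of "Suc k"] by simp_all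
    then show False using rl_antimono[OF column_strict_Ptab, of k "Suc k" v] mu by simp
  qed
  then have rlv: "rl (Ptab v) i = (if i < h then if i = h - 1 then mu - 1 else mu else 0)" for i
    using rlr[of i] rli[of i] h by (auto split: if_splits)
  \<comment> \<open>Letters from \<open>0\<close>, so that content and shape can be
    compared.\<close>
  define v0 where "v0 = map (\<lambda>x. x - Suc off) v'"
  have vs: "v' = map (\<lambda>x. x + Suc off) v0"
    unfolding v0_def map_map by (rule map_idI[symmetric]) (auto simp: v'_def)
  have "count_list v0 i = rl (Ptab v0) i" for i
  proof -
    have "count_list v0 i = count_list v' (i + Suc off)" unfolding vs by (induction v0) auto
    also have "\<dots> = (if i < h then count_list u' (i + Suc off) else 0)"
      using count_filter[of "i + Suc off" ?B u'] by (auto simp: v'_def count_list_0_iff)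
    also have "\<dots> = rl (Ptab v) i" using cu'[of "i + Suc off"] h by (auto simp: rlv)
    also have "\<dots> = rl (Ptab v') i" unfolding v' by (rule rl_cong[OF Qs_shape[OF act_gens_Qs]])
    also have "\<dots> = rl (Ptab v0) i" unfolding vs by (rule rl_shift)
    finally show ?thesis .
  qed
  then have hw: "hwd v0" by (rule content_eq_shape_imp_hw)
  have eps: "eps r u' = 0" if r: "off < r" "Suc r \<le> off + h" for r
  proof -
    have "eps r u' = eps r v'" unfolding v'_def by (rule epsA_filter[symmetric]) (use r in auto)
    also have "\<dots> = eps (r - Suc off) v0"
      using epsA_shift[of "r - Suc off" "Suc off" v0 0] r unfolding vs by simp
    finally show ?thesis using hw by simp
  qed
  have "eps r ((off + h) # u') = 0" if r: "off < r" "Suc r \<le> off + h" for r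
  proof (cases "off + h = Suc r")
    case True
    then have "phi r u' = 1" using eps_phi_count[of r u'] eps[OF r] cu'[of r] cu'[of "Suc r"] r mu by simp
    then show ?thesis using True eps[OF r] epsA_eq[of r u' "Suc 0"] by simp
  qed (use eps[OF r] r in simp)
  moreover have "count_list ((off + h) # u') k = mu" if "off < k" "k \<le> off + h" for k
    using cu'[OF that] mu by auto
  ultimately show ?thesis unfolding Blk_def u'_def by blast
qed

section \<open>Two rectangles: cyclage and shape\<close>

lemma W2_Blk: "W2 m e mu nu w \<longleftrightarrow> set w \<subseteq> {1..m + e} \<and> Blk 0 m mu w \<and> Blk m e nu w"
proof -
  have "(\<forall>r. 1 \<le> r \<and> r < m + e \<and> r \<noteq> m \<longrightarrow> eps r w = 0) \<longleftrightarrow>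
    (\<forall>r. 0 < r \<and> Suc r \<le> 0 + m \<longrightarrow> eps r w = 0) \<and> (\<forall>r. m < r \<and> Suc r \<le> m + e \<longrightarrow> eps r w = 0)"
    by (auto simp: Suc_le_eq) (metis linorder_neqE_nat)
  then show ?thesis unfolding W2_def Blk_def by (auto simp: Suc_le_eq)
qed

lemma W2_knuth: "knuth_equiv u v \<Longrightarrow> W2 m e mu nu u = W2 m e mu nu v"
  unfolding W2_def using knuth_set[of u v] knuth_count[of u v] epsA_knuth[of u v] by simp

lemma W2_Ptab: "W2 m e mu nu (tword (Ptab w)) = W2 m e mu nu w"
  by (rule W2_knuth[OF knuth_sym[OF knuth_Ptab]])

text \<open>On words satisfying \<open>W2\<close> the last letter is the smallest of its block, so
  its image is the largest one; the longest element of the other block acts trivially.\<close>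

definition chi2 :: "nat \<Rightarrow> nat \<Rightarrow> nat list \<Rightarrow> nat \<Rightarrow> nat list" where
  "chi2 m e u x = (if x \<le> m then m # act_gens (rev_word 0 m) u else (m + e) # act_gens (rev_word m e) u)"

section \<open>Bounds on the box added at either end of a word\<close>

lemma length_takeWhile_cnt: "sorted r \<Longrightarrow> length (takeWhile (\<lambda>z. z \<le> x) r) = cnt x r"
proof (induction r)
  case (Cons a r)
  show ?case
  proof (cases "a \<le> x")
    case False
    then have "cnt x (a # r) = 0" using Cons.prems by (intro cnt_none) auto
    then show ?thesis using False by simp
  qed (use Cons in \<open>auto simp: cnt_def\<close>)
qed (simp add: cnt_def)

text \<open>The bumping path of a row insertion moves weakly to the left, and its letters increase.\<close>

lemma bumping_path:
  "column_strict T \<Longrightarrow> \<exists>k\<le>length T. shape (tab_ins x T) = inc k (shape T) \<and>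
     rl (tab_ins x T) k \<le> Suc (cnt x (if T = [] then [] else hd T)) \<and>
     (\<forall>n. x \<le> n \<and> (\<forall>y\<in>set (tword T). y \<le> n) \<longrightarrow> k + x \<le> n)"
proof (induction T arbitrary: x)
  case Nil
  then show ?case by (simp add: shape_def inc_def rl_def)
next
  case (Cons r T)
  obtain r' b where rb: "row_ins x r = (r', b)" by force
  have r: "sorted r" "column_strict T" "T \<noteq> [] \<Longrightarrow> dominates r (hd T)"
    using Cons.prems by (auto simp: column_strict_Cons)
  show ?case
  proof (cases b)
    case None
    then have "r' = r @ [x]" "\<forall>z\<in>set r. z \<le> x" using row_ins_None[of x r r'] rb by auto
    then show ?thesis using rb None cnt_all[of r x]
      by (intro exI[of _ 0]) (auto simp: shape_def inc_def rl_def)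
  next
    case (Some y)
    obtain k where k: "k \<le> length T" "shape (tab_ins y T) = inc k (shape T)"
      "rl (tab_ins y T) k \<le> Suc (cnt y (if T = [] then [] else hd T))"
      "\<forall>n. y \<le> n \<and> (\<forall>z\<in>set (tword T). z \<le> n) \<longrightarrow> k + y \<le> n" using Cons.IH[OF r(2)] by blast
    note S = row_ins_Some[OF rb[unfolded Some]]
    have y: "cnt x r < length r" "y = r ! cnt x r"
      using rb Some length_takeWhile_cnt[OF r(1), of x] by (auto simp: row_ins_spec Let_def split: if_splits)
    have "cnt y (if T = [] then [] else hd T) \<le> cnt x r"
    proof (cases "T = []")
      case False
      show ?thesis
      proof (rule ccontr)
        assume "\<not> ?thesis"
        then have c: "cnt x r < cnt y (hd T)" using False by simp
        then have l: "cnt x r < length (hd T)" using cnt_le[of y "hd T"] by simp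
        moreover have "sorted (hd T)" using r(2) False by (cases T) (auto simp: column_strict_Cons)
        ultimately have "hd T ! cnt x r \<le> y" using sorted_cnt c by blast
        then show False using r(3)[OF False] l y by (auto simp: dominates_def)
      qed
    qed (simp add: cnt_def)
    moreover have "rl (tab_ins x (r # T)) (Suc k) = rl (tab_ins y T) k" using rb Some by (simp add: rl_def)
    moreover have "shape (tab_ins x (r # T)) = inc (Suc k) (shape (r # T))"
      using rb Some k S by (auto simp: shape_def inc_def)
    moreover have "Suc k + x \<le> n" if "x \<le> n \<and> (\<forall>z\<in>set (tword (r # T)). z \<le> n)" for n
    proof -
      have "k + y \<le> n" using k(4) that S by auto
      then show ?thesis using S by simp
    qed
    ultimately show ?thesis using k by (intro exI[of _ "Suc k"]) auto
  qed
qed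

lemma snoc_box:
  obtains c where "\<And>i. rl (Ptab (u @ [x])) i = rl (Ptab u) i + (if i = c then 1 else 0)"
    "rl (Ptab (u @ [x])) c \<le> Suc (cnt x (if Ptab u = [] then [] else hd (Ptab u)))"
    "\<And>n. x \<le> n \<Longrightarrow> (\<forall>y\<in>set u. y \<le> n) \<Longrightarrow> c + x \<le> n"
proof -
  obtain k where k: "k \<le> length (Ptab u)" "shape (Ptab (u @ [x])) = inc k (shape (Ptab u))"
     "rl (Ptab (u @ [x])) k \<le> Suc (cnt x (if Ptab u = [] then [] else hd (Ptab u)))"
     "\<forall>n. x \<le> n \<and> (\<forall>y\<in>set u. y \<le> n) \<longrightarrow> k + x \<le> n"
    using bumping_path[OF column_strict_Ptab, of u x] unfolding Ptab_snoc[symmetric] set_Ptab by blast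
  then show thesis using that[of k] rl_inc[OF k(1,2)] by blast
qed

lemma row_ins_middle: "\<forall>z\<in>set p. z \<le> a \<Longrightarrow> a < b \<Longrightarrow> row_ins a (p @ b # q) = (p @ a # q, Some b)"
  by (induction p) auto

text \<open>Inserting \<open>t\<close> into the row \<open>p @ s @ [n]\<close> bumps the letters of
  \<open>s\<close> in turn, so \<open>n\<close> passes from the end of the lower row to the end of
  the upper one. The prefix \<open>p\<close> collects the letters already inserted.\<close>

lemma knuth_pass_max:
  assumes "length s = length t" "sorted (p @ s @ [n])" "sorted (p @ t)" "\<forall>j<length s. t ! j < s ! j"
  shows "knuth_equiv ((p @ s @ [n]) @ t) (s @ (p @ t @ [n]))"
  using assms
proof (induction s t arbitrary: p rule: list_induct2)
  case (Cons b s a t)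
  have ab: "a < b" using Cons.prems(3) by (metis length_greater_0_conv list.distinct(1) nth_Cons_0)
  have pa: "\<forall>z\<in>set p. z \<le> a" using Cons.prems(2) by (auto simp: sorted_append)
  have "knuth_equiv ((p @ b # s @ [n]) @ [a]) (b # (p @ a # s @ [n]))"
    by (rule row_ins_knuth) (use Cons.prems(1) row_ins_middle[OF pa ab] in auto)
  then have "knuth_equiv (((p @ b # s @ [n]) @ [a]) @ t) ((b # (p @ a # s @ [n])) @ t)"
    by (rule knuth_append_right)
  also have "knuth_equiv \<dots> (b # (s @ ((p @ [a]) @ t @ [n])))"
  proof -
    have "knuth_equiv (((p @ [a]) @ s @ [n]) @ t) (s @ ((p @ [a]) @ t @ [n]))"
    proof (rule Cons.IH)
      show "sorted ((p @ [a]) @ s @ [n])" using Cons.prems(1) ab pa by (auto simp: sorted_append)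
      show "sorted ((p @ [a]) @ t)" using Cons.prems(2) by simp
      show "\<forall>j<length s. t ! j < s ! j" using Cons.prems(3) by (metis Suc_less_eq length_Cons nth_Cons_Suc)
    qed
    from knuth_append_left[OF this, of "[b]"] show ?thesis by simp
  qed
  finally show ?case by simp
qed simp

definition addn :: "nat \<Rightarrow> nat \<Rightarrow> nat list list \<Rightarrow> nat list list" where
  "addn n k T = (if k < length T then T[k := T ! k @ [n]] else T @ [[n]])"

text \<open>Prepending a maximal letter adds a box to the first column not containing it.\<close>

lemma prepend_max_tableau:
  "column_strict T \<Longrightarrow> \<forall>x\<in>set (tword T). x \<le> n \<Longrightarrow> \<exists>k\<le>length T. column_strict (addn n k T) \<and>
     knuth_equiv (n # tword T) (tword (addn n k T)) \<and> rl (addn n k T) k \<le> Suc (count_list (tword T) n)"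
proof (induction T)
  case Nil
  show ?case by (simp add: addn_def column_strict_Cons rl_def)
next
  case (Cons r T)
  have r: "sorted r" "r \<noteq> []" "column_strict T" "T \<noteq> [] \<Longrightarrow> dominates r (hd T)"
    using Cons.prems by (auto simp: column_strict_Cons)
  obtain k where k: "k \<le> length T" "column_strict (addn n k T)" "knuth_equiv (n # tword T) (tword (addn n k T))"
    "rl (addn n k T) k \<le> Suc (count_list (tword T) n)" using Cons r(3) by auto
  have word: "knuth_equiv (n # tword (r # T)) (tword (addn n k T) @ r)"
    using knuth_append_right[OF k(3), of r] by simp
  have addS: "addn n (Suc k) (r # T) = r # addn n k T" by (simp add: addn_def)
  have rlS: "rl (r # addn n k T) (Suc k) = rl (addn n k T) k" by (simp add: rl_def)
  define s where "s = (if T = [] then [] else hd T)"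
  have hd: "addn n k T \<noteq> []" "hd (addn n k T) = (if k = 0 then s @ [n] else hd T)"
    using k(1) by (cases T; auto simp: addn_def s_def nth_Cons split: nat.splits)+
  show ?case
  \<comment> \<open>Either the next row, possibly extended by \<open>n\<close>, still fits under
    \<open>r\<close>, or \<open>n\<close> moves up to the end of \<open>r\<close>.\<close>
  proof (cases "dominates r (hd (addn n k T))")
    case True
    then have "column_strict (addn n (Suc k) (r # T))" using r k(2) addS hd by (simp add: column_strict_Cons)
    then show ?thesis using word k addS rlS by (intro exI[of _ "Suc k"]) auto
  next
    case False
    have k0: "k = 0"
    proof (rule ccontr)
      assume k0: "k \<noteq> 0"
      then have "T \<noteq> []" using k(1) by auto
      then show False using r(4) hd(2) False k0 by simp
    qed
    have dom: "dominates r s" using r(4) by (auto simp: s_def dominates_def)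
    define t where "t = take (length s) r"
    define z where "z = drop (length s) r"
    have tz: "r = t @ z" "length s = length t" using dom by (auto simp: t_def z_def dominates_def)
    have rn: "\<forall>x\<in>set r. x \<le> n" and sn: "\<forall>x\<in>set s. x \<le> n"
      using Cons.prems(2) by (cases T; auto simp: s_def)+
    have nd: "\<not> (length s < length r \<and> r ! length s < n)"
      using False dom hd k0 by (auto simp: dominates_def nth_append less_Suc_eq_le le_less)
    \<comment> \<open>Nothing smaller than \<open>n\<close> stands above the failed box, so beyond
      the length of \<open>s\<close> the row \<open>r\<close> can only contain letters
      \<open>n\<close>.\<close>
    have zn: "z = replicate (length z) n"
    proof (rule replicate_eqI)
      fix x assume x: "x \<in> set z"
      then obtain z0 z' where z: "z = z0 # z'" by (cases z) auto
      then have "r ! length s = z0" "length s < length r" using tz by (auto simp: nth_append)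
      then have "n \<le> z0" using nd by simp
      moreover have "z0 \<le> x" using r(1) tz z x by (auto simp: sorted_append)
      moreover have "x \<le> n" using rn tz x by simp
      ultimately show "x = n" by linarith
    qed simp
    have ssn: "sorted (s @ [n])"
      using r(3) sn by (cases T) (auto simp: s_def column_strict_Cons sorted_append)
    have "knuth_equiv (([] @ s @ [n]) @ t) (s @ ([] @ t @ [n]))"
    proof (rule knuth_pass_max)
      show "\<forall>j<length s. t ! j < s ! j" using dom by (auto simp: dominates_def t_def)
      show "sorted ([] @ t)" using r(1) by (simp add: t_def)
    qed (use tz ssn in auto)
    then have p: "knuth_equiv ((s @ [n]) @ r) (s @ r @ [n])"
    proof -
      assume k: "knuth_equiv (([] @ s @ [n]) @ t) (s @ ([] @ t @ [n]))"
      have "knuth_equiv ((s @ [n] @ t) @ z) ((s @ t @ [n]) @ z)" using knuth_append_right[OF k, of z] by simp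
      moreover have "n # z = z @ [n]" using replicate_append_same[of "length z" n] zn by metis
      ultimately show ?thesis using tz(1) by simp
    qed
    obtain rest where rest: "tword (addn n k T) = rest @ s @ [n]" "tword T = rest @ s"
      using k0 by (cases T) (auto simp: addn_def s_def)
    have "knuth_equiv (n # tword (r # T)) (tword T @ r @ [n])"
      using knuth_trans[OF word] knuth_append_left[OF p, of rest] rest by simp
    moreover have a0: "addn n 0 (r # T) = (r @ [n]) # T" by (simp add: addn_def)
    moreover have "column_strict ((r @ [n]) # T)"
      using r rn by (auto simp: column_strict_Cons sorted_append dominates_def nth_append)
    moreover have "rl ((r @ [n]) # T) 0 \<le> Suc (count_list (tword (r # T)) n)"
    proof -
      have "rl (addn n k T) k = Suc (length s)" using k0 by (cases T) (auto simp: addn_def s_def rl_def)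
      then have "length s \<le> count_list (tword T) n" using k(4) by simp
      moreover have "length z \<le> count_list r n"
        using count_replicate[of "length z" n n] zn tz(1) by (metis count_list_append le_add2)
      moreover have "length r = length s + length z" using tz by simp
      ultimately show ?thesis by (simp add: rl_def)
    qed
    ultimately show ?thesis by (intro exI[of _ 0]) simp
  qed
qed

lemma prepend_max:
  assumes "\<forall>x\<in>set u. x \<le> n" and i: "\<And>i. rl (Ptab (n # u)) i = rl (Ptab u) i + (if i = c then 1 else 0)"
  shows "rl (Ptab (n # u)) c \<le> Suc (count_list u n)"
proof -
  let ?T = "Ptab u"
  obtain k where k: "k \<le> length ?T" "column_strict (addn n k ?T)"
    "knuth_equiv (n # tword ?T) (tword (addn n k ?T))" "rl (addn n k ?T) k \<le> Suc (count_list u n)"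
    using prepend_max_tableau[OF column_strict_Ptab, of u n] assms(1) unfolding set_Ptab count_Ptab by blast
  have "knuth_equiv (n # u) (tword (addn n k ?T))"
    using knuth_trans[OF knuth_append_left[OF knuth_Ptab, of "[n]" u]] k(3) by simp
  then have P: "Ptab (n # u) = addn n k ?T" by (rule Ptab_unique[OF k(2)])
  have "rl (addn n k ?T) k = Suc (rl ?T k)" using k(1) by (auto simp: addn_def rl_def nth_append)
  then have "k = c" using i[of k] P by (simp split: if_splits)
  then show ?thesis using k(4) P by simp
qed

lemma prepend_box:
  "\<exists>x'\<le>x. \<forall>i. rl (Ptab (x # u)) i = rl (Ptab u) i + (if i = x' then 1 else 0)"
  by (rule prepend[of x u]) blast

text \<open>In the absence of \<open>0\<close> all letters can be translated down by one, which
  sharpens the bound of \<open>prepend_box\<close> by one.\<close>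

lemma prepend_row:
  assumes "0 < y" "0 \<notin> set u" and i: "\<And>i. rl (Ptab (y # u)) i = rl (Ptab u) i + (if i = c then 1 else 0)"
  shows "c < y"
proof -
  define u0 where "u0 = map (\<lambda>x. x - 1) u"
  have u: "u = map (\<lambda>x. x + 1) u0"
    unfolding u0_def map_map
  proof (rule map_idI[symmetric])
    fix x assume "x \<in> set u"
    then have "x \<noteq> 0" using assms(2) by metis
    then show "((\<lambda>x. x + 1) \<circ> (\<lambda>x. x - 1)) x = x" by simp
  qed
  then have yu: "y # u = map (\<lambda>x. x + 1) ((y - 1) # u0)" using assms(1) by simp
  obtain x' where x': "x' \<le> y - 1"
    "\<forall>i. rl (Ptab ((y - 1) # u0)) i = rl (Ptab u0) i + (if i = x' then 1 else 0)"
    using prepend_box by blast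
  have "rl (Ptab (y # u)) c = rl (Ptab ((y - 1) # u0)) c" unfolding yu by (rule rl_shift)
  moreover have "rl (Ptab u) c = rl (Ptab u0) c" using rl_shift[of 1 u0 c] u by simp
  moreover have "rl (Ptab (y # u)) c = rl (Ptab u) c + 1" using i[of c] by simp
  moreover have "rl (Ptab ((y - 1) # u0)) c = rl (Ptab u0) c" if "c \<noteq> x'"
    using x'(2) that by simp
  ultimately have "c = x'" by force
  then show ?thesis using x'(1) assms(1) by simp
qed

text \<open>Complementary rows have a constant sum, so a change in row \<open>c\<close> forces one
  in row \<open>m + e - 1 - c\<close>. If \<open>c\<close> is an upper row, it is still at least
  \<open>mu\<close> and \<open>nu\<close> after losing its box, hence the strict bounds.\<close>

lemma LR_shape_two:
  assumes "LR_shape m e mu nu l1" "LR_shape m e mu nu l2" "c \<noteq> d"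
    "\<And>i. l1 i = l i + (if i = c then 1 else 0)" "\<And>i. l2 i = l i + (if i = d then 1 else 0)"
  shows "d = m + e - 1 - c \<and> (c < m \<and> c < e \<and> mu < l1 c \<and> nu < l1 c \<or> m \<le> c \<and> e \<le> c)"
proof -
  have l1: "l1 c = Suc (l2 c)" "l2 d = Suc (l1 d)" "\<And>i. i \<noteq> c \<Longrightarrow> i \<noteq> d \<Longrightarrow> l1 i = l2 i"
    using assms(3-5) by auto
  note ok = assms(1,2)[unfolded LR_shape_def]
  have c: "c < m + e"
  proof (rule ccontr)
    assume "\<not> c < m + e"
    then have "l1 c = 0" using ok by auto
    then show False using l1(1) by simp
  qed
  have "\<not> (e \<le> c \<and> c < m)" "\<not> (m \<le> c \<and> c < e)" using ok l1(1) by force+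
  then consider (lo) "c < m" "c < e" | (hi) "m \<le> c" "e \<le> c" by linarith
  then show ?thesis
  proof cases
    case lo
    have "l1 c + l1 (m + e - 1 - c) = l2 c + l2 (m + e - 1 - c)" using ok lo by auto
    then have "l2 (m + e - 1 - c) = Suc (l1 (m + e - 1 - c))" using l1(1) by simp
    moreover from this have "m + e - 1 - c \<noteq> c" using l1(1) by auto
    ultimately have "m + e - 1 - c = d" using l1(3)[of "m + e - 1 - c"] by fastforce
    moreover have "mu \<le> l2 c" "nu \<le> l2 c" using ok lo by auto
    ultimately show ?thesis using lo l1(1) by auto
  next
    case hi
    let ?i = "m + e - 1 - c"
    have i: "?i < m" "?i < e" "m + e - 1 - ?i = c" using hi c by auto
    have "l1 ?i + l1 c = l2 ?i + l2 c" using ok i by metis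
    then have "l2 ?i = Suc (l1 ?i)" using l1(1) by simp
    moreover from this have "?i \<noteq> c" using l1(1) by auto
    ultimately have "?i = d" using l1(3)[of ?i] by fastforce
    then show ?thesis using hi by auto
  qed
qed

lemma pat_subset: "pat B u v \<Longrightarrow> set u \<subseteq> B \<Longrightarrow> set v \<subseteq> B"
  unfolding pat_def by (induction u v rule: list_all2_induct) auto

section \<open>The box moved by the cyclage of two rectangles\<close>

context two_rect
begin

lemma W2_LR_shape: "W2 m e mu nu w \<Longrightarrow> LR_shape m e mu nu (rl (Ptab w))"
  by (rule LR_imp_shape[OF column_strict_Ptab]) (simp add: W2_Ptab)

text \<open>The block of \<open>x\<close> is promoted by \<open>Blk_promote\<close>; the subword on
  the other block does not change.\<close>

lemma chi2_W2:
  assumes W: "W2 m e mu nu (u @ [x])" shows "W2 m e mu nu (chi2 m e u x)"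
proof -
  have x: "0 < x" "x \<le> m + e" and su: "set u \<subseteq> {1..m + e}" using W by (auto simp: W2_def)
  have B: "Blk 0 m mu (u @ [x])" "Blk m e nu (u @ [x])" using W W2_Blk by auto
  have sub: "set (act_gens rs u) \<subseteq> {1..m + e}" if "\<And>r. r \<in> set rs \<Longrightarrow> 1 \<le> r \<and> Suc r \<le> m + e" for rs
  proof -
    have "pat {1..m + e} u (act_gens rs u)" by (rule act_gens_pat) (use that in force)
    then show ?thesis using su by (rule pat_subset)
  qed
  have other: "Blk o' h' mu' (y # act_gens rs u)" if "Blk o' h' mu' (u @ [x])"
    "x \<notin> {o' + 1..o' + h'}" "y \<notin> {o' + 1..o' + h'}"
    "\<And>r. r \<in> set rs \<Longrightarrow> r \<in> - {o' + 1..o' + h'} \<and> Suc r \<in> - {o' + 1..o' + h'}" for o' h' mu' y rs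
  proof -
    have "filter (\<lambda>x. x \<in> {o' + 1..o' + h'}) (act_gens rs u) = filter (\<lambda>x. x \<in> {o' + 1..o' + h'}) u"
      by (rule pat_filter[OF pat_sym[OF act_gens_pat[OF that(4)]]]) auto
    then have "filter (\<lambda>x. x \<in> {o' + 1..o' + h'}) (y # act_gens rs u) =
        filter (\<lambda>x. x \<in> {o' + 1..o' + h'}) (u @ [x])"
      using that(2,3) by simp
    from Blk_filter[OF this] show ?thesis using that(1) by simp
  qed
  show ?thesis
  proof (cases "x \<le> m")
    case True
    have "Blk 0 m mu (m # act_gens (rev_word 0 m) u)" using Blk_promote[OF pos(3) B(1)] x True by simp
    moreover have "Blk m e nu (m # act_gens (rev_word 0 m) u)"
      by (rule other[OF B(2)]) (use True in \<open>auto dest!: set_rev_word\<close>)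
    moreover have "set (act_gens (rev_word 0 m) u) \<subseteq> {1..m + e}"
      by (rule sub) (auto dest!: set_rev_word)
    ultimately show ?thesis using True pos by (simp add: W2_Blk chi2_def)
  next
    case False
    have "Blk m e nu ((m + e) # act_gens (rev_word m e) u)" using Blk_promote[OF pos(4) B(2)] x False by simp
    moreover have "Blk 0 m mu ((m + e) # act_gens (rev_word m e) u)"
      by (rule other[OF B(1)]) (use False pos in \<open>auto dest!: set_rev_word\<close>)
    moreover have "set (act_gens (rev_word m e) u) \<subseteq> {1..m + e}"
      by (rule sub) (auto dest!: set_rev_word)
    ultimately show ?thesis using False pos by (simp add: W2_Blk chi2_def)
  qed
qed

text \<open>If \<open>x \<le> m\<close>, then \<open>x = 1\<close> is inserted behind at most
  \<open>mu - 1\<close> letters \<open>1\<close>, and the prepended \<open>m\<close> adds its box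
  above row \<open>m\<close>. Otherwise \<open>x = m + 1\<close>, and the letters along its bumping
  path increase within \<open>m + e\<close>, so the path ends in the first \<open>e\<close> rows;
  the prepended \<open>m + e\<close> is maximal and ends in the first \<open>nu\<close>
  columns.\<close>

lemma chi2_boxes:
  assumes W: "W2 m e mu nu (u @ [x])"
    and c: "\<And>i. rl (Ptab (u @ [x])) i = rl (Ptab u) i + (if i = c then 1 else 0)"
    and c': "\<And>i. rl (Ptab (chi2 m e u x)) i = rl (Ptab u) i + (if i = c' then 1 else 0)"
  shows "x \<le> m \<and> rl (Ptab (u @ [x])) c \<le> mu \<and> c' < m \<or>
    m < x \<and> c < e \<and> rl (Ptab (chi2 m e u x)) c' \<le> nu"
proof -
  have x: "0 < x" "x \<le> m + e" and su: "set u \<subseteq> {1..m + e}" using W by (auto simp: W2_def)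
  have B: "Blk 0 m mu (u @ [x])" "Blk m e nu (u @ [x])" using W W2_Blk by auto
  obtain d where d: "\<And>i. rl (Ptab (u @ [x])) i = rl (Ptab u) i + (if i = d then 1 else 0)"
    "rl (Ptab (u @ [x])) d \<le> Suc (cnt x (if Ptab u = [] then [] else hd (Ptab u)))"
    "\<And>n. x \<le> n \<Longrightarrow> (\<forall>y\<in>set u. y \<le> n) \<Longrightarrow> d + x \<le> n"
    using snoc_box[of u x] by blast
  have "d = c" using c[of c] d(1)[of c] by (auto split: if_splits)
  have Wc: "W2 m e mu nu (chi2 m e u x)" by (rule chi2_W2[OF W])
  show ?thesis
  proof (cases "x \<le> m")
    case True
    then have x1: "x = 1" using Blk_last[OF B(1)] x by simp
    let ?r = "if Ptab u = [] then [] else hd (Ptab u)"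
    have sub: "set ?r \<subseteq> set (tword (Ptab u))" by (cases "Ptab u") auto
    have "cnt 0 ?r = 0" by (rule cnt_none) (use sub su in \<open>auto simp: set_Ptab\<close>)
    then have "cnt 1 ?r = count_list ?r 1" using cnt_Suc[of 0 ?r] by simp
    also have "\<dots> \<le> count_list (tword (Ptab u)) 1" by (cases "Ptab u") auto
    also have "\<dots> = mu - 1" using B(1) x1 True by (auto simp: count_Ptab Blk_def)
    finally have A: "rl (Ptab (u @ [x])) c \<le> mu" using d(2) \<open>d = c\<close> x1 pos by simp
    define u' where "u' = act_gens (rev_word 0 m) u"
    have ch: "chi2 m e u x = m # u'" using True by (simp add: chi2_def u'_def)
    have "c' < m"
    proof (rule prepend_row[OF pos(1)])
      show "0 \<notin> set u'" using Wc unfolding ch W2_def by auto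
      have "rl (Ptab u') i = rl (Ptab u) i" for i
        unfolding u'_def by (rule rl_cong[OF Qs_shape[OF Qs_sym[OF act_gens_Qs]]])
      then show "rl (Ptab (m # u')) i = rl (Ptab u') i + (if i = c' then 1 else 0)" for i
        using c' ch by simp
    qed
    then show ?thesis using A True by simp
  next
    case False
    then have x1: "x = Suc m" using Blk_last[OF B(2)] x by simp
    have "\<forall>y\<in>set u. y \<le> m + e" using su by auto
    then have "c + x \<le> m + e" using d(3) x(2) \<open>d = c\<close> by simp
    then have A: "c < e" using x1 by simp
    define u' where "u' = act_gens (rev_word m e) u"
    have ch: "chi2 m e u x = (m + e) # u'" using False by (simp add: chi2_def u'_def)
    have "rl (Ptab u') i = rl (Ptab u) i" for i
      unfolding u'_def by (rule rl_cong[OF Qs_shape[OF Qs_sym[OF act_gens_Qs]]])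
    then have "rl (Ptab ((m + e) # u')) c' \<le> Suc (count_list u' (m + e))"
      using Wc c' unfolding ch by (intro prepend_max) (auto simp: W2_def)
    moreover have "count_list ((m + e) # u') (m + e) = nu"
    proof -
      have "m < m + e \<and> m + e \<le> m + e" using pos by simp
      then show ?thesis using Wc unfolding ch W2_def by blast
    qed
    ultimately show ?thesis using A ch False by simp
  qed
qed

text \<open>When a second admissible shape covers that of \<open>u\<close>, cyclage selects it: if
  the box stayed in row \<open>c\<close>, both alternatives of \<open>chi2_boxes\<close> would
  contradict both alternatives of \<open>LR_shape_two\<close>.\<close>

lemma chi2_moves:
  assumes W: "W2 m e mu nu (u @ [x])"
    and c: "\<And>i. rl (Ptab (u @ [x])) i = rl (Ptab u) i + (if i = c then 1 else 0)"
    and c': "\<And>i. rl (Ptab (chi2 m e u x)) i = rl (Ptab u) i + (if i = c' then 1 else 0)"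
    and d: "LR_shape m e mu nu k" "\<And>i. k i = rl (Ptab u) i + (if i = d then 1 else 0)" "d \<noteq> c"
  shows "c' = d"
proof -
  have ok: "LR_shape m e mu nu (rl (Ptab (u @ [x])))" "LR_shape m e mu nu (rl (Ptab (chi2 m e u x)))"
    using W2_LR_shape W chi2_W2 by auto
  have 1: "d = m + e - 1 - c" "c < m \<and> c < e \<and> mu < rl (Ptab (u @ [x])) c \<and> nu < rl (Ptab (u @ [x])) c \<or> m \<le> c \<and> e \<le> c"
    using LR_shape_two[OF ok(1) d(1) _ c d(2)] d(3) by auto
  have "c' \<noteq> c"
  proof
    assume "c' = c"
    then have "rl (Ptab (chi2 m e u x)) c' = rl (Ptab (u @ [x])) c" using c c' by simp
    then show False using 1(2) chi2_boxes[OF W c c'] \<open>c' = c\<close> by auto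
  qed
  then show ?thesis using LR_shape_two[OF ok(1) ok(2) _ c c'] 1(1) by auto
qed

end

lemma chi2_form: "\<exists>y rs. chi2 m e u x = y # act_gens rs u"
  by (cases "x \<le> m") (simp add: chi2_def; blast)+

lemma chi2_box:
  obtains c' where "\<And>i. rl (Ptab (chi2 m e u x)) i = rl (Ptab u) i + (if i = c' then 1 else 0)"
proof -
  obtain y rs where ch: "chi2 m e u x = y # act_gens rs u" using chi2_form by blast
  obtain c' where "\<And>i. rl (Ptab (y # act_gens rs u)) i = rl (Ptab (act_gens rs u)) i + (if i = c' then 1 else 0)"
    using prepend_box[of y "act_gens rs u"] by blast
  moreover have "rl (Ptab (act_gens rs u)) i = rl (Ptab u) i" for i
    by (rule rl_cong[OF Qs_shape[OF Qs_sym[OF act_gens_Qs]]])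
  ultimately show thesis using that[of c'] ch by simp
qed

lemma chi2_Qs:
  assumes "two_rect m e mu nu" and W: "W2 m e mu nu (u @ [x])" and W': "W2 e m nu mu (v @ [y])"
    and Q: "Qs (u @ [x]) (v @ [y])"
  shows "Qs (chi2 m e u x) (chi2 e m v y)"
proof -
  interpret A: two_rect m e mu nu by fact
  interpret B: two_rect e m nu mu by unfold_locales (rule A.pos)+
  have uv: "Qs u v" "shape (Ptab (u @ [x])) = shape (Ptab (v @ [y]))" using Q Qs_snoc by auto
  have rluv: "rl (Ptab u) i = rl (Ptab v) i" "rl (Ptab (u @ [x])) i = rl (Ptab (v @ [y])) i" for i
    using rl_cong[OF Qs_shape[OF uv(1)]] rl_cong[OF uv(2)] by auto
  obtain c where c: "\<And>i. rl (Ptab (u @ [x])) i = rl (Ptab u) i + (if i = c then 1 else 0)"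
    using snoc_box[of u x] by metis
  have cv: "rl (Ptab (v @ [y])) i = rl (Ptab v) i + (if i = c then 1 else 0)" for i
    using c rluv by simp
  obtain c1 where c1: "\<And>i. rl (Ptab (chi2 m e u x)) i = rl (Ptab u) i + (if i = c1 then 1 else 0)"
    using chi2_box[of m e u x] by metis
  obtain c2 where c2: "\<And>i. rl (Ptab (chi2 e m v y)) i = rl (Ptab v) i + (if i = c2 then 1 else 0)"
    using chi2_box[of e m v y] by metis
  have c1v: "rl (Ptab (chi2 m e u x)) i = rl (Ptab v) i + (if i = c1 then 1 else 0)" for i
    using c1 rluv by simp
  have c2u: "rl (Ptab (chi2 e m v y)) i = rl (Ptab u) i + (if i = c2 then 1 else 0)" for i
    using c2 rluv by simp
  have ok1: "LR_shape e m nu mu (rl (Ptab (chi2 m e u x)))"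
    using A.W2_LR_shape[OF A.chi2_W2[OF W]] LR_shape_commute by blast
  have ok2: "LR_shape m e mu nu (rl (Ptab (chi2 e m v y)))"
    using B.W2_LR_shape[OF B.chi2_W2[OF W']] LR_shape_commute by blast
  \<comment> \<open>If \<open>c1\<close> differs from \<open>c\<close>, it is a second choice for
    the word with exchanged rectangles as well, whose cyclage must then take it; likewise with the
    roles reversed.\<close>
  have "c1 = c2"
  proof (cases "c1 = c")
    case False
    then show ?thesis using B.chi2_moves[OF W' cv c2 ok1 c1v] by simp
  next
    case True
    then show ?thesis using A.chi2_moves[OF W c c1 ok2 c2u] by (cases "c2 = c") auto
  qed
  then have "shape (Ptab (chi2 m e u x)) = shape (Ptab (chi2 e m v y))"
    using shape_eq_iff[OF column_strict_Ptab column_strict_Ptab] c1v c2 by simp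
  moreover obtain y1 rs1 where ch1: "chi2 m e u x = y1 # act_gens rs1 u" using chi2_form by blast
  moreover obtain y2 rs2 where ch2: "chi2 e m v y = y2 # act_gens rs2 v" using chi2_form by blast
  moreover have "Qs (act_gens rs1 u) (act_gens rs2 v)"
    by (rule Qs_trans[OF Qs_sym[OF act_gens_Qs] Qs_trans[OF uv(1) act_gens_Qs]])
  ultimately show ?thesis using Qs_Cons by simp
qed

section \<open>The switching map on two rectangles\<close>

lemma W2_Wset: "two_rect m e mu nu \<Longrightarrow> w \<in> Wset [(m, mu), (e, nu)] \<longleftrightarrow> W2 m e mu nu w"
proof -
  assume "two_rect m e mu nu"
  then interpret two_rect m e mu nu .
  have Y: "Ytab [(m, mu), (e, nu)] 0 = rect 0 m mu" "Ytab [(m, mu), (e, nu)] (Suc 0) = rect m e nu"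
    by (simp_all add: Ytab_def rect_def offs_def)
  have b: "blk [(m, mu), (e, nu)] 0 = {0 + 1..0 + m}" "blk [(m, mu), (e, nu)] (Suc 0) = {m + 1..m + e}"
    by (simp_all add: blk_def offs_def)
  have all: "(\<forall>i<length [(m, mu), (e, nu)]. P i) \<longleftrightarrow> P 0 \<and> P (Suc 0)" for P
    by (auto simp: less_Suc_eq)
  have t: "total [(m, mu), (e, nu)] = m + e" by (simp add: total_def)
  show ?thesis
    unfolding Wset_def mem_Collect_eq all Y b t W2_Blk block_iff[OF pos(3)] block_iff[OF pos(4)] Blk_def ..
qed

context two_rect
begin

text \<open>Uniqueness of the tableau for its shape and injectivity of the correspondence resolve
  the two definite descriptions, so an image is verified by exhibiting a word of the exchanged kind
  with the same recording tableau.\<close>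

lemma tau_word2_eq:
  assumes W: "W2 m e mu nu w" and W': "W2 e m nu mu v" and Q: "Qs v w"
  shows "tau_word2 (m, mu) (e, nu) w = v"
proof -
  interpret B: two_rect e m nu mu by unfold_locales (rule pos)+
  have mem: "T \<in> LRT (shape (Ptab w)) [(e, nu), (m, mu)] \<longleftrightarrow>
      column_strict T \<and> shape T = shape (Ptab v) \<and> W2 e m nu mu (tword T)" for T
    unfolding LRT_def using W2_Wset[OF B.two_rect_axioms] Qs_shape[OF Q] by simp
  have "tau_tab2 (m, mu) (e, nu) (Ptab w) = Ptab v"
    unfolding tau_tab2_def
  proof (rule the_equality)
    show "Ptab v \<in> LRT (shape (Ptab w)) [(e, nu), (m, mu)]" using W' by (simp add: mem W2_Ptab)
    show "T = Ptab v" if "T \<in> LRT (shape (Ptab w)) [(e, nu), (m, mu)]" for T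
      using that W' B.LR_unique[of T "Ptab v"] by (simp add: mem W2_Ptab)
  qed
  then show ?thesis
    unfolding tau_word2_def
  proof (intro the_equality)
    assume t: "tau_tab2 (m, mu) (e, nu) (Ptab w) = Ptab v"
    show "Ptab v = tau_tab2 (m, mu) (e, nu) (Ptab w) \<and> Qtab v = Qtab w"
      using t Q Qtab_eq_iff by simp
    fix w' assume "Ptab w' = tau_tab2 (m, mu) (e, nu) (Ptab w) \<and> Qtab w' = Qtab w"
    then have "Ptab w' = Ptab v" "Qs w' w" using t Qtab_eq_iff by auto
    then show "w' = v" using rsk_inj[of w' v] Qs_trans[OF _ Qs_sym[OF Q]] by blast
  qed
qed

lemma tau_word2:
  assumes W: "W2 m e mu nu w"
  shows "W2 e m nu mu (tau_word2 (m, mu) (e, nu) w)" "Qs (tau_word2 (m, mu) (e, nu) w) w"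
proof -
  interpret B: two_rect e m nu mu by unfold_locales (rule pos)+
  have "LR_shape e m nu mu (rl (Ptab w))" using W2_LR_shape[OF W] LR_shape_commute by blast
  then obtain T where T: "column_strict T" "shape T = shape (Ptab w)" "W2 e m nu mu (tword T)"
    using B.LR_exists[OF column_strict_Ptab] by blast
  obtain v where v: "Ptab v = T" "Qs v w" using ex_word[OF T(1,2)] by blast
  have "W2 e m nu mu v" using T(3) v(1) W2_Ptab by blast
  with tau_word2_eq[OF W this v(2)] v(2)
  show "W2 e m nu mu (tau_word2 (m, mu) (e, nu) w)" "Qs (tau_word2 (m, mu) (e, nu) w) w" by auto
qed

lemma tau_chi2:
  assumes W: "W2 m e mu nu (u @ [x])" and t: "tau_word2 (m, mu) (e, nu) (u @ [x]) = v @ [y]"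
  shows "tau_word2 (m, mu) (e, nu) (chi2 m e u x) = chi2 e m v y"
proof (rule tau_word2_eq)
  interpret B: two_rect e m nu mu by unfold_locales (rule pos)+
  have W': "W2 e m nu mu (v @ [y])" and Q: "Qs (v @ [y]) (u @ [x])" using tau_word2[OF W] t by auto
  show "W2 m e mu nu (chi2 m e u x)" by (rule chi2_W2[OF W])
  show "W2 e m nu mu (chi2 e m v y)" by (rule B.chi2_W2[OF W'])
  show "Qs (chi2 e m v y) (chi2 m e u x)"
    by (rule Qs_sym[OF chi2_Qs[OF two_rect_axioms W W' Qs_sym[OF Q]]])
qed

end

section \<open>Cyclage as promotion of one block\<close>

lemma offs_Suc: "i < length R \<Longrightarrow> offs R (Suc i) = offs R i + fst (R ! i)"
  by (simp add: offs_def take_Suc_conv_app_nth)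

lemma offs_mono: "i \<le> j \<Longrightarrow> offs R i \<le> offs R j"
proof -
  have "offs R k \<le> offs R (Suc k)" for k
    using offs_Suc[of k R] by (cases "k < length R") (auto simp: offs_def)
  then show "i \<le> j \<Longrightarrow> offs R i \<le> offs R j" by (rule lift_Suc_mono_le)
qed

lemma offs_length: "offs R (length R) = total R"
  by (simp add: offs_def total_def)

lemma blk_disjoint_less: "i < j \<Longrightarrow> j < length R \<Longrightarrow> blk R i \<inter> blk R j = {}"
  using offs_mono[of "Suc i" j R] offs_Suc[of i R] by (auto simp: blk_def)

lemma blk_disjoint: "i \<noteq> j \<Longrightarrow> i < length R \<Longrightarrow> j < length R \<Longrightarrow> blk R i \<inter> blk R j = {}"
  using blk_disjoint_less[of i j R] blk_disjoint_less[of j i R] by (cases i j rule: linorder_cases) auto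

lemma blk_total: "i < length R \<Longrightarrow> blk R i \<subseteq> {1..total R}"
  using offs_mono[of "Suc i" "length R" R] offs_Suc[of i R] offs_length[of R] by (auto simp: blk_def)

lemma total_blk: "k \<in> {1..total R} \<Longrightarrow> \<exists>i<length R. k \<in> blk R i"
proof -
  have "\<exists>i<j. k \<in> blk R i" if "1 \<le> k" "k \<le> offs R j" "j \<le> length R" for j
    using that
  proof (induction j)
    case (Suc j)
    show ?case
    proof (cases "k \<le> offs R j")
      case True
      then show ?thesis using Suc by (meson Suc_leD less_SucI)
    next
      case False
      then have "k \<in> blk R j" using Suc.prems offs_Suc[of j R] by (auto simp: blk_def)
      then show ?thesis by blast
    qed
  qed (simp add: offs_def)
  then show "k \<in> {1..total R} \<Longrightarrow> \<exists>i<length R. k \<in> blk R i" using offs_length by auto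
qed

lemma w0R_eq:
  assumes "i < length R" "k \<in> blk R i" shows "w0R R k = 2 * offs R i + fst (R ! i) + 1 - k"
proof -
  have "(THE i. i < length R \<and> k \<in> blk R i) = i"
    by (rule the_equality) (use assms blk_disjoint in blast)+
  then show ?thesis unfolding w0R_def using assms by auto
qed

definition rv :: "(nat \<times> nat) list \<Rightarrow> nat \<Rightarrow> nat list" where
  "rv R i = rev_word (offs R i) (fst (R ! i))"

lemma set_rv: "r \<in> set (rv R i) \<Longrightarrow> r \<in> blk R i \<and> Suc r \<in> blk R i"
  by (auto simp: rv_def blk_def dest!: set_rev_word)

lemma gens_prod_rv:
  "gens_prod (rv R i) k = (if k \<in> blk R i then 2 * offs R i + fst (R ! i) + 1 - k else k)"
  by (auto simp: rv_def blk_def gens_prod_rev_word)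

lemma gens_prod_blocks:
  "j \<le> length R \<Longrightarrow> (\<forall>i<j. k \<in> blk R i \<longrightarrow> gens_prod (concat (map (rv R) [0..<j])) k = 2 * offs R i + fst (R ! i) + 1 - k) \<and>
     ((\<forall>i<j. k \<notin> blk R i) \<longrightarrow> gens_prod (concat (map (rv R) [0..<j])) k = k)"
proof (induction j arbitrary: k)
  case (Suc j)
  have g: "gens_prod (concat (map (rv R) [0..<Suc j])) k =
      gens_prod (concat (map (rv R) [0..<j])) (gens_prod (rv R j) k)"
    by (simp add: gens_prod_append)
  have dis: "k \<notin> blk R i" if "k \<in> blk R j" "i < j" for k i
    using blk_disjoint[of i j R] that Suc.prems by auto
  show ?case
  proof (cases "k \<in> blk R j")
    case True
    let ?k = "2 * offs R j + fst (R ! j) + 1 - k"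
    have "?k \<in> blk R j" using True by (auto simp: blk_def)
    then have "gens_prod (concat (map (rv R) [0..<Suc j])) k = ?k"
      using g True Suc.IH[of ?k] Suc.prems dis by (simp add: gens_prod_rv)
    then show ?thesis using True dis by (auto simp: less_Suc_eq)
  next
    case False
    then show ?thesis using g Suc.IH[of k] Suc.prems by (auto simp: gens_prod_rv less_Suc_eq)
  qed
qed simp

text \<open>Replaces the chosen word of \<open>act_perm\<close> by the concatenated words for the
  longest elements of the blocks.\<close>

lemma act_w0R: "act_perm (total R) (w0R R) u = act_gens (concat (map (rv R) [0..<length R])) u"
proof (rule act_perm_eq)
  show "set (concat (map (rv R) [0..<length R])) \<subseteq> {1..<total R}"
    using blk_total set_rv by fastforce
  show "gens_prod (concat (map (rv R) [0..<length R])) = w0R R"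
  proof
    fix k
    show "gens_prod (concat (map (rv R) [0..<length R])) k = w0R R k"
      using gens_prod_blocks[of "length R" R k] w0R_eq[of _ R k]
      by (cases "\<exists>i<length R. k \<in> blk R i") (auto simp: w0R_def)
  qed
qed

abbreviation BlkR :: "(nat \<times> nat) list \<Rightarrow> nat \<Rightarrow> nat list \<Rightarrow> bool" where
  "BlkR R i \<equiv> Blk (offs R i) (fst (R ! i)) (snd (R ! i))"

lemma Wset_iff:
  assumes "\<forall>(eta, mu)\<in>set R. 0 < eta \<and> 0 < mu"
  shows "w \<in> Wset R \<longleftrightarrow> set w \<subseteq> {1..total R} \<and> (\<forall>i<length R. BlkR R i w)"
proof -
  have "knuth_equiv (filter (\<lambda>x. x \<in> blk R i) w) (tword (Ytab R i)) \<longleftrightarrow> BlkR R i w" if "i < length R" for i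
  proof -
    have "0 < snd (R ! i)" using assms nth_mem[OF that] by fastforce
    from block_iff[OF this] show ?thesis
      unfolding Blk_def blk_def by (simp add: Ytab_def rect_def)
  qed
  then show ?thesis unfolding Wset_def by auto
qed

lemma BlkR_cong:
  "filter (\<lambda>x. x \<in> blk R i) u = filter (\<lambda>x. x \<in> blk R i) v \<Longrightarrow> BlkR R i u = BlkR R i v"
  by (rule Blk_filter) (simp add: blk_def)

lemma act_blocks_fix: "(\<And>j. j \<in> set js \<Longrightarrow> BlkR R j v) \<Longrightarrow> act_gens (concat (map (rv R) js)) v = v"
proof (induction js)
  case (Cons j js)
  have "BlkR R j v" using Cons.prems by simp
  then have "act_gens (rv R j) v = v" unfolding rv_def by (rule Blk_act_fix)
  then show ?case using Cons by (simp add: act_gens_append)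
qed simp

lemma act_rv_filter: "blk R i \<inter> C = {} \<Longrightarrow> filter (\<lambda>x. x \<in> C) (act_gens (rv R i) u) = filter (\<lambda>x. x \<in> C) u"
  using pat_filter[OF act_gens_pat[of "rv R i" "blk R i" u]] set_rv by metis

text \<open>The blocks not containing \<open>x\<close> keep all their letters when \<open>x\<close>
  is removed, so their longest elements act trivially, before and after block \<open>i\<close> is
  moved.\<close>

lemma chi_eq:
  assumes R: "\<forall>(eta, mu)\<in>set R. 0 < eta \<and> 0 < mu" and W: "u @ [x] \<in> Wset R"
    and i: "i < length R" "x \<in> blk R i"
  shows "chi R (u @ [x]) = (offs R i + fst (R ! i)) # act_gens (rv R i) u"
proof -
  have B: "BlkR R j (u @ [x])" if "j < length R" for j using W Wset_iff[OF R] that by auto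
  have Bu: "BlkR R j u" if "j < length R" "j \<noteq> i" for j
  proof -
    have "x \<notin> blk R j" using blk_disjoint[of i j R] i that by auto
    then have "filter (\<lambda>x. x \<in> blk R j) u = filter (\<lambda>x. x \<in> blk R j) (u @ [x])" by simp
    then show ?thesis using BlkR_cong B[OF that(1)] by blast
  qed
  have Bv: "BlkR R j (act_gens (rv R i) u)" if "j < length R" "j \<noteq> i" for j
    using BlkR_cong[OF act_rv_filter[OF blk_disjoint[OF that(2)[symmetric] i(1) that(1)]]] Bu[OF that] by blast
  have idx: "[0..<length R] = [0..<i] @ i # [Suc i..<length R]"
    using i(1) upt_add_eq_append[of 0 i "length R - i"] by (simp add: upt_conv_Cons)
  have "act_perm (total R) (w0R R) u = act_gens (rv R i) u"
  proof -
    have 1: "act_gens (concat (map (rv R) [Suc i..<length R])) u = u"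
      by (rule act_blocks_fix) (use Bu in auto)
    have 2: "act_gens (concat (map (rv R) [0..<i])) (act_gens (rv R i) u) = act_gens (rv R i) u"
      by (rule act_blocks_fix) (use Bv i(1) in auto)
    show ?thesis unfolding act_w0R idx by (simp add: act_gens_append 1 2)
  qed
  moreover have "act_perm (total R) (w0R R) [x] = [offs R i + fst (R ! i)]"
  proof -
    have "x = Suc (offs R i)" using Blk_last[OF B[OF i(1)]] i(2) by (auto simp: blk_def)
    moreover have "gens_prod (concat (map (rv R) [0..<length R])) x = 2 * offs R i + fst (R ! i) + 1 - x"
      using gens_prod_blocks[of "length R" R x] i by blast
    ultimately show ?thesis unfolding act_w0R act_gens_single by simp
  qed
  ultimately show ?thesis by (simp add: chi_def)
qed

section \<open>Switching adjacent rectangles\<close>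

lemma fill_pos_letters:
  "length vs = length (filter (\<lambda>x. x \<in> B) w) \<Longrightarrow> set vs \<subseteq> B \<Longrightarrow>
     pat B w (fill_pos {i. i < length w \<and> w ! i \<in> B} w vs) \<and>
     filter (\<lambda>x. x \<in> B) (fill_pos {i. i < length w \<and> w ! i \<in> B} w vs) = vs"
proof (induction w arbitrary: vs)
  case (Cons x w)
  let ?S = "{i. i < length (x # w) \<and> (x # w) ! i \<in> B}"
  have S: "{i. Suc i \<in> ?S} = {i. i < length w \<and> w ! i \<in> B}" by auto
  have 0: "0 \<in> ?S \<longleftrightarrow> x \<in> B" by simp
  have "0 \<in> ?S \<longrightarrow> vs \<noteq> []" unfolding 0 using Cons.prems(1) by auto
  note f = fill_pos_Cons[OF this, of x w, unfolded S 0]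
  show ?case
  proof (cases "x \<in> B")
    case True
    then obtain v vs' where vs: "vs = v # vs'" using Cons.prems(1) by (cases vs) auto
    show ?thesis unfolding f using Cons.IH[of vs'] Cons.prems True vs by (simp add: pat_def)
  next
    case False
    show ?thesis unfolding f using Cons.IH[of vs] Cons.prems False by (simp add: pat_def)
  qed
qed (simp add: pat_def)

text \<open>Both words have their letters of \<open>C\<close> at the same positions, so equal
  subwords on \<open>C\<close> make these letters equal one by one.\<close>

lemma pat_split:
  assumes "list_all2 (\<lambda>x y. x = y \<or> x \<in> B \<and> y \<in> B \<or> x \<in> C \<and> y \<in> C) u v" "B \<inter> C = {}"
    "filter (\<lambda>x. x \<in> C) u = filter (\<lambda>x. x \<in> C) v"
  shows "pat B u v"
  using assms(1,3) unfolding pat_def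
  by (induction u v rule: list_all2_induct) (use assms(2) in \<open>auto split: if_splits\<close>)

lemma pat_snoc: "pat B (u @ [x]) w \<Longrightarrow> \<exists>v y. w = v @ [y] \<and> pat B u v \<and> (x = y \<or> x \<in> B \<and> y \<in> B)"
  unfolding pat_def by (auto simp: list_all2_append1 list_all2_Cons1)

lemma Blk_shift: "Blk (off + d) h mu (map (\<lambda>x. x + d) w) = Blk off h mu w"
proof -
  have c: "count_list (map (\<lambda>x. x + d) w) (k + d) = count_list w k" for k by (induction w) auto
  have "(\<forall>k. off + d < k \<and> k \<le> off + d + h \<longrightarrow> P k) \<longleftrightarrow> (\<forall>k. off < k \<and> k \<le> off + h \<longrightarrow> P (k + d))" for P
  proof
    assume L: "\<forall>k. off < k \<and> k \<le> off + h \<longrightarrow> P (k + d)"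
    show "\<forall>k. off + d < k \<and> k \<le> off + d + h \<longrightarrow> P k"
    proof (intro allI impI)
      fix k assume "off + d < k \<and> k \<le> off + d + h"
      then have "off < k - d \<and> k - d \<le> off + h" "k - d + d = k" by auto
      then show "P k" using L by metis
    qed
  qed simp
  moreover have "(\<forall>r. off + d < r \<and> Suc r \<le> off + d + h \<longrightarrow> P r) \<longleftrightarrow>
      (\<forall>r. off < r \<and> Suc r \<le> off + h \<longrightarrow> P (r + d))" for P
  proof
    assume L: "\<forall>r. off < r \<and> Suc r \<le> off + h \<longrightarrow> P (r + d)"
    show "\<forall>r. off + d < r \<and> Suc r \<le> off + d + h \<longrightarrow> P r"
    proof (intro allI impI)
      fix r assume "off + d < r \<and> Suc r \<le> off + d + h"
      then have "off < r - d \<and> Suc (r - d) \<le> off + h" "r - d + d = r" by auto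
      then show "P r" using L by metis
    qed
  qed simp
  ultimately show ?thesis unfolding Blk_def by (simp add: c epsA_shift)
qed

text \<open>The rectangles exchanged are at list positions \<open>q\<close> and
  \<open>Suc q\<close>, counted from \<open>0\<close>; the one-based index of the switch is
  therefore \<open>Suc q\<close>.\<close>

locale swap = two_rect +
  fixes R :: "(nat \<times> nat) list" and q :: nat
  assumes R: "\<forall>(eta, mu)\<in>set R. 0 < eta \<and> 0 < mu"
    and q: "Suc q < length R" "R ! q = (m, mu)" "R ! Suc q = (e, nu)"
begin

abbreviation "off \<equiv> offs R q"
abbreviation "B \<equiv> {off + 1..off + m + e}"
abbreviation "R' \<equiv> tauR (Suc q) R"
abbreviation "low w \<equiv> map (\<lambda>x. x - off) (filter (\<lambda>x. x \<in> B) w)"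

lemma off_p: "offs R (Suc q) = off + m"
  using offs_Suc[of q R] q by simp

lemma B: "blk R q \<union> blk R (Suc q) = B"
  using q off_p by (auto simp: blk_def)

lemma R'_nth: "R' ! i = (if i = q then (e, nu) else if i = Suc q then (m, mu) else R ! i)" "length R' = length R"
  using q by (auto simp: tauR_def nth_list_update)

lemma R'_pos: "\<forall>(eta, mu)\<in>set R'. 0 < eta \<and> 0 < mu"
proof -
  have "set R' = set R" unfolding tauR_def using set_swap[of q R "Suc q"] q(1) by simp
  then show ?thesis using R by simp
qed

lemma offs_R': "i \<le> length R \<Longrightarrow> offs R' i = (if i = Suc q then off + e else offs R i)"
proof (induction i rule: less_induct)
  case (less i)
  consider "i = 0" | "i = Suc q" | "i = Suc (Suc q)" | j where "i = Suc j" "j \<noteq> q" "j \<noteq> Suc q"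
    by (cases i) auto
  then show ?case
  proof cases
    case 1
    then show ?thesis by (simp add: offs_def)
  next
    case 2
    then show ?thesis using less.IH[of q] offs_Suc[of q R'] q R'_nth by simp
  next
    case 3
    have "offs R' (Suc q) = off + e" using 3 less.IH[of q] offs_Suc[of q R'] q R'_nth by simp
    then show ?thesis using 3 offs_Suc[of "Suc q" R'] offs_Suc[of "Suc q" R] off_p q R'_nth by simp
  next
    case 4
    then show ?thesis using less.IH[of j] less.prems offs_Suc[of j R'] offs_Suc[of j R] R'_nth by simp
  qed
qed

lemma blk_R': "i < length R \<Longrightarrow> i \<noteq> q \<Longrightarrow> i \<noteq> Suc q \<Longrightarrow> blk R' i = blk R i"
  using offs_R'[of i] R'_nth by (simp add: blk_def)

lemma blk_B: "i < length R \<Longrightarrow> i \<noteq> q \<Longrightarrow> i \<noteq> Suc q \<Longrightarrow> blk R i \<inter> B = {}"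
  using blk_disjoint[of i q R] blk_disjoint[of i "Suc q" R] q(1) unfolding B[symmetric] by auto

lemma total_R': "total R' = total R"
  using offs_R'[of "length R"] q(1) R'_nth(2) offs_length[of R] offs_length[of R'] by simp

lemma low_shift: "map (\<lambda>x. x + off) (low w) = filter (\<lambda>x. x \<in> B) w"
  unfolding map_map by (rule map_idI) auto

lemma low_eqI: "filter (\<lambda>x. x \<in> B) w = map (\<lambda>x. x + off) v \<Longrightarrow> low w = v"
  by (simp add: comp_def)

lemma low_W2: "W2 m e mu nu (low w) \<longleftrightarrow> Blk off m mu w \<and> Blk (off + m) e nu w"
  and low_W2': "W2 e m nu mu (low w) \<longleftrightarrow> Blk off e nu w \<and> Blk (off + e) m mu w"
proof -
  have sub: "Blk o' h' mu' (filter (\<lambda>x. x \<in> B) w) = Blk o' h' mu' w" if "off \<le> o'" "o' + h' \<le> off + m + e" for o' h' mu'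
  proof (rule Blk_filter)
    have "x \<in> {o' + 1..o' + h'} \<Longrightarrow> x \<in> B" for x using that by auto
    then show "filter (\<lambda>x. x \<in> {o' + 1..o' + h'}) (filter (\<lambda>x. x \<in> B) w) = filter (\<lambda>x. x \<in> {o' + 1..o' + h'}) w"
      by (subst filter_filter) (metis (no_types, lifting))
  qed
  have s: "set (low w) \<subseteq> {1..m + e}" "set (low w) \<subseteq> {1..e + m}" by auto
  have sh: "Blk k h mu' (low w) = Blk (k + off) h mu' (filter (\<lambda>x. x \<in> B) w)" for k h mu'
    using Blk_shift[of k off h mu' "low w"] unfolding low_shift by simp
  show "W2 m e mu nu (low w) \<longleftrightarrow> Blk off m mu w \<and> Blk (off + m) e nu w"
    unfolding W2_Blk sh using s sub[of off m mu] sub[of "off + m" e nu] by (simp add: add.commute)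
  show "W2 e m nu mu (low w) \<longleftrightarrow> Blk off e nu w \<and> Blk (off + e) m mu w"
    unfolding W2_Blk sh using s sub[of off e nu] sub[of "off + e" m mu] by (simp add: add.commute add.left_commute)
qed

lemma tauW_spec:
  assumes W: "W2 m e mu nu (low w)"
  shows "pat B w (tauW (Suc q) R w) \<and>
    filter (\<lambda>x. x \<in> B) (tauW (Suc q) R w) = map (\<lambda>x. x + off) (tau_word2 (m, mu) (e, nu) (low w))"
proof -
  let ?v = "tau_word2 (m, mu) (e, nu) (low w)"
  have "W2 e m nu mu ?v" "Qs ?v (low w)" using tau_word2[OF W] by auto
  then have v: "set ?v \<subseteq> {1..e + m}" "length ?v = length (low w)" by (auto simp: W2_def Qs_def)
  have t: "tauW (Suc q) R w = fill_pos {i. i < length w \<and> w ! i \<in> B} w (map (\<lambda>x. x + off) ?v)"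
    unfolding tauW_def Let_def diff_Suc_1 B q(2,3) ..
  have l: "length (map (\<lambda>x. x + off) ?v) = length (filter (\<lambda>x. x \<in> B) w)" using v(2) by simp
  have s: "set (map (\<lambda>x. x + off) ?v) \<subseteq> B" using v(1) by auto
  show ?thesis unfolding t by (rule fill_pos_letters[OF l s])
qed

text \<open>The form in which switched words are recognised: same letters outside the two blocks,
  prescribed subword on them.\<close>

lemma tauW_eqI:
  assumes "W2 m e mu nu (low w)" "pat B w y"
    "filter (\<lambda>x. x \<in> B) y = map (\<lambda>x. x + off) (tau_word2 (m, mu) (e, nu) (low w))"
  shows "tauW (Suc q) R w = y"
proof (rule pat_eq)
  show "pat B (tauW (Suc q) R w) y" using pat_trans[OF pat_sym assms(2)] tauW_spec[OF assms(1)] by blast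
  show "filter (\<lambda>x. x \<in> B) (tauW (Suc q) R w) = filter (\<lambda>x. x \<in> B) y"
    using tauW_spec[OF assms(1)] assms(3) by simp
qed

lemma Wset_low: "w \<in> Wset R \<Longrightarrow> W2 m e mu nu (low w)"
proof -
  assume "w \<in> Wset R"
  then have "BlkR R q w" "BlkR R (Suc q) w" using Wset_iff[OF R, of w] q(1) by auto
  then show ?thesis unfolding low_W2 by (simp add: q off_p)
qed

lemma tauW_Wset:
  assumes W: "w \<in> Wset R" shows "tauW (Suc q) R w \<in> Wset R'"
proof -
  let ?w = "tauW (Suc q) R w"
  have L: "W2 m e mu nu (low w)" by (rule Wset_low[OF W])
  have p: "pat B w ?w" using tauW_spec[OF L] by blast
  have "low ?w = tau_word2 (m, mu) (e, nu) (low w)" by (rule low_eqI) (use tauW_spec[OF L] in blast)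
  then have "W2 e m nu mu (low ?w)" using tau_word2(1)[OF L] by simp
  then have b: "Blk off e nu ?w" "Blk (off + e) m mu ?w" unfolding low_W2' by auto
  have "BlkR R' i ?w" if i: "i < length R" for i
  proof -
    consider "i = q" | "i = Suc q" | "i \<noteq> q" "i \<noteq> Suc q" by blast
    then show ?thesis
    proof cases
      case 3
      have "filter (\<lambda>x. x \<in> blk R i) w = filter (\<lambda>x. x \<in> blk R i) ?w"
        by (rule pat_filter[OF p]) (use blk_B[OF i 3] in blast)
      then have "BlkR R i ?w" using BlkR_cong W Wset_iff[OF R] i by blast
      then show ?thesis using 3 R'_nth offs_R'[of i] i by simp
    qed (use b q R'_nth offs_R'[of i] i in simp_all)
  qed
  moreover have "set ?w \<subseteq> {1..total R}"
  proof (rule pat_subset[OF pat_mono[OF p]])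
    show "B \<subseteq> {1..total R}" unfolding B[symmetric] using blk_total[of q R] blk_total[of "Suc q" R] q by auto
    show "set w \<subseteq> {1..total R}" using W Wset_iff[OF R] by blast
  qed
  ultimately show ?thesis unfolding Wset_iff[OF R'_pos] total_R' R'_nth(2) by blast
qed

text \<open>Cyclage preserves the subword on \<open>B\<close>, and switching preserves the subword
  on the block of \<open>x\<close>. What remains is to see that the letters of both kinds sit at
  corresponding positions.\<close>

lemma chi_outside:
  assumes W: "u @ [x] \<in> Wset R" and i: "i < length R" "x \<in> blk R i" "i \<noteq> q" "i \<noteq> Suc q"
  shows "chi R' (tauW (Suc q) R (u @ [x])) = tauW (Suc q) R (chi R (u @ [x]))"
proof -
  let ?w = "tauW (Suc q) R (u @ [x])"
  let ?C = "blk R i"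
  have C: "?C \<inter> B = {}" by (rule blk_B[OF i(1,3,4)])
  have L: "W2 m e mu nu (low (u @ [x]))" by (rule Wset_low[OF W])
  have xB: "x \<notin> B" using C i(2) by blast
  obtain v where v: "?w = v @ [x]" "pat B u v"
    using pat_snoc[of B u x ?w] tauW_spec[OF L] xB by blast
  have W': "v @ [x] \<in> Wset R'" using tauW_Wset[OF W] v by simp
  have rv': "rv R' i = rv R i" using i offs_R'[of i] R'_nth by (simp add: rv_def)
  define y where "y = offs R i + fst (R ! i)"
  have yB: "y \<notin> B"
  proof -
    have "0 < fst (R ! i)" using R nth_mem[OF i(1)] by fastforce
    then have "y \<in> ?C" by (auto simp: blk_def y_def)
    then show ?thesis using C by blast
  qed
  have c: "chi R (u @ [x]) = y # act_gens (rv R i) u"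
    unfolding y_def by (rule chi_eq[OF R W i(1,2)])
  have c': "chi R' ?w = y # act_gens (rv R i) v"
    using chi_eq[OF R'_pos W', of i] i blk_R'[OF i(1,3,4)] R'_nth offs_R'[of i] rv' v by (simp add: y_def)
  have f: "filter (\<lambda>x. x \<in> B) (y # act_gens (rv R i) z) = filter (\<lambda>x. x \<in> B) (z @ [x])" for z
    using act_rv_filter[OF C, of z] xB yB by simp
  have low: "low (chi R (u @ [x])) = low (u @ [x])" unfolding c f ..
  show ?thesis
    unfolding c'
  proof (rule tauW_eqI[symmetric])
    show "W2 m e mu nu (low (chi R (u @ [x])))" using L low by simp
    show "filter (\<lambda>x. x \<in> B) (y # act_gens (rv R i) v) =
        map (\<lambda>x. x + off) (tau_word2 (m, mu) (e, nu) (low (chi R (u @ [x]))))"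
      unfolding f low using tauW_spec[OF L] v by simp
    have P: "pat ?C z (act_gens (rv R i) z)" for z by (rule act_gens_pat) (use set_rv in blast)
    have "list_all2 (\<lambda>x y. x = y \<or> x \<in> B \<and> y \<in> B \<or> x \<in> ?C \<and> y \<in> ?C) (act_gens (rv R i) u) (act_gens (rv R i) v)"
      using v(2) P[of u] P[of v] C unfolding pat_def list_all2_conv_all_nth by (metis disjoint_iff)
    moreover have "filter (\<lambda>x. x \<in> ?C) (act_gens (rv R i) u) = filter (\<lambda>x. x \<in> ?C) (act_gens (rv R i) v)"
      using act_gens_filter[of "rv R i" ?C] set_rv pat_filter[OF v(2), of ?C] C by (metis Int_commute)
    ultimately have "pat B (act_gens (rv R i) u) (act_gens (rv R i) v)"
      using pat_split[of B ?C] C by (simp add: Int_commute)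
    then show "pat B (chi R (u @ [x])) (y # act_gens (rv R i) v)" unfolding c by (simp add: pat_def)
  qed
qed

lemma low_snoc: "x \<in> B \<Longrightarrow> low (u @ [x]) = low u @ [x - off]"
  by simp

lemma filter_promote:
  assumes "off \<le> k + off" "k + h \<le> m + e"
  shows "filter (\<lambda>x. x \<in> B) (act_gens (rev_word (k + off) h) u) = map (\<lambda>x. x + off) (act_gens (rev_word k h) (low u))"
proof -
  have "filter (\<lambda>x. x \<in> B) (act_gens (rev_word (k + off) h) u) = act_gens (rev_word (k + off) h) (filter (\<lambda>x. x \<in> B) u)"
    by (rule act_gens_filter) (use assms in \<open>auto dest!: set_rev_word\<close>)
  also have "\<dots> = act_gens (map (\<lambda>r. r + off) (rev_word k h)) (map (\<lambda>x. x + off) (low u))"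
    unfolding low_shift rev_word_shift ..
  finally show ?thesis unfolding act_gens_shift .
qed

text \<open>On the two blocks cyclage is \<open>chi2\<close> translated by \<open>off\<close>. The
  form \<open>y # act_gens rs u\<close> with all letters in \<open>B\<close> records that the rest
  of the word only moves along.\<close>

lemma chi_inside:
  assumes W: "u @ [x] \<in> Wset R" and x: "x \<in> B"
  shows "\<exists>y rs. chi R (u @ [x]) = y # act_gens rs u \<and> y \<in> B \<and> (\<forall>r\<in>set rs. r \<in> B \<and> Suc r \<in> B) \<and>
    filter (\<lambda>x. x \<in> B) (chi R (u @ [x])) = map (\<lambda>x. x + off) (chi2 m e (low u) (x - off))"
proof (cases "x \<in> blk R q")
  case True
  have c: "chi R (u @ [x]) = (off + m) # act_gens (rev_word (0 + off) m) u"
    using chi_eq[OF R W _ True] q by (simp add: rv_def)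
  have "x - off \<le> m" using True q by (auto simp: blk_def)
  then have "filter (\<lambda>x. x \<in> B) (chi R (u @ [x])) = map (\<lambda>x. x + off) (chi2 m e (low u) (x - off))"
    unfolding c chi2_def using filter_promote[of 0 m u] pos by simp
  then show ?thesis using c pos
    by (intro exI[of _ "off + m"] exI[of _ "rev_word (0 + off) m"]) (auto dest!: set_rev_word)
next
  case False
  then have xp: "x \<in> blk R (Suc q)" using x B by blast
  have c: "chi R (u @ [x]) = (off + m + e) # act_gens (rev_word (m + off) e) u"
    using chi_eq[OF R W _ xp] q off_p by (simp add: rv_def add.commute)
  have "\<not> x - off \<le> m" using xp q off_p by (auto simp: blk_def)
  then have "filter (\<lambda>x. x \<in> B) (chi R (u @ [x])) = map (\<lambda>x. x + off) (chi2 m e (low u) (x - off))"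
    unfolding c chi2_def using filter_promote[of m e u] pos by simp
  then show ?thesis using c pos
    by (intro exI[of _ "off + m + e"] exI[of _ "rev_word (m + off) e"]) (auto dest!: set_rev_word)
qed

end

lemma (in swap) swap': "swap e m nu mu R' q"
  using pos R'_pos q(1) R'_nth by unfold_locales auto

lemma (in swap) chi_commute:
  assumes W: "w \<in> Wset R"
  shows "chi R' (tauW (Suc q) R w) = tauW (Suc q) R (chi R w)"
proof -
  interpret S: swap e m nu mu R' q by (rule swap')
  have off': "offs R' q = off" using offs_R'[of q] q(1) by simp
  have BB: "{offs R' q + 1..offs R' q + e + m} = B" using off' by auto
  have "Blk off m mu w" using Wset_low[OF W] unfolding low_W2 by blast
  then have "count_list w (Suc off) = mu" using pos by (auto simp: Blk_def)
  then have "w \<noteq> []" using pos by auto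
  then obtain u x where w: "w = u @ [x]" by (metis rev_exhaust)
  have "x \<in> {1..total R}" using W w Wset_iff[OF R] by auto
  then obtain i where i: "i < length R" "x \<in> blk R i" using total_blk by blast
  show ?thesis
  proof (cases "i = q \<or> i = Suc q")
    case False
    then show ?thesis using chi_outside[OF _ i] W w by simp
  next
    case True
    then have x: "x \<in> B" using i B by auto
    let ?w = "tauW (Suc q) R w"
    have L: "W2 m e mu nu (low (u @ [x]))" using Wset_low[OF W] unfolding w .
    obtain v z where v: "?w = v @ [z]" "pat B u v" and z: "z \<in> B"
      using pat_snoc[of B u x ?w] tauW_spec[OF L] x w by auto
    have W': "v @ [z] \<in> Wset R'" using tauW_Wset[OF W] v by simp
    have "filter (\<lambda>x. x \<in> B) ?w = map (\<lambda>x. x + off) (tau_word2 (m, mu) (e, nu) (low w))"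
      using tauW_spec[OF L] w by blast
    then have l1: "low ?w = tau_word2 (m, mu) (e, nu) (low w)" by (rule low_eqI)
    have l2: "low ?w = low v @ [z - off]" unfolding v(1) by (rule low_snoc[OF z])
    have l3: "low w = low u @ [x - off]" unfolding w by (rule low_snoc[OF x])
    have t: "tau_word2 (m, mu) (e, nu) (low u @ [x - off]) = low v @ [z - off]"
      by (rule l1[unfolded l2 l3, symmetric])
    have Lu: "W2 m e mu nu (low u @ [x - off])" using L unfolding low_snoc[OF x] .
    obtain y rs where c: "chi R w = y # act_gens rs u" "y \<in> B" "\<forall>r\<in>set rs. r \<in> B \<and> Suc r \<in> B"
      "filter (\<lambda>x. x \<in> B) (chi R w) = map (\<lambda>x. x + off) (chi2 m e (low u) (x - off))"
      using chi_inside[of u x] W x w by auto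
    obtain y' rs' where c': "chi R' ?w = y' # act_gens rs' v" "y' \<in> B" "\<forall>r\<in>set rs'. r \<in> B \<and> Suc r \<in> B"
      "filter (\<lambda>x. x \<in> B) (chi R' ?w) = map (\<lambda>x. x + off) (chi2 e m (low v) (z - off))"
      using S.chi_inside[OF W', unfolded BB, OF z, unfolded off'] unfolding v(1) by blast
    have lc: "low (chi R w) = chi2 m e (low u) (x - off)" by (rule low_eqI[OF c(4)])
    show ?thesis
    proof (rule tauW_eqI[symmetric])
      show "W2 m e mu nu (low (chi R w))" unfolding lc by (rule chi2_W2[OF Lu])
      show "filter (\<lambda>x. x \<in> B) (chi R' ?w) = map (\<lambda>x. x + off) (tau_word2 (m, mu) (e, nu) (low (chi R w)))"
        unfolding lc c'(4) tau_chi2[OF Lu t] ..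
      have "pat B (act_gens rs u) (act_gens rs' v)"
        by (rule pat_trans[OF pat_sym[OF act_gens_pat] pat_trans[OF v(2) act_gens_pat]])
          (use c(3) c'(3) in blast)+
      then show "pat B (chi R w) (chi R' ?w)" unfolding c(1) c'(1) using c(2) c'(2) by (simp add: pat_def)
    qed
  qed
qed

theorem theorem3p5:
  fixes R :: "(nat \<times> nat) list" and p :: nat and w :: "nat list"
  assumes "\<forall>(eta, mu) \<in> set R. 0 < eta \<and> 0 < mu"
    and "1 \<le> p" and "p \<le> length R - 1"
    and "w \<in> Wset R"
  shows "chi (tauR p R) (tauW p R w) = tauW p R (chi R w)"
proof -
  obtain q where p: "p = Suc q" using assms(2) by (cases p) auto
  have len: "Suc q < length R" using assms(2,3) p by simp
  obtain m mu where a: "R ! q = (m, mu)" by force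
  obtain e nu where b: "R ! Suc q = (e, nu)" by force
  have "R ! q \<in> set R" "R ! Suc q \<in> set R" using len by auto
  then have "0 < m" "0 < mu" "0 < e" "0 < nu" using assms(1) a b by fastforce+
  then interpret swap m e mu nu R q using assms(1) len a b by unfold_locales auto
  show ?thesis using chi_commute[OF assms(4)] unfolding p .
qed

end
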